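(* Let $\mathbb{K}$ be a field, let $H=(V,E)$ be a $3$-uniform hypergraph on the vertex set $V=[n]$, and let $d\ge 1$ be an integer. If $d \geq \frac{3}{2}n^2-\frac{15}{2}n+10$, then: (1) $L_H^{\mathbb{K}}(d)$ is a radical complete intersection ideal; (2) $L_H^{\mathbb{K}}(d+1)$ is a prime ideal.
   Context: $[n]=\{1,\dots,n\}$. A hypergraph $H=(V,E)$ consists of a finite vertex set $V$ and a set $E$ of subsets of $V$ (edges), no edge being contained in another; it is $r$-uniform if $|e|=r$ for all $e\in E$. For an integer $d\ge1$ and $e\subset[n]$ put $f_e^{(d)}=\sum_{j=1}^{d}\prod_{i\in e}x_{ij}$ in $S=\mathbb{K}[x_{ij}\mid i\in[n],\,j\in[d]]$. The Lovász–Saks–Schrijver (LSS) ideal of $H$ is $L_H^{\mathbb{K}}(d)=(f_e^{(d)}\mid e\in E)\subset S$. A homogeneous ideal $I\subset S$ is a complete intersection if $\mu(I)=\mathrm{ht}(I)$, where $\mu(I)$ is the cardinality of a minimal homogeneous generating set of $I$. *)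

theory Defs
  imports
    "HOL-Algebra.Algebra"
    "HOL-Library.Poly_Mapping"
    "HOL-Library.Extended_Nat"
    Complex_Main
begin

section \<open>Hypergraphs\<close>

definition hypergraph :: "'a set \<Rightarrow> 'a set set \<Rightarrow> bool" where
  "hypergraph V E \<longleftrightarrow>
     finite V \<and> (\<forall>e\<in>E. e \<subseteq> V) \<and> (\<forall>e\<in>E. \<forall>f\<in>E. e \<subseteq> f \<longrightarrow> e = f)"

definition uniform :: "nat \<Rightarrow> 'a set set \<Rightarrow> bool" where
  "uniform r E \<longleftrightarrow> (\<forall>e\<in>E. card e = r)"


section \<open>Polynomial rings\<close>

text \<open>A monomial is a finitely supported exponent vector, and a polynomial is a finitely
  supported map from monomials to coefficients; addition and multiplication (convolution) are
  those of the type of finitely supported maps.\<close>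

type_synonym ('x, 'k) mpoly = "('x \<Rightarrow>\<^sub>0 nat) \<Rightarrow>\<^sub>0 'k"

definition Var :: "'x \<Rightarrow> ('x, 'k::field) mpoly" where
  "Var x = Poly_Mapping.single (Poly_Mapping.single x 1) 1"

text \<open>The polynomial ring over the field \<open>'k\<close> whose set of variables is exactly \<open>Vs\<close>.\<close>

definition mpoly_ring :: "'x set \<Rightarrow> ('x, 'k::field) mpoly ring" where
  "mpoly_ring Vs =
     \<lparr>carrier = {p. \<forall>m\<in>Poly_Mapping.keys p. Poly_Mapping.keys m \<subseteq> Vs},
      monoid.mult = (*), one = 1, ring.zero = 0, add = (+)\<rparr>"

lemma plus_in_mpoly_ring:
  fixes p q :: "('x, 'k::field) mpoly"
  assumes "p \<in> carrier (mpoly_ring Vs)" and "q \<in> carrier (mpoly_ring Vs)"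
  shows "p + q \<in> carrier (mpoly_ring Vs)"
  using assms Poly_Mapping.keys_add[of p q] unfolding mpoly_ring_def by fastforce

lemma times_in_mpoly_ring:
  fixes p q :: "('x, 'k::field) mpoly"
  assumes "p \<in> carrier (mpoly_ring Vs)" and "q \<in> carrier (mpoly_ring Vs)"
  shows "p * q \<in> carrier (mpoly_ring Vs)"
proof -
  have "Poly_Mapping.keys m \<subseteq> Vs" if m: "m \<in> Poly_Mapping.keys (p * q)" for m
  proof -
    obtain a b where "a \<in> Poly_Mapping.keys p" "b \<in> Poly_Mapping.keys q" "m = a + b"
      using m keys_mult[of p q] by blast
    moreover from this have "Poly_Mapping.keys a \<subseteq> Vs" "Poly_Mapping.keys b \<subseteq> Vs"
      using assms by (auto simp: mpoly_ring_def)
    ultimately show ?thesis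
      using Poly_Mapping.keys_add[of a b] by blast
  qed
  then show ?thesis
    by (simp add: mpoly_ring_def)
qed

lemma mpoly_ring_simps [simp]:
  "x \<otimes>\<^bsub>mpoly_ring Vs\<^esub> y = x * y" "x \<oplus>\<^bsub>mpoly_ring Vs\<^esub> y = x + y"
  "\<zero>\<^bsub>mpoly_ring Vs\<^esub> = 0" "\<one>\<^bsub>mpoly_ring Vs\<^esub> = 1"
  by (simp_all add: mpoly_ring_def)

lemma cring_mpoly_ring: "cring (mpoly_ring Vs :: ('x, 'k::field) mpoly ring)"
proof (rule cringI)
  have zero: "(0 :: ('x, 'k) mpoly) \<in> carrier (mpoly_ring Vs)"
    and one: "(1 :: ('x, 'k) mpoly) \<in> carrier (mpoly_ring Vs)"
    by (simp_all add: mpoly_ring_def)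
  show "abelian_group (mpoly_ring Vs :: ('x, 'k) mpoly ring)"
  proof (rule abelian_groupI)
    fix p :: "('x, 'k) mpoly"
    assume "p \<in> carrier (mpoly_ring Vs)"
    then have "- p \<in> carrier (mpoly_ring Vs)"
      by (simp add: mpoly_ring_def)
    moreover have "- p \<oplus>\<^bsub>mpoly_ring Vs\<^esub> p = \<zero>\<^bsub>mpoly_ring Vs\<^esub>"
      by simp
    ultimately show "\<exists>q\<in>carrier (mpoly_ring Vs). q \<oplus>\<^bsub>mpoly_ring Vs\<^esub> p = \<zero>\<^bsub>mpoly_ring Vs\<^esub>"
      by blast
  qed (simp_all add: zero plus_in_mpoly_ring add_ac)
  show "Group.comm_monoid (mpoly_ring Vs :: ('x, 'k) mpoly ring)"
    by (rule comm_monoidI) (simp_all add: one times_in_mpoly_ring mult_ac)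
qed (simp add: distrib_right)

lemma Var_in_mpoly_ring:
  "x \<in> Vs \<Longrightarrow> (Var x :: ('x, 'k::field) mpoly) \<in> carrier (mpoly_ring Vs)"
  by (simp add: mpoly_ring_def Var_def)


section \<open>Homogeneous ideals\<close>

text \<open>Standard grading, every variable having degree 1. The zero polynomial is homogeneous.\<close>

definition homogeneous :: "('x, 'k::field) mpoly \<Rightarrow> bool" where
  "homogeneous p \<longleftrightarrow>
     (\<exists>t. \<forall>m\<in>Poly_Mapping.keys p. (\<Sum>x\<in>Poly_Mapping.keys m. Poly_Mapping.lookup m x) = t)"

definition homogeneous_generating_set ::
  "'x set \<Rightarrow> ('x, 'k::field) mpoly set \<Rightarrow> ('x, 'k) mpoly set \<Rightarrow> bool" where
  "homogeneous_generating_set Vs I G \<longleftrightarrow>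
     G \<subseteq> carrier (mpoly_ring Vs) \<and> (\<forall>g\<in>G. homogeneous g) \<and> Idl\<^bsub>mpoly_ring Vs\<^esub> G = I"

definition minimal_homogeneous_generating_set ::
  "'x set \<Rightarrow> ('x, 'k::field) mpoly set \<Rightarrow> ('x, 'k) mpoly set \<Rightarrow> bool" where
  "minimal_homogeneous_generating_set Vs I G \<longleftrightarrow>
     homogeneous_generating_set Vs I G \<and>
     (\<forall>G'. G' \<subset> G \<longrightarrow> \<not> homogeneous_generating_set Vs I G')"

definition homogeneous_ideal :: "'x set \<Rightarrow> ('x, 'k::field) mpoly set \<Rightarrow> bool" where
  "homogeneous_ideal Vs I \<longleftrightarrow> (\<exists>G. homogeneous_generating_set Vs I G)"

text \<open>For a finitely generated homogeneous ideal all minimal homogeneous generating sets are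
  finite and have the same cardinality (graded Nakayama lemma), so the description is proper.\<close>

definition mu :: "'x set \<Rightarrow> ('x, 'k::field) mpoly set \<Rightarrow> nat" where
  "mu Vs I =
     (THE c. \<exists>G. minimal_homogeneous_generating_set Vs I G \<and> finite G \<and> card G = c)"


section \<open>Radical ideals, height, complete intersections\<close>

definition radical :: "('a, 'b) ring_scheme \<Rightarrow> 'a set \<Rightarrow> 'a set" where
  "radical R I = {a \<in> carrier R. \<exists>k::nat. a [^]\<^bsub>R\<^esub> k \<in> I}"

definition radical_ideal :: "'a set \<Rightarrow> ('a, 'b) ring_scheme \<Rightarrow> bool" where
  "radical_ideal I R \<longleftrightarrow> ideal I R \<and> radical R I = I"

text \<open>The height of a prime \<open>P\<close> is the supremum of the lengths \<open>k\<close> of strict chains of primes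
  \<open>C 0 \<subset> \<dots> \<subset> C k = P\<close>; the height of an ideal is the infimum of the heights of the primes
  containing it (so the unit ideal has height \<open>\<infinity>\<close>).\<close>

definition prime_height :: "('a, 'b) ring_scheme \<Rightarrow> 'a set \<Rightarrow> enat" where
  "prime_height R P =
     (SUP k \<in> {k::nat. \<exists>C :: nat \<Rightarrow> 'a set. (\<forall>i\<le>k. primeideal (C i) R) \<and>
                  (\<forall>i<k. C i \<subset> C (Suc i)) \<and> C k = P}. enat k)"

definition height :: "('a, 'b) ring_scheme \<Rightarrow> 'a set \<Rightarrow> enat" where
  "height R I = (INF P \<in> {P. primeideal P R \<and> I \<subseteq> P}. prime_height R P)"

definition complete_intersection :: "'x set \<Rightarrow> ('x, 'k::field) mpoly set \<Rightarrow> bool" where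
  "complete_intersection Vs I \<longleftrightarrow>
     homogeneous_ideal Vs I \<and> enat (mu Vs I) = height (mpoly_ring Vs) I"


section \<open>Lovasz--Saks--Schrijver ideals\<close>

text \<open>The variable \<open>x\<^sub>i\<^sub>j\<close> is \<open>Var (i, j)\<close>.\<close>

definition lss_vars :: "nat \<Rightarrow> nat \<Rightarrow> (nat \<times> nat) set" where
  "lss_vars n d = {1..n} \<times> {1..d}"

definition lss_poly :: "nat \<Rightarrow> nat set \<Rightarrow> (nat \<times> nat, 'k::field) mpoly" where
  "lss_poly d e = (\<Sum>j=1..d. \<Prod>i\<in>e. Var (i, j))"

definition lss_ideal :: "nat \<Rightarrow> nat set set \<Rightarrow> nat \<Rightarrow> (nat \<times> nat, 'k::field) mpoly set" where
  "lss_ideal n E d = Idl\<^bsub>mpoly_ring (lss_vars n d)\<^esub> (lss_poly d ` E)"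

lemma lss_poly_in_mpoly_ring:
  assumes "e \<subseteq> {1..n}"
  shows "(lss_poly d e :: (nat \<times> nat, 'k::field) mpoly) \<in> carrier (mpoly_ring (lss_vars n d))"
proof -
  interpret cring "mpoly_ring (lss_vars n d) :: (nat \<times> nat, 'k) mpoly ring"
    by (rule cring_mpoly_ring)
  let ?C = "carrier (mpoly_ring (lss_vars n d)) :: (nat \<times> nat, 'k) mpoly set"
  have var: "Var (i, j) \<in> ?C" if "i \<in> {1..n}" "j \<in> {1..d}" for i j
    using that by (intro Var_in_mpoly_ring) (simp add: lss_vars_def)
  have zero: "0 \<in> ?C" and one: "1 \<in> ?C"
    using zero_closed one_closed by simp_all
  have "(\<Prod>i\<in>A. Var (i, j)) \<in> ?C" if "finite A" "A \<subseteq> {1..n}" "j \<in> {1..d}" for A j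
    using that by induction (simp_all add: one times_in_mpoly_ring var)
  moreover have "finite e"
    using assms finite_subset by blast
  ultimately have mon: "(\<Prod>i\<in>e. Var (i, j)) \<in> ?C" if "j \<in> {1..d}" for j
    using assms that by blast
  have "(\<Sum>j\<in>A. \<Prod>i\<in>e. Var (i, j)) \<in> ?C" if "finite A" "A \<subseteq> {1..d}" for A
    using that by induction (simp_all add: zero plus_in_mpoly_ring mon)
  then show ?thesis
    by (simp add: lss_poly_def)
qed

end

theory Submission
  imports Defs "HOL-Library.Product_Lexorder"
begin

text \<open>
Write \<open>f e\<close> for the LSS polynomial of an edge \<open>e\<close>: one squarefree monomial for each column \<open>j\<close>. The
  proof chooses, for every edge, the column whose monomial is to lead.

  To a triple \<open>i < j < k\<close> attach the pair \<open>(i + j, j + k)\<close>. Two distinct triples with the same pair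
  are disjoint, and the number of pairs is at most \<open>3/2 n\<^sup>2 - 15/2 n + 10\<close>
  (\<open>card_triple_classes\<close>). So the edges split into at most \<open>d\<close> matchings. List these by
  decreasing pair. For every position \<open>l\<close> there is an integer weight on the vertices whose sum
  vanishes on the edges of the \<open>l\<close>-th matching and is negative on the edges of all later ones
  (\<open>triple_weight_zero\<close>, \<open>triple_weight_neg\<close>). This is a positive matching decomposition in the
  sense of Conca and Welker, normalised to weight zero on the matching itself. Giving the
  variables of column \<open>l\<close> the \<open>l\<close>-th weight, and comparing these weights one column after the
  other, yields a monomial order in which \<open>f e\<close> is led by its monomial in column \<open>l\<close> when \<open>e\<close> lies
  in the \<open>l\<close>-th matching (\<open>column_order_leading\<close>). These leading monomials are squarefree, and
  pairwise coprime because edges with the same column are disjoint.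

  Coprime leading monomials make the \<open>f e\<close> a Groebner basis and a regular sequence
  (\<open>leading_span\<close>, \<open>regular_sequence\<close>). The ideal is then radical because the leading monomials are
  squarefree. Its height is the number of edges: a prime that contains the ideal lies above a
  chain of that length, by regularity and a prime avoidance argument (\<open>chain_below\<close>); and
  if one variable is deleted for each leading monomial, some prime above the ideal contains no
  nonzero polynomial in the remaining variables, and such a prime cannot lie above a longer chain,
  by counting monomials (\<open>chain_length_le\<close>). The number of minimal generators is the
  number of edges as well, since the \<open>f e\<close> are linearly independent forms of one degree
  (\<open>equigenerated_mu\<close>).

  For primality there is one more column than there are matchings. Add the columns and matchings
  one at a time, starting with the spare column and no edge. When column \<open>l\<close> is added, the weight
  makes its monomial in \<open>f e\<close> negligible for every edge \<open>e\<close> of a later matching, so that up to terms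
  of lower weight these generators lie in the prime ideal \<open>J\<close> already reached; for an
  edge \<open>e\<close> of the \<open>l\<close>-th matching, \<open>f e\<close> is \<open>x_e + g_e\<close> with \<open>x_e\<close> a product of new variables, disjoint
  for different \<open>e\<close>, and \<open>g_e\<close> not in \<open>J\<close>, thanks to the spare column. A
  quotient by relations \<open>x_e = - g_e\<close> of this kind is again a domain: it is graded by the
  differences of exponents along the edges, and each nonzero graded piece is free of rank one over
  the old domain.
  The theorem \<open>span_prime\<close> carries out this argument with leading terms.
\<close>

section \<open>Monomials\<close>

abbreviation keys :: "('a \<Rightarrow>\<^sub>0 'b::zero) \<Rightarrow> 'a set" where
  "keys \<equiv> Poly_Mapping.keys"

abbreviation lookup :: "('a \<Rightarrow>\<^sub>0 'b::zero) \<Rightarrow> 'a \<Rightarrow> 'b" where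
  "lookup \<equiv> Poly_Mapping.lookup"

abbreviation single :: "'a \<Rightarrow> 'b \<Rightarrow> 'a \<Rightarrow>\<^sub>0 'b::zero" where
  "single \<equiv> Poly_Mapping.single"

definition mdeg :: "('x \<Rightarrow>\<^sub>0 nat) \<Rightarrow> nat" where
  "mdeg m = (\<Sum>x\<in>keys m. lookup m x)"

lemma mdeg_superset:
  assumes "finite A" "keys m \<subseteq> A"
  shows "mdeg m = (\<Sum>x\<in>A. lookup m x)"
  unfolding mdeg_def
  by (rule sum.mono_neutral_left) (use assms in \<open>auto simp: in_keys_iff\<close>)

lemma mdeg_add: "mdeg (a + b) = mdeg a + mdeg b"
proof -
  let ?A = "keys a \<union> keys b"
  have "keys (a + b) \<subseteq> ?A"
    by (rule Poly_Mapping.keys_add)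
  then show ?thesis
    by (simp add: mdeg_superset[of ?A] lookup_add sum.distrib)
qed

lemma keys_add_nat:
  "keys (a + b :: 'x \<Rightarrow>\<^sub>0 nat) = keys a \<union> keys b"
  by (auto simp: in_keys_iff lookup_add)

text \<open>Divisibility of monomials. The order \<open>\<le>\<close> of the type of exponent vectors is lexicographic, hence a
  separate relation.\<close>

definition mdvd :: "('x \<Rightarrow>\<^sub>0 nat) \<Rightarrow> ('x \<Rightarrow>\<^sub>0 nat) \<Rightarrow> bool" where
  "mdvd a b \<longleftrightarrow> (\<forall>x. lookup a x \<le> lookup b x)"

lemma mdvd_add_right [simp]: "mdvd a (a + b)" "mdvd a (b + a)"
  by (simp_all add: mdvd_def lookup_add)

lemma mdvdE:
  assumes "mdvd a b"
  obtains c where "b = c + a"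
proof
  show "b = (b - a) + a"
    using assms by (intro poly_mapping_eqI) (simp add: mdvd_def lookup_add lookup_minus)
qed

lemma mdvd_trans: "mdvd a b \<Longrightarrow> mdvd b c \<Longrightarrow> mdvd a c"
  unfolding mdvd_def using order_trans by blast

lemma mdvd_add: "mdvd a b \<Longrightarrow> mdvd a (b + c)" "mdvd a b \<Longrightarrow> mdvd a (c + b)"
  using mdvd_trans mdvd_add_right by blast+

lemma mdvd_coprime_cancel:
  assumes "mdvd a (b + c)" "keys a \<inter> keys c = {}"
  shows "mdvd a b"
  unfolding mdvd_def
proof
  fix x
  show "lookup a x \<le> lookup b x"
  proof (cases "x \<in> keys a")
    case True
    then have "lookup c x = 0"
      using assms(2) by (auto simp: in_keys_iff)
    then show ?thesis
      using assms(1) unfolding mdvd_def lookup_add by (metis add.right_neutral)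
  qed (simp add: in_keys_iff)
qed

section \<open>Polynomials in a given set of variables\<close>

abbreviation polys :: "'x set \<Rightarrow> ('x, 'k::field) mpoly set" where
  "polys V \<equiv> carrier (mpoly_ring V)"

lemma polys_iff: "p \<in> polys V \<longleftrightarrow> (\<forall>m\<in>keys p. keys m \<subseteq> V)"
  by (simp add: mpoly_ring_def)

lemma polys_mono: "V \<subseteq> W \<Longrightarrow> p \<in> polys V \<Longrightarrow> p \<in> polys W"
  unfolding polys_iff by blast

lemma polys_0 [simp]: "0 \<in> polys V" and polys_1 [simp]: "1 \<in> polys V"
  by (simp_all add: polys_iff)

lemma polys_uminus [simp]: "- p \<in> polys V \<longleftrightarrow> p \<in> polys V"
  by (simp add: polys_iff)

lemma polys_diff: "p \<in> polys V \<Longrightarrow> q \<in> polys V \<Longrightarrow> p - q \<in> polys V"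
  using plus_in_mpoly_ring[of p V "- q"] by simp

lemma polys_sum: "(\<And>i. i \<in> A \<Longrightarrow> f i \<in> polys V) \<Longrightarrow> sum f A \<in> polys V"
  by (induction A rule: infinite_finite_induct) (auto intro: plus_in_mpoly_ring)

lemma polys_power: "p \<in> polys V \<Longrightarrow> p ^ k \<in> polys V"
  by (induction k) (auto intro: times_in_mpoly_ring)

lemma polys_single: "c = 0 \<or> keys m \<subseteq> V \<Longrightarrow> single m c \<in> polys V"
  by (auto simp: polys_iff)

lemmas polys_intros = plus_in_mpoly_ring times_in_mpoly_ring polys_diff polys_0 polys_1
  polys_single polys_power polys_sum

lemma cring_pow_eq: "(p :: ('x, 'k::field) mpoly) [^]\<^bsub>mpoly_ring V\<^esub> (k::nat) = p ^ k"
proof -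
  interpret cring "mpoly_ring V :: ('x, 'k) mpoly ring" by (rule cring_mpoly_ring)
  show ?thesis by (induction k) (simp_all add: mult.commute)
qed

section \<open>Ideals of the polynomial ring\<close>

lemma mpoly_idealI:
  fixes I :: "('x, 'k::field) mpoly set"
  assumes sub: "I \<subseteq> polys V" and 0: "0 \<in> I"
    and add: "\<And>a b. a \<in> I \<Longrightarrow> b \<in> I \<Longrightarrow> a + b \<in> I"
    and mult: "\<And>h a. h \<in> polys V \<Longrightarrow> a \<in> I \<Longrightarrow> h * a \<in> I"
  shows "ideal I (mpoly_ring V)"
proof -
  interpret cring "mpoly_ring V :: ('x, 'k) mpoly ring" by (rule cring_mpoly_ring)
  have inv: "\<ominus>\<^bsub>mpoly_ring V\<^esub> a = - a" if "a \<in> polys V" for a :: "('x, 'k) mpoly"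
    using that by (intro minus_equality) simp_all
  show ?thesis
  proof (rule idealI)
    show "ring (mpoly_ring V :: ('x, 'k) mpoly ring)" by (rule ring_axioms)
    show "subgroup I (add_monoid (mpoly_ring V))"
    proof
      fix a assume a: "a \<in> I"
      have "- a = (- 1) * a" by simp
      also have "\<dots> \<in> I" using a by (intro mult) simp_all
      finally show "inv\<^bsub>add_monoid (mpoly_ring V)\<^esub> a \<in> I"
        using inv a sub unfolding a_inv_def by auto
    qed (use sub 0 add in auto)
    show "x \<otimes>\<^bsub>mpoly_ring V\<^esub> a \<in> I" "a \<otimes>\<^bsub>mpoly_ring V\<^esub> x \<in> I"
      if "a \<in> I" "x \<in> polys V" for a x
      using mult[OF that(2,1)] by (simp_all add: mult.commute[of a x])
  qed
qed

context
  fixes I :: "('x, 'k::field) mpoly set" and V :: "'x set"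
  assumes I: "ideal I (mpoly_ring V)"
begin

interpretation R: ideal I "mpoly_ring V" by (rule I)

lemma ideal_sub: "I \<subseteq> polys V"
  using R.a_subset .

lemma ideal_0: "0 \<in> I"
  using additive_subgroup.zero_closed[OF ideal.axioms(1)[OF I]] by simp

lemma ideal_add: "a \<in> I \<Longrightarrow> b \<in> I \<Longrightarrow> a + b \<in> I"
  using additive_subgroup.a_closed[OF ideal.axioms(1)[OF I], of a b] by simp

lemma ideal_mult: "h \<in> polys V \<Longrightarrow> a \<in> I \<Longrightarrow> h * a \<in> I"
  using R.I_l_closed[of a h] by simp

lemma ideal_mult': "h \<in> polys V \<Longrightarrow> a \<in> I \<Longrightarrow> a * h \<in> I"
  using ideal_mult[of h a] by (simp add: mult.commute[of a h])

lemma ideal_uminus: "a \<in> I \<Longrightarrow> - a \<in> I"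
  using ideal_mult[of "- 1" a] by simp

lemma ideal_diff: "a \<in> I \<Longrightarrow> b \<in> I \<Longrightarrow> a - b \<in> I"
  using ideal_add[of a "- b"] ideal_uminus by simp

lemma ideal_cong: "a - b \<in> I \<Longrightarrow> a \<in> I \<longleftrightarrow> b \<in> I"
  using ideal_add[of "a - b" b] ideal_diff[of a "a - b"] by auto

end

lemma mpoly_genideal:
  fixes S :: "('x, 'k::field) mpoly set"
  assumes "S \<subseteq> polys V"
  shows "ideal (Idl\<^bsub>mpoly_ring V\<^esub> S) (mpoly_ring V)" "S \<subseteq> Idl\<^bsub>mpoly_ring V\<^esub> S"
    and "\<And>I. ideal I (mpoly_ring V) \<Longrightarrow> S \<subseteq> I \<Longrightarrow> Idl\<^bsub>mpoly_ring V\<^esub> S \<subseteq> I"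
proof -
  interpret cring "mpoly_ring V :: ('x, 'k) mpoly ring" by (rule cring_mpoly_ring)
  show "ideal (Idl\<^bsub>mpoly_ring V\<^esub> S) (mpoly_ring V)" "S \<subseteq> Idl\<^bsub>mpoly_ring V\<^esub> S"
    using genideal_ideal genideal_self assms by auto
  show "Idl\<^bsub>mpoly_ring V\<^esub> S \<subseteq> I" if "ideal I (mpoly_ring V)" "S \<subseteq> I" for I
    using genideal_minimal that by auto
qed

lemma Idl_mono_polys:
  fixes S T :: "('x, 'k::field) mpoly set"
  assumes "S \<subseteq> T" "T \<subseteq> polys V"
  shows "Idl\<^bsub>mpoly_ring V\<^esub> S \<subseteq> Idl\<^bsub>mpoly_ring V\<^esub> T"
  using mpoly_genideal(3)[of S V "Idl\<^bsub>mpoly_ring V\<^esub> T"] mpoly_genideal(1,2)[of T V] assms by blast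

text \<open>The ideal generated by \<open>S\<close> and one further \<open>f\<close> consists of the sums \<open>h + q * f\<close>: this is what makes
  an induction on the number of generators possible.\<close>

lemma Idl_insert_polys:
  fixes S :: "('x, 'k::field) mpoly set"
  assumes S: "S \<subseteq> polys V" and f: "f \<in> polys V"
    and p: "p \<in> Idl\<^bsub>mpoly_ring V\<^esub> (insert f S)"
  obtains h q where "h \<in> Idl\<^bsub>mpoly_ring V\<^esub> S" "q \<in> polys V" "p = h + q * f"
proof -
  let ?J = "Idl\<^bsub>mpoly_ring V\<^esub> S"
  let ?I = "{h + q * f |h q. h \<in> ?J \<and> q \<in> polys V}"
  note J = mpoly_genideal(1)[OF S] and sub = mpoly_genideal(2)[OF S]
  have "ideal ?I (mpoly_ring V)"
  proof (rule mpoly_idealI)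
    show "?I \<subseteq> polys V"
      using ideal_sub[OF J] f by (auto intro!: polys_intros)
    show "0 \<in> ?I"
      using ideal_0[OF J] polys_0[of V] by (smt (verit) add_0 mem_Collect_eq mult_zero_left)
    fix a b assume "a \<in> ?I" "b \<in> ?I"
    then obtain h q h' q' where "a = h + q * f" "b = h' + q' * f"
      and *: "h \<in> ?J" "h' \<in> ?J" "q \<in> polys V" "q' \<in> polys V" by blast
    then have "a + b = (h + h') + (q + q') * f" by (simp add: algebra_simps)
    with * show "a + b \<in> ?I"
      using ideal_add[OF J] plus_in_mpoly_ring by blast
  next
    fix g a :: "('x, 'k) mpoly" assume g: "g \<in> polys V" and "a \<in> ?I"
    then obtain h q where "a = h + q * f" and *: "h \<in> ?J" "q \<in> polys V" by blast
    then have "g * a = g * h + (g * q) * f" by (simp add: algebra_simps)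
    with * g show "g * a \<in> ?I"
      using ideal_mult[OF J] times_in_mpoly_ring by blast
  qed
  moreover have "insert f S \<subseteq> ?I"
  proof -
    have "f = 0 + 1 * f" by simp
    then have "f \<in> ?I" using ideal_0[OF J] polys_1 by blast
    moreover have "s \<in> ?I" if "s \<in> S" for s
    proof -
      have "s = s + 0 * f" by simp
      then show ?thesis using that sub polys_0 by blast
    qed
    ultimately show ?thesis by blast
  qed
  ultimately have "p \<in> ?I"
    using mpoly_genideal(3)[of "insert f S" V ?I] S f p by blast
  then show ?thesis using that by blast
qed

section \<open>Monomial orders and leading monomials\<close>

text \<open>Refining the total degree makes such an order a well-order on the monomials in finitely many
  variables (\<open>wf_monomial_order\<close>).\<close>

locale monomial_order =
  fixes lt :: "('x \<Rightarrow>\<^sub>0 nat) \<Rightarrow> ('x \<Rightarrow>\<^sub>0 nat) \<Rightarrow> bool"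
  assumes lt_irrefl: "\<not> lt a a"
    and lt_trans: "lt a b \<Longrightarrow> lt b c \<Longrightarrow> lt a c"
    and lt_total: "a \<noteq> b \<Longrightarrow> lt a b \<or> lt b a"
    and lt_add: "lt a b \<Longrightarrow> lt (a + c) (b + c)"
    and lt_deg: "lt a b \<Longrightarrow> mdeg a \<le> mdeg b"
begin

lemma lt_asym: "lt a b \<Longrightarrow> \<not> lt b a"
  using lt_trans lt_irrefl by blast

lemma lt_add_mono:
  assumes "a = a' \<or> lt a a'" "b = b' \<or> lt b b'" "a \<noteq> a' \<or> b \<noteq> b'"
  shows "lt (a + b) (a' + b')"
proof -
  have *: "lt (a + b) (a' + b)" if "lt a a'" for b
    using that lt_add by blast
  have **: "lt (a + b) (a + b')" if "lt b b'" for a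
    using that lt_add[of b b' a] by (simp add: add.commute)
  show ?thesis
    using assms(1)
  proof
    assume "a = a'"
    then show ?thesis using assms(2,3) ** by blast
  next
    assume "lt a a'"
    then have "lt (a + b) (a' + b)" by (rule *)
    moreover have "a' + b = a' + b' \<or> lt (a' + b) (a' + b')" using assms(2) ** by blast
    ultimately show ?thesis using lt_trans by metis
  qed
qed

end

lemma bounded_monomials_card:
  fixes V :: "'x set" and N :: nat
  assumes "finite V"
  defines "A \<equiv> {m :: 'x \<Rightarrow>\<^sub>0 nat. keys m \<subseteq> V \<and> (\<forall>x. lookup m x \<le> N)}"
  shows "finite A" "card A = (N + 1) ^ card V"
proof -
  define g where "g f = Abs_poly_mapping (\<lambda>x. if x \<in> V then f x else 0)" for f :: "'x \<Rightarrow> nat"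
  have g: "lookup (g f) x = (if x \<in> V then f x else 0)" for f x
  proof -
    have "finite {x. (if x \<in> V then f x else 0) \<noteq> 0}"
      using assms(1) by (rule finite_subset[rotated]) auto
    then show ?thesis by (simp add: g_def)
  qed
  have "bij_betw (\<lambda>m. restrict (lookup m) V) A (PiE V (\<lambda>_. {..N}))"
  proof (rule bij_betwI[where g = g])
    show "(\<lambda>m. restrict (lookup m) V) \<in> A \<rightarrow> PiE V (\<lambda>_. {..N})"
      by (auto simp: A_def)
    show "g \<in> PiE V (\<lambda>_. {..N}) \<rightarrow> A"
    proof
      fix f assume f: "f \<in> PiE V (\<lambda>_. {..N})"
      have "keys (g f) \<subseteq> V"
        using g[of f] by (auto simp: in_keys_iff split: if_splits)
      moreover have "lookup (g f) x \<le> N" for x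
        using g[of f x] PiE_mem[OF f, of x] by auto
      ultimately show "g f \<in> A" by (simp add: A_def)
    qed
    show "g (restrict (lookup m) V) = m" if "m \<in> A" for m
    proof (rule poly_mapping_eqI)
      fix x
      have "x \<notin> V \<Longrightarrow> x \<notin> keys m" using that unfolding A_def by blast
      then show "lookup (g (restrict (lookup m) V)) x = lookup m x"
        by (cases "x \<in> V") (simp_all add: g in_keys_iff)
    qed
    show "restrict (lookup (g f)) V = f" if "f \<in> PiE V (\<lambda>_. {..N})" for f
      by (rule PiE_ext[where k = V and s = "\<lambda>_. UNIV"]) (use that in \<open>auto simp: g PiE_iff\<close>)
  qed
  moreover have "finite (PiE V (\<lambda>_. {..N}))" "card (PiE V (\<lambda>_. {..N})) = (N + 1) ^ card V"
    using assms(1) by (auto simp: finite_PiE card_PiE)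
  ultimately show "finite A" "card A = (N + 1) ^ card V"
    using bij_betw_finite bij_betw_same_card by metis+
qed

context monomial_order
begin

lemma ex_max:
  assumes "finite A" "A \<noteq> {}"
  shows "\<exists>m\<in>A. \<forall>m'\<in>A. m' = m \<or> lt m' m"
  using assms
proof (induction rule: finite_ne_induct)
  case (insert x F)
  then obtain m where m: "m \<in> F" "\<forall>m'\<in>F. m' = m \<or> lt m' m" by blast
  consider "x = m \<or> lt x m" | "lt m x" using lt_total by blast
  then show ?case
  proof cases
    case 1
    then have "\<forall>m'\<in>insert x F. m' = m \<or> lt m' m" using m by auto
    then show ?thesis using m(1) by blast
  next
    case 2
    then have "lt m' x" if "m' \<in> F" for m' using m that lt_trans by metis
    then show ?thesis by blast
  qed
qed auto

lemma ex_min: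
  assumes "finite A" "A \<noteq> {}"
  shows "\<exists>m\<in>A. \<forall>m'\<in>A. m' = m \<or> lt m m'"
  using assms
proof (induction rule: finite_ne_induct)
  case (insert x F)
  then obtain m where m: "m \<in> F" "\<forall>m'\<in>F. m' = m \<or> lt m m'" by blast
  consider "x = m \<or> lt m x" | "lt x m" using lt_total by blast
  then show ?case
  proof cases
    case 1
    then have "\<forall>m'\<in>insert x F. m' = m \<or> lt m m'" using m by auto
    then show ?thesis using m(1) by blast
  next
    case 2
    then have "lt x m'" if "m' \<in> F" for m' using m that lt_trans by metis
    then show ?thesis by blast
  qed
qed auto

text \<open>Below a given monomial only finitely many degrees, hence finitely many monomials, are available.\<close>

lemma wf_monomial_order:
  assumes "finite V"
  shows "wf {(a, b). lt a b \<and> keys a \<subseteq> V \<and> keys b \<subseteq> V}" (is "wf ?r")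
proof (rule wfI_min)
  fix x :: "'x \<Rightarrow>\<^sub>0 nat" and Q assume x: "x \<in> Q"
  show "\<exists>z\<in>Q. \<forall>y. (y, z) \<in> ?r \<longrightarrow> y \<notin> Q"
  proof (rule ccontr)
    assume contra: "\<not> ?thesis"
    define S where "S = {m. keys m \<subseteq> V \<and> mdeg m \<le> mdeg x} \<inter> Q"
    have "\<exists>y\<in>Q. (y, x) \<in> ?r" using contra x by blast
    then have "x \<in> S" using x by (auto simp: S_def)
    have "lookup m y \<le> mdeg x" if "m \<in> S" for m y
    proof (cases "y \<in> keys m")
      case True
      then have "lookup m y \<le> mdeg m"
        unfolding mdeg_def by (rule member_le_sum) auto
      then show ?thesis using that by (simp add: S_def)
    qed (simp add: in_keys_iff)
    then have "S \<subseteq> {m. keys m \<subseteq> V \<and> (\<forall>y. lookup m y \<le> mdeg x)}"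
      by (auto simp: S_def)
    then have "finite S" using bounded_monomials_card(1)[OF assms] finite_subset by blast
    moreover have "\<exists>y\<in>S. lt y z" if "z \<in> S" for z
      using contra that lt_deg unfolding S_def by fastforce
    ultimately show False
      using ex_min[of S] \<open>x \<in> S\<close> lt_asym lt_irrefl by (metis empty_iff)
  qed
qed

text \<open>The leading monomial, unspecified for the zero polynomial.\<close>

definition lm :: "('x, 'k::field) mpoly \<Rightarrow> 'x \<Rightarrow>\<^sub>0 nat" where
  "lm p = (THE m. m \<in> keys p \<and> (\<forall>m'\<in>keys p. m' = m \<or> lt m' m))"

lemma lm_eqI:
  assumes "m \<in> keys p" "\<And>m'. m' \<in> keys p \<Longrightarrow> m' = m \<or> lt m' m"
  shows "lm p = m"
  unfolding lm_def
proof (rule the_equality)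
  show "m \<in> keys p \<and> (\<forall>m'\<in>keys p. m' = m \<or> lt m' m)"
    using assms by blast
  show "m'' = m" if "m'' \<in> keys p \<and> (\<forall>m'\<in>keys p. m' = m'' \<or> lt m' m'')"
    for m''
    using assms(1) assms(2)[of m''] that lt_asym[of m'' m] by auto
qed

lemma lm_props:
  assumes "p \<noteq> 0"
  shows "lm p \<in> keys p" "m \<in> keys p \<Longrightarrow> m = lm p \<or> lt m (lm p)"
proof -
  obtain a where a: "a \<in> keys p" "\<forall>m'\<in>keys p. m' = a \<or> lt m' a"
    using ex_max[of "keys p"] assms by auto
  then have "lm p = a" by (intro lm_eqI) auto
  with a show "lm p \<in> keys p" "m \<in> keys p \<Longrightarrow> m = lm p \<or> lt m (lm p)"
    by auto
qed

lemma lm_single: "c \<noteq> 0 \<Longrightarrow> lm (single m c) = m"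
  by (rule lm_eqI) auto

lemma lm_keys_subset: "p \<in> polys V \<Longrightarrow> p \<noteq> 0 \<Longrightarrow> keys (lm p) \<subseteq> V"
  using lm_props(1) unfolding polys_iff by blast

text \<open>Only one pair of monomials contributes to the top coefficient of a product.\<close>

lemma lookup_mult_lm:
  fixes p q :: "('x, 'k::field) mpoly"
  assumes "p \<noteq> 0" "q \<noteq> 0"
  shows "lookup (p * q) (lm p + lm q)
           = lookup p (lm p) * lookup q (lm q)"
proof -
  define p0 where "p0 = single (lm p) (lookup p (lm p))"
  define q0 where "q0 = single (lm q) (lookup q (lm q))"
  have p1: "m \<noteq> lm p \<and> m \<in> keys p" if "m \<in> keys (p - p0)" for m
    using that by (auto simp: in_keys_iff p0_def lookup_minus lookup_single when_def split: if_splits)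
  have q1: "m \<noteq> lm q \<and> m \<in> keys q" if "m \<in> keys (q - q0)" for m
    using that by (auto simp: in_keys_iff q0_def lookup_minus lookup_single when_def split: if_splits)
  have eq: "p * q = p0 * q0 + (p - p0) * q + p0 * (q - q0)"
    by (simp add: algebra_simps)
  have "lm p + lm q \<notin> keys ((p - p0) * q)"
  proof
    assume "lm p + lm q \<in> keys ((p - p0) * q)"
    then obtain a b where "a \<in> keys (p - p0)" "b \<in> keys q"
      "lm p + lm q = a + b" using keys_mult by blast
    then show False
      using lt_add_mono[of a "lm p" b "lm q"] p1[of a] lm_props(2)[OF assms(1), of a]
        lm_props(2)[OF assms(2), of b] lt_irrefl by metis
  qed
  moreover have "lm p + lm q \<notin> keys (p0 * (q - q0))"
  proof
    assume "lm p + lm q \<in> keys (p0 * (q - q0))"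
    then obtain a b where "a \<in> keys p0" "b \<in> keys (q - q0)"
      "lm p + lm q = a + b" using keys_mult by blast
    then have "a = lm p" "b \<noteq> lm q" by (auto simp: p0_def q1 split: if_splits)
    then show False using \<open>lm p + lm q = a + b\<close> by simp
  qed
  ultimately show ?thesis
    unfolding eq lookup_add by (simp add: in_keys_iff p0_def q0_def mult_single)
qed

lemma lm_mult:
  fixes p q :: "('x, 'k::field) mpoly"
  assumes "p \<noteq> 0" "q \<noteq> 0"
  shows "p * q \<noteq> 0" "lm (p * q) = lm p + lm q"
proof -
  have *: "lm p + lm q \<in> keys (p * q)"
    using lookup_mult_lm[OF assms] lm_props(1)[OF assms(1)] lm_props(1)[OF assms(2)]
    by (simp add: in_keys_iff)
  then show "p * q \<noteq> 0" by auto
  show "lm (p * q) = lm p + lm q"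
  proof (rule lm_eqI[OF *])
    fix m assume "m \<in> keys (p * q)"
    then obtain a b where "a \<in> keys p" "b \<in> keys q" "m = a + b"
      using keys_mult by blast
    then show "m = lm p + lm q \<or> lt m (lm p + lm q)"
      using lt_add_mono[of a "lm p" b "lm q"] lm_props(2)[OF assms(1), of a]
        lm_props(2)[OF assms(2), of b] by metis
  qed
qed

lemma lm_power:
  fixes p :: "('x, 'k::field) mpoly"
  assumes "p \<noteq> 0"
  shows "p ^ k \<noteq> 0" "lookup (lm (p ^ k)) x = k * lookup (lm p) x"
proof -
  have "p ^ k \<noteq> 0 \<and> lookup (lm (p ^ k)) x = k * lookup (lm p) x"
  proof (induction k)
    case 0
    have "lm (1 :: ('x, 'k) mpoly) = 0"
      by (rule lm_eqI) simp_all
    then show ?case by simp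
  qed (use assms lm_mult[of p] in \<open>simp add: lookup_add\<close>)
  then show "p ^ k \<noteq> 0" "lookup (lm (p ^ k)) x = k * lookup (lm p) x"
    by auto
qed

lemma lm_add_neq:
  assumes "r \<noteq> 0" "h = 0 \<or> lm h \<noteq> lm r"
  shows "h + r \<noteq> 0" "lm (h + r) = lm r \<or> h \<noteq> 0 \<and> lm (h + r) = lm h"
proof -
  have "h + r \<noteq> 0 \<and> (lm (h + r) = lm r \<or> h \<noteq> 0 \<and> lm (h + r) = lm h)"
  proof (cases "h = 0")
    case False
    with assms have "lm h \<noteq> lm r" by simp
    have K: "m \<in> keys h \<or> m \<in> keys r"
      if "m \<in> keys (h + r)" for m
      using that Poly_Mapping.keys_add[of h r] by blast
    from \<open>lm h \<noteq> lm r\<close> consider "lt (lm h) (lm r)" | "lt (lm r) (lm h)" using lt_total by blast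
    then show ?thesis
    proof cases
      case 1
      have "lm r \<notin> keys h"
        using lm_props(2)[OF False] 1 lt_asym lt_irrefl by metis
      then have "lm r \<in> keys (h + r)"
        using lm_props(1)[OF assms(1)] by (simp add: in_keys_iff lookup_add)
      moreover have "lm (h + r) = lm r"
      proof (rule lm_eqI[OF calculation])
        fix m assume "m \<in> keys (h + r)"
        then show "m = lm r \<or> lt m (lm r)"
          using K[of m] lm_props(2)[OF False, of m] lm_props(2)[OF assms(1), of m] 1 lt_trans by metis
      qed
      ultimately show ?thesis by auto
    next
      case 2
      have "lm h \<notin> keys r"
        using lm_props(2)[OF assms(1)] 2 lt_asym lt_irrefl by metis
      then have "lm h \<in> keys (h + r)"
        using lm_props(1)[OF False] by (simp add: in_keys_iff lookup_add)
      moreover have "lm (h + r) = lm h"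
      proof (rule lm_eqI[OF calculation])
        fix m assume "m \<in> keys (h + r)"
        then show "m = lm h \<or> lt m (lm h)"
          using K[of m] lm_props(2)[OF False, of m] lm_props(2)[OF assms(1), of m] 2 lt_trans by metis
      qed
      ultimately show ?thesis using False by auto
    qed
  qed (use assms in simp)
  then show "h + r \<noteq> 0" "lm (h + r) = lm r \<or> h \<noteq> 0 \<and> lm (h + r) = lm h"
    by auto
qed

text \<open>One division step: a multiple of \<open>f\<close> removes the leading term of \<open>p\<close>.\<close>

lemma cancel_lm:
  fixes p f :: "('x, 'k::field) mpoly"
  assumes "p \<noteq> 0" "f \<noteq> 0" "lm p = s + lm f"
  obtains c where "c \<noteq> 0"
    "\<And>m. m \<in> keys (p - single s c * f) \<Longrightarrow> lt m (lm p)"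
proof -
  define c where "c = lookup p (lm p) / lookup f (lm f)"
  let ?t = "single s c"
  have c: "c \<noteq> 0"
    using lm_props(1)[OF assms(1)] lm_props(1)[OF assms(2)] by (simp add: c_def in_keys_iff)
  then have t: "?t \<noteq> 0" "lm ?t = s"
    using lm_single by (auto simp flip: keys_eq_empty)
  have lead: "lookup (?t * f) (lm p) = lookup p (lm p)"
    using lookup_mult_lm[OF t(1) assms(2)] lm_props(1)[OF assms(2)]
    unfolding t(2) assms(3)[symmetric] lookup_single_eq by (simp add: c_def in_keys_iff)
  have "lt m (lm p)" if m: "m \<in> keys (p - ?t * f)" for m
  proof -
    have "m \<noteq> lm p"
      using m lead by (auto simp: in_keys_iff lookup_minus)
    moreover have "m \<in> keys p \<or> m \<in> keys (?t * f)"
      using m by (auto simp: in_keys_iff lookup_minus)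
    moreover have "m = lm p \<or> lt m (lm p)" if "m \<in> keys (?t * f)"
      using lm_props(2)[OF lm_mult(1)[OF t(1) assms(2)] that] lm_mult(2)[OF t(1) assms(2)]
      by (simp add: t(2) assms(3))
    ultimately show ?thesis using lm_props(2)[OF assms(1), of m] by blast
  qed
  with c show ?thesis using that by blast
qed

end

section \<open>Families with coprime leading monomials\<close>

context monomial_order
begin

definition leading_monomials :: "('x, 'k::field) mpoly set \<Rightarrow> ('x \<Rightarrow>\<^sub>0 nat) set" where
  "leading_monomials I = lm ` (I - {0})"

text \<open>Induction along the division algorithm. A claim about \<open>p\<close> may be assumed for every polynomial all of
  whose monomials are smaller than the leading monomial of \<open>p\<close>.\<close>

lemma lm_induct [consumes 2, case_names step]:
  fixes p :: "('x, 'k::field) mpoly"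
  assumes V: "finite V" and p: "p \<in> polys V"
    and step: "\<And>p. p \<in> polys V \<Longrightarrow>
      (\<And>q. q \<in> polys V \<Longrightarrow> p \<noteq> 0 \<Longrightarrow> (\<And>m. m \<in> keys q \<Longrightarrow> lt m (lm p)) \<Longrightarrow> P q) \<Longrightarrow> P p"
  shows "P p"
proof -
  have P0: "P 0" by (rule step) simp_all
  have "\<forall>p\<in>polys V. p \<noteq> 0 \<longrightarrow> lm p = m \<longrightarrow> P p" for m
  proof (induction m rule: wf_induct_rule[OF wf_monomial_order[OF V]])
    case (1 m)
    show ?case
    proof (intro ballI impI)
      fix p :: "('x, 'k) mpoly" assume p: "p \<in> polys V" "p \<noteq> 0" "lm p = m"
      show "P p"
      proof (rule step[OF p(1)])
        fix q :: "('x, 'k) mpoly" assume q: "q \<in> polys V" "\<And>m. m \<in> keys q \<Longrightarrow> lt m (lm p)"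
        show "P q"
        proof (cases "q = 0")
          case False
          then have "lt (lm q) m" using q(2)[OF lm_props(1)] p(3) by blast
          then show ?thesis using 1 q(1) False lm_keys_subset p by blast
        qed (use P0 in simp)
      qed
    qed
  qed
  then show ?thesis using p P0 by (cases "p = 0") auto
qed

lemma leading_up_closed:
  assumes I: "ideal I (mpoly_ring V)" and m: "m \<in> leading_monomials I" "mdvd m m'" "keys m' \<subseteq> V"
  shows "m' \<in> leading_monomials (I :: ('x, 'k::field) mpoly set)"
proof -
  obtain h where h: "h \<in> I" "h \<noteq> 0" "m = lm h" using m(1) by (auto simp: leading_monomials_def)
  obtain s where s: "m' = s + m" using mdvdE[OF m(2)] by blast
  let ?t = "single s (1::'k)"
  have t: "?t \<noteq> 0" "lm ?t = s" using lm_single[of "1::'k" s] by (auto simp flip: keys_eq_empty)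
  have "?t \<in> polys V" using m(3) s by (intro polys_single) (auto simp: keys_add_nat)
  then have "?t * h \<in> I" using ideal_mult[OF I] h(1) by blast
  moreover have "?t * h \<noteq> 0" "lm (?t * h) = m'" using lm_mult[OF t(1) h(2)] t s h by auto
  ultimately show ?thesis unfolding leading_monomials_def by (metis DiffI image_eqI singletonD)
qed

text \<open>The leading term is either cancelled by an element of the ideal or split off for good.\<close>

lemma normal_form:
  fixes I :: "('x, 'k::field) mpoly set"
  assumes V: "finite V" and I: "ideal I (mpoly_ring V)" and p: "p \<in> polys V"
  shows "\<exists>q\<in>polys V. p - q \<in> I \<and> keys q \<inter> leading_monomials I = {}"
  using V p
proof (induction p rule: lm_induct)
  case (step p)
  show ?case
  proof (cases "p = 0")
    case True
    then show ?thesis using ideal_0[OF I] by (intro bexI[of _ 0]) auto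
  next
    case p0: False
    show ?thesis
    proof (cases "lm p \<in> leading_monomials I")
      case True
      then obtain h where h: "h \<in> I" "h \<noteq> 0" "lm p = 0 + lm h" by (auto simp: leading_monomials_def)
      obtain c where c: "\<And>m. m \<in> keys (p - single 0 c * h) \<Longrightarrow> lt m (lm p)"
        using cancel_lm[OF p0 h(2,3)] by blast
      have ch: "single 0 c * h \<in> I"
        using ideal_mult[OF I _ h(1)] by (simp add: polys_single)
      moreover have "p - single 0 c * h \<in> polys V"
        using step.hyps ch ideal_sub[OF I] polys_diff by blast
      ultimately obtain q where q: "q \<in> polys V" "p - single 0 c * h - q \<in> I"
        "keys q \<inter> leading_monomials I = {}"
        using step.IH[OF _ p0 c] by blast
      have "p - q = (p - single 0 c * h - q) + single 0 c * h" by simp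
      also have "\<dots> \<in> I" using ideal_add[OF I q(2) ch] .
      finally show ?thesis using q by blast
    next
      case False
      let ?t = "single (lm p) (lookup p (lm p))"
      have t: "?t \<in> polys V" using lm_keys_subset[OF step.hyps p0] by (intro polys_single) blast
      have "lt m (lm p)" if "m \<in> keys (p - ?t)" for m
        using that lm_props(2)[OF p0, of m]
        by (auto simp: in_keys_iff lookup_minus lookup_single when_def split: if_splits)
      moreover have "p - ?t \<in> polys V" using step.hyps t polys_diff by blast
      ultimately obtain q where q: "q \<in> polys V" "p - ?t - q \<in> I" "keys q \<inter> leading_monomials I = {}"
        using step.IH[OF _ p0] by blast
      have "keys (q + ?t) \<subseteq> insert (lm p) (keys q)"
        using Poly_Mapping.keys_add[of q ?t] by (auto split: if_splits)
      then have "keys (q + ?t) \<inter> leading_monomials I = {}" using q(3) False by blast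
      moreover have "p - (q + ?t) \<in> I" using q(2) by (simp add: algebra_simps)
      ultimately show ?thesis using q(1) t plus_in_mpoly_ring by blast
    qed
  qed
qed

text \<open>Reduce \<open>q\<close> modulo \<open>J\<close> to a remainder \<open>r\<close>. If \<open>r\<close> were nonzero, \<open>lm r + lm f\<close> would be divisible by some
  \<open>a\<close> that leads in \<open>J\<close>; since \<open>a\<close> is coprime to \<open>lm f\<close>, it would divide \<open>lm r\<close>, which is excluded for a
  remainder.\<close>

lemma coprime_nonzerodivisor:
  fixes J :: "('x, 'k::field) mpoly set"
  assumes V: "finite V" and J: "ideal J (mpoly_ring V)"
    and L: "\<And>m. m \<in> leading_monomials J \<Longrightarrow> \<exists>a\<in>A. mdvd a m" "A \<subseteq> leading_monomials J"
    and f: "f \<in> polys V" "f \<noteq> 0" "\<And>a. a \<in> A \<Longrightarrow> keys a \<inter> keys (lm f) = {}"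
    and q: "q \<in> polys V" "q * f \<in> J"
  shows "q \<in> J"
proof -
  obtain r where r: "r \<in> polys V" "q - r \<in> J" "keys r \<inter> leading_monomials J = {}"
    using normal_form[OF V J q(1)] by blast
  have "q * f - r * f \<in> J"
    using ideal_mult'[OF J f(1) r(2)] by (simp add: left_diff_distrib)
  then have rf: "r * f \<in> J" using ideal_cong[OF J] q(2) by blast
  have "r = 0"
  proof (rule ccontr)
    assume r0: "r \<noteq> 0"
    then have "lm r + lm f \<in> leading_monomials J"
      using rf lm_mult[OF r0 f(2)] unfolding leading_monomials_def by (metis DiffI image_eqI singletonD)
    then obtain a where a: "a \<in> A" "mdvd a (lm r + lm f)" using L(1) by blast
    then have "mdvd a (lm r)" using f(3) mdvd_coprime_cancel by blast
    then have "lm r \<in> leading_monomials J"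
      using leading_up_closed[OF J] L(2) a(1) lm_keys_subset[OF r(1) r0] by blast
    then show False using r(3) lm_props(1)[OF r0] by blast
  qed
  then show ?thesis using r(2) by simp
qed

text \<open>The cofactor \<open>q\<close> may be reduced modulo \<open>J\<close>, at the cost of changing \<open>h\<close>. After that \<open>lm (q * f)\<close> does
  not lead in \<open>J\<close>, by coprimality, so it cannot cancel against \<open>lm h\<close>. This replaces the usual
  computation with S-polynomials.\<close>

lemma coprime_leading_insert:
  fixes J :: "('x, 'k::field) mpoly set"
  assumes V: "finite V" and J: "ideal J (mpoly_ring V)"
    and L: "\<And>m. m \<in> leading_monomials J \<Longrightarrow> \<exists>a\<in>A. mdvd a m" "A \<subseteq> leading_monomials J"
    and f: "f \<in> polys V" "f \<noteq> 0" "\<And>a. a \<in> A \<Longrightarrow> keys a \<inter> keys (lm f) = {}"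
    and p: "h \<in> J" "q \<in> polys V" "h + q * f \<noteq> 0"
  shows "\<exists>a\<in>insert (lm f) A. mdvd a (lm (h + q * f))"
proof -
  obtain r where r: "r \<in> polys V" "q - r \<in> J" "keys r \<inter> leading_monomials J = {}"
    using normal_form[OF V J p(2)] by blast
  \<comment> \<open>q is replaced by its remainder r and h absorbs the difference\<close>
  define h' where "h' = h + (q - r) * f"
  have h': "h' \<in> J" using ideal_add[OF J p(1) ideal_mult'[OF J f(1) r(2)]] by (simp add: h'_def)
  have eq: "h + q * f = h' + r * f" by (simp add: h'_def algebra_simps)
  show ?thesis
  proof (cases "r = 0")
    case True
    then have "h' \<noteq> 0" "h + q * f = h'" using eq p(3) by auto
    then have "lm (h + q * f) \<in> leading_monomials J" using h' by (auto simp: leading_monomials_def)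
    then show ?thesis using L(1) by blast
  next
    case r0: False
    have rf: "r * f \<noteq> 0" "lm (r * f) = lm r + lm f" using lm_mult[OF r0 f(2)] by auto
    have nl: "lm (r * f) \<notin> leading_monomials J"
    proof
      assume "lm (r * f) \<in> leading_monomials J"
      then obtain a where a: "a \<in> A" "mdvd a (lm r + lm f)" using L(1) rf(2) by metis
      then have "mdvd a (lm r)" using f(3) mdvd_coprime_cancel by blast
      then have "lm r \<in> leading_monomials J"
        using leading_up_closed[OF J] L(2) a(1) lm_keys_subset[OF r(1) r0] by blast
      then show False using r(3) lm_props(1)[OF r0] by blast
    qed
    then have "h' = 0 \<or> lm h' \<noteq> lm (r * f)" using h' unfolding leading_monomials_def by (metis DiffI image_eqI singletonD)
    from lm_add_neq(2)[OF rf(1) this] show ?thesis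
    proof
      assume "lm (h' + r * f) = lm (r * f)"
      then show ?thesis unfolding eq rf(2) by auto
    next
      assume "h' \<noteq> 0 \<and> lm (h' + r * f) = lm h'"
      moreover from this have "lm h' \<in> leading_monomials J" using h' by (auto simp: leading_monomials_def)
      ultimately show ?thesis using L(1) unfolding eq by auto
    qed
  qed
qed

end

text \<open>By Buchberger's product criterion such a family is a Groebner basis of the ideal that it generates
  (\<open>leading_span\<close>), and so is each of its subfamilies.\<close>

locale coprime_leading_family = monomial_order lt
  for lt :: "('x \<Rightarrow>\<^sub>0 nat) \<Rightarrow> ('x \<Rightarrow>\<^sub>0 nat) \<Rightarrow> bool" +
  fixes V :: "'x set" and F :: "'e set" and f :: "'e \<Rightarrow> ('x, 'k::field) mpoly"
  assumes finite_V: "finite V" and finite_F: "finite F"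
    and f_polys: "e \<in> F \<Longrightarrow> f e \<in> polys V" and f_nz: "e \<in> F \<Longrightarrow> f e \<noteq> 0"
    and f_coprime: "e \<in> F \<Longrightarrow> e' \<in> F \<Longrightarrow> e \<noteq> e' \<Longrightarrow>
      keys (lm (f e)) \<inter> keys (lm (f e')) = {}"
begin

abbreviation span_of :: "'e set \<Rightarrow> ('x, 'k) mpoly set" where
  "span_of G \<equiv> Idl\<^bsub>mpoly_ring V\<^esub> (f ` G)"

lemma span_ideal: "G \<subseteq> F \<Longrightarrow> ideal (span_of G) (mpoly_ring V)"
  and f_in_span: "G \<subseteq> F \<Longrightarrow> e \<in> G \<Longrightarrow> f e \<in> span_of G"
  using mpoly_genideal[of "f ` G" V] f_polys by blast+

lemma leading_span:
  assumes "G \<subseteq> F" "m \<in> leading_monomials (span_of G)"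
  shows "\<exists>e\<in>G. mdvd (lm (f e)) m"
proof -
  have "finite G" using finite_F assms(1) finite_subset by blast
  then have "G \<subseteq> F \<longrightarrow> (\<forall>m\<in>leading_monomials (span_of G). \<exists>e\<in>G. mdvd (lm (f e)) m)"
  proof (induction rule: finite_induct)
    case empty
    have "ideal {0 :: ('x, 'k) mpoly} (mpoly_ring V)" by (rule mpoly_idealI) auto
    then have "span_of {} \<subseteq> {0}" using mpoly_genideal(3)[of "{}" V "{0}"] by auto
    then show ?case by (auto simp: leading_monomials_def)
  next
    case (insert c G)
    show ?case
    proof (intro impI ballI)
      fix m assume sub: "insert c G \<subseteq> F" and "m \<in> leading_monomials (span_of (insert c G))"
      then obtain p where p: "p \<in> span_of (insert c G)" "p \<noteq> 0" "m = lm p"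
        by (auto simp: leading_monomials_def)
      obtain h q where hq: "h \<in> span_of G" "q \<in> polys V" "p = h + q * f c"
      proof (rule Idl_insert_polys[of "f ` G" V "f c" p])
        show "p \<in> Idl\<^bsub>mpoly_ring V\<^esub> (insert (f c) (f ` G))" using p(1) by simp
      qed (use sub f_polys in auto)
      have "\<exists>a\<in>insert (lm (f c)) ((\<lambda>e. lm (f e)) ` G). mdvd a (lm (h + q * f c))"
      proof (rule coprime_leading_insert[OF finite_V, of "span_of G"])
        show "ideal (span_of G) (mpoly_ring V)" using sub by (simp add: span_ideal)
        show "\<exists>a\<in>(\<lambda>e. lm (f e)) ` G. mdvd a m" if "m \<in> leading_monomials (span_of G)" for m
          using that insert.IH sub by auto
        show "(\<lambda>e. lm (f e)) ` G \<subseteq> leading_monomials (span_of G)"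
          using sub f_in_span[of G] f_nz by (auto simp: leading_monomials_def)
        show "keys a \<inter> keys (lm (f c)) = {}" if "a \<in> (\<lambda>e. lm (f e)) ` G" for a
          using that sub f_coprime insert.hyps(2) by auto
      qed (use hq p sub f_polys f_nz in auto)
      then show "\<exists>e\<in>insert c G. mdvd (lm (f e)) m" using p(3) hq(3) by auto
    qed
  qed
  then show ?thesis using assms by blast
qed

lemma regular_sequence:
  assumes "G \<subseteq> F" "c \<in> F - G" "q \<in> polys V" "q * f c \<in> span_of G"
  shows "q \<in> span_of G"
proof (rule coprime_nonzerodivisor[OF finite_V span_ideal[OF assms(1)]])
  show "\<exists>a\<in>(\<lambda>e. lm (f e)) ` G. mdvd a m" if "m \<in> leading_monomials (span_of G)" for m
    using leading_span[OF assms(1) that] by auto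
  show "(\<lambda>e. lm (f e)) ` G \<subseteq> leading_monomials (span_of G)"
    using assms(1) f_in_span[of G] f_nz by (auto simp: leading_monomials_def)
  show "keys a \<inter> keys (lm (f c)) = {}" if "a \<in> (\<lambda>e. lm (f e)) ` G" for a
    using that assms f_coprime by auto
qed (use assms f_polys f_nz in auto)

lemma standard_form:
  assumes "p \<in> polys V"
  obtains q where "q \<in> polys V" "p - q \<in> span_of F"
    "\<And>m e. m \<in> keys q \<Longrightarrow> e \<in> F \<Longrightarrow> \<not> mdvd (lm (f e)) m"
proof -
  obtain q where q: "q \<in> polys V" "p - q \<in> span_of F" "keys q \<inter> leading_monomials (span_of F) = {}"
    using normal_form[OF finite_V span_ideal assms] by auto
  have "\<not> mdvd (lm (f e)) m" if "m \<in> keys q" "e \<in> F" for m e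
  proof
    assume "mdvd (lm (f e)) m"
    moreover have "lm (f e) \<in> leading_monomials (span_of F)"
      using that f_in_span[of F] f_nz by (auto simp: leading_monomials_def)
    moreover have "keys m \<subseteq> V" using q(1) that by (auto simp: polys_iff)
    ultimately show False using leading_up_closed[OF span_ideal[of F]] q(3) that by blast
  qed
  with q that show ?thesis by blast
qed

text \<open>The form in which the Groebner property is used: a polynomial with standard leading monomial is not
  in the ideal.\<close>

lemma standard_not_in_span:
  assumes "q \<noteq> 0" "\<And>e. e \<in> F \<Longrightarrow> \<not> mdvd (lm (f e)) (lm q)"
  shows "q \<notin> span_of F"
proof
  assume "q \<in> span_of F"
  then have "lm q \<in> leading_monomials (span_of F)" using assms(1) by (auto simp: leading_monomials_def)
  then show False using leading_span[of F] assms(2) by blast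
qed

text \<open>If \<open>a ^ k\<close> lies in the ideal, so does \<open>q ^ k\<close> for the remainder \<open>q\<close> of \<open>a\<close>. A squarefree monomial
  dividing \<open>lm q\<close> raised to the power \<open>k\<close> already divides \<open>lm q\<close>, so \<open>q\<close> must vanish.\<close>

lemma radical_span:
  assumes sqfree: "\<And>e x. e \<in> F \<Longrightarrow> lookup (lm (f e)) x \<le> 1"
  shows "radical_ideal (span_of F) (mpoly_ring V)"
proof -
  note I = span_ideal[of F, simplified]
  have "a \<in> span_of F" if a: "a \<in> polys V" "a ^ k \<in> span_of F" for a k
  proof -
    obtain q where q: "q \<in> polys V" "a - q \<in> span_of F"
      "\<And>m e. m \<in> keys q \<Longrightarrow> e \<in> F \<Longrightarrow> \<not> mdvd (lm (f e)) m"
      using standard_form[OF a(1)] by blast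
    have "q = 0"
    proof (rule ccontr)
      assume q0: "q \<noteq> 0"
      have "(\<Sum>i<k. q ^ (k - Suc i) * a ^ i) \<in> polys V"
        using a(1) q(1) by (auto intro!: polys_intros)
      then have "a ^ k - q ^ k \<in> span_of F"
        using ideal_mult'[OF I] q(2) by (simp add: power_diff_sumr2)
      then have "q ^ k \<in> span_of F" using ideal_cong[OF I] a(2) by blast
      then have "lm (q ^ k) \<in> leading_monomials (span_of F)"
        using lm_power(1)[OF q0] by (auto simp: leading_monomials_def)
      then obtain e where e: "e \<in> F" "mdvd (lm (f e)) (lm (q ^ k))"
        using leading_span[of F] by blast
      have "mdvd (lm (f e)) (lm q)"
        unfolding mdvd_def
      proof
        fix x
        have "lookup (lm (f e)) x \<le> k * lookup (lm q) x"
          using e(2) lm_power(2)[OF q0] by (simp add: mdvd_def)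
        then show "lookup (lm (f e)) x \<le> lookup (lm q) x"
          using sqfree[OF e(1), of x] by (cases "lookup (lm q) x") auto
      qed
      then show False using q(3) e(1) lm_props(1)[OF q0] by blast
    qed
    then show ?thesis using q(2) by simp
  qed
  moreover have "a \<in> radical (mpoly_ring V) (span_of F)" if "a \<in> span_of F" for a
    using that ideal_sub[OF I] unfolding radical_def by (auto simp: cring_pow_eq intro!: exI[of _ 1])
  ultimately show ?thesis
    using I unfolding radical_ideal_def radical_def by (auto simp: cring_pow_eq)
qed

end

section \<open>Prime ideals avoiding a multiplicative set\<close>

text \<open>An ideal that is maximal among those disjoint from a multiplicative set is prime.\<close>

lemma prime_avoiding:
  fixes I :: "('x, 'k::field) mpoly set"
  assumes I: "ideal I (mpoly_ring V)" and M: "M \<subseteq> polys V" "1 \<in> M"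
    and mult: "\<And>a b. a \<in> M \<Longrightarrow> b \<in> M \<Longrightarrow> a * b \<in> M" and disj: "I \<inter> M = {}"
  obtains P where "primeideal P (mpoly_ring V)" "I \<subseteq> P" "P \<inter> M = {}"
proof -
  define A where "A = {J. ideal J (mpoly_ring V) \<and> I \<subseteq> J \<and> J \<inter> M = {}}"
  have "\<exists>P\<in>A. \<forall>Q\<in>A. P \<subseteq> Q \<longrightarrow> Q = P"
  proof (rule subset_Zorn_nonempty)
    show "A \<noteq> {}" using I disj by (auto simp: A_def)
    fix C assume C: "C \<noteq> {}" "subset.chain A C"
    then have CA: "\<And>J. J \<in> C \<Longrightarrow> ideal J (mpoly_ring V) \<and> I \<subseteq> J \<and> J \<inter> M = {}"
      by (auto simp: A_def subset_chain_def)
    have "ideal (\<Union>C) (mpoly_ring V)"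
    proof (rule mpoly_idealI)
      show "\<Union>C \<subseteq> polys V" using CA ideal_sub by blast
      show "0 \<in> \<Union>C" using CA C(1) ideal_0 by blast
      fix a b assume "a \<in> \<Union>C" "b \<in> \<Union>C"
      then obtain J K where JK: "J \<in> C" "K \<in> C" "a \<in> J" "b \<in> K" by blast
      moreover have "J \<subseteq> K \<or> K \<subseteq> J" using C(2) JK(1,2) by (auto simp: subset_chain_def)
      ultimately show "a + b \<in> \<Union>C" using CA ideal_add by (metis UnionI subsetD)
    next
      fix h a :: "('x, 'k) mpoly" assume "h \<in> polys V" "a \<in> \<Union>C"
      then show "h * a \<in> \<Union>C" using CA ideal_mult by blast
    qed
    then show "\<Union>C \<in> A" using CA C(1) by (auto simp: A_def)
  qed
  then obtain P where P: "ideal P (mpoly_ring V)" "I \<subseteq> P" "P \<inter> M = {}"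
    and max: "\<And>Q. Q \<in> A \<Longrightarrow> P \<subseteq> Q \<Longrightarrow> Q = P" by (auto simp: A_def)
  have meet: "\<exists>h\<in>P. \<exists>q\<in>polys V. h + q * a \<in> M" if a: "a \<in> polys V" "a \<notin> P" for a
  proof -
    have sub: "insert a P \<subseteq> polys V" using a(1) ideal_sub[OF P(1)] by blast
    let ?J = "Idl\<^bsub>mpoly_ring V\<^esub> (insert a P)"
    have "?J \<notin> A" using max[of ?J] mpoly_genideal(2)[OF sub] a(2) by blast
    then obtain m where m: "m \<in> ?J" "m \<in> M"
      using mpoly_genideal(1,2)[OF sub] P(2) unfolding A_def by blast
    obtain h q where "h \<in> Idl\<^bsub>mpoly_ring V\<^esub> P" "q \<in> polys V" "m = h + q * a"
      using Idl_insert_polys[OF ideal_sub[OF P(1)] a(1) m(1)] by blast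
    moreover have "Idl\<^bsub>mpoly_ring V\<^esub> P \<subseteq> P"
      using mpoly_genideal(3)[OF ideal_sub[OF P(1)] P(1)] by blast
    ultimately show ?thesis using m(2) by blast
  qed
  have "primeideal P (mpoly_ring V)"
  proof (rule primeidealI[OF P(1) cring_mpoly_ring])
    show "polys V \<noteq> P" using M P(3) by blast
    fix a b assume ab: "a \<in> polys V" "b \<in> polys V" "a \<otimes>\<^bsub>mpoly_ring V\<^esub> b \<in> P"
    show "a \<in> P \<or> b \<in> P"
    proof (rule ccontr)
      assume "\<not> ?thesis"
      then obtain h q h' q' where *: "h \<in> P" "q \<in> polys V" "h + q * a \<in> M"
        "h' \<in> P" "q' \<in> polys V" "h' + q' * b \<in> M" using meet ab by meson
      have "(h + q * a) * (h' + q' * b) = (h' + q' * b) * h + (q * a) * h' + (q * q') * (a * b)"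
        by (simp add: algebra_simps)
      also have "\<dots> \<in> P"
      proof (intro ideal_add[OF P(1)])
        show "(h' + q' * b) * h \<in> P" using * M(1) by (intro ideal_mult[OF P(1)]) auto
        show "(q * a) * h' \<in> P" using * ab by (intro ideal_mult[OF P(1)]) (auto intro: polys_intros)
        show "(q * q') * (a * b) \<in> P" using * ab ideal_mult[OF P(1), of "q * q'" "a * b"] times_in_mpoly_ring[of q V q'] by simp
      qed
      finally show False using mult[OF *(3,6)] P(3) by blast
    qed
  qed
  with P that show ?thesis by blast
qed

lemma mpoly_primeD:
  assumes "primeideal P (mpoly_ring V)" "a \<in> polys V" "b \<in> polys V" "a * b \<in> P"
  shows "a \<in> P \<or> b \<in> P"
  using primeideal.I_prime[OF assms(1), of a b] assms by simp

lemma mpoly_prime_power: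
  assumes P: "primeideal P (mpoly_ring V)" and a: "a \<in> polys V" and b: "b \<in> polys V"
    and "a ^ k * b \<in> P" "a \<notin> P"
  shows "b \<in> P"
  using assms(4)
proof (induction k)
  case (Suc k)
  then have "a * (a ^ k * b) \<in> P" by (simp add: mult.assoc)
  then show ?case
    using Suc.IH mpoly_primeD[OF P a, of "a ^ k * b"] assms(5) a b by (auto intro: polys_intros)
qed simp

lemma mpoly_prime_one: "primeideal P (mpoly_ring V) \<Longrightarrow> (1 :: ('x, 'k::field) mpoly) \<notin> P"
  using ideal.one_imp_carrier[of P "mpoly_ring V"] primeideal.I_notcarr[of P "mpoly_ring V"]
    primeideal.axioms(1)[of P "mpoly_ring V"] by auto

section \<open>Lower bound for the height\<close>

context coprime_leading_family
begin

text \<open>The heart of the inequality between height and length of a regular sequence. Given a prime \<open>P\<close> above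
  \<open>f c\<close> and the ideal of \<open>G\<close>, avoid the multiplicative set of all \<open>s * f c ^ k\<close> with \<open>s\<close> outside \<open>P\<close>. It
  misses the ideal of \<open>G\<close> because \<open>f c\<close> is a nonzerodivisor modulo that ideal. The resulting prime lies
  in \<open>P\<close> (take \<open>k = 0\<close>) and omits \<open>f c\<close> (take \<open>s = 1\<close>), so it is strictly smaller.\<close>

lemma chain_below:
  assumes "G \<subseteq> F" "primeideal P (mpoly_ring V)" "span_of G \<subseteq> P"
  shows "\<exists>C. (\<forall>i\<le>card G. primeideal (C i) (mpoly_ring V)) \<and> (\<forall>i<card G. C i \<subset> C (Suc i)) \<and> C (card G) = P"
proof -
  have "finite G" using assms(1) finite_F finite_subset by blast
  then show ?thesis using assms
  proof (induction G arbitrary: P rule: finite_induct)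
    case empty
    then show ?case by (intro exI[of _ "\<lambda>_. P"]) auto
  next
    case (insert c G)
    have P: "ideal P (mpoly_ring V)" using insert.prems(2) by (simp add: primeideal.axioms(1))
    have sub: "G \<subseteq> F" "c \<in> F - G" using insert by auto
    have mono: "span_of G \<subseteq> span_of (insert c G)"
      using insert.prems(1) f_polys by (intro Idl_mono_polys) auto
    define M where "M = {s * f c ^ k |s k. s \<in> polys V - P}"
    have powers: "s \<in> span_of G" if "s \<in> polys V" "s * f c ^ k \<in> span_of G" for s k
      using that
    proof (induction k arbitrary: s)
      case (Suc k)
      have "s * f c ^ k \<in> span_of G"
      proof (rule regular_sequence[OF sub])
        show "s * f c ^ k \<in> polys V" using Suc.prems(1) f_polys sub by (auto intro!: polys_intros)
        show "s * f c ^ k * f c \<in> span_of G" using Suc.prems(2) by (simp add: mult_ac)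
      qed
      then show ?case using Suc by blast
    qed simp
    obtain P' where P': "primeideal P' (mpoly_ring V)" "span_of G \<subseteq> P'" "P' \<inter> M = {}"
    proof (rule prime_avoiding[OF span_ideal[OF sub(1)], of M])
      show "M \<subseteq> polys V" using f_polys sub by (auto simp: M_def intro!: polys_intros)
      have "1 \<notin> P" using mpoly_prime_one[OF insert.prems(2)] .
      then show "1 \<in> M" unfolding M_def by (force intro: exI[of _ 1] exI[of _ 0])
      show "a * b \<in> M" if ab: "a \<in> M" "b \<in> M" for a b
      proof -
        obtain s k s' k' where *: "a = s * f c ^ k" "b = s' * f c ^ k'" "s \<in> polys V - P" "s' \<in> polys V - P"
          using ab unfolding M_def by blast
        then have "a * b = (s * s') * f c ^ (k + k')" by (simp add: power_add mult_ac)
        moreover have "s * s' \<in> polys V - P"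
          using * mpoly_primeD[OF insert.prems(2)] by (auto intro: polys_intros)
        ultimately show ?thesis unfolding M_def by blast
      qed
      show "span_of G \<inter> M = {}"
        using powers mono insert.prems(3) unfolding M_def by blast
    qed
    have "P' \<subseteq> P"
    proof
      fix x assume x: "x \<in> P'"
      show "x \<in> P"
      proof (rule ccontr)
        assume "x \<notin> P"
        moreover have "x \<in> polys V" using x P'(1) ideal_sub primeideal.axioms(1) by blast
        moreover have "x = x * f c ^ 0" by simp
        ultimately have "x \<in> M" unfolding M_def by blast
        then show False using x P'(3) by blast
      qed
    qed
    moreover have "f c \<in> P" using insert.prems(3) f_in_span[OF insert.prems(1), of c] by blast
    moreover have "f c \<notin> P'"
    proof -
      have "f c = 1 * f c ^ 1" by simp
      then have "f c \<in> M" unfolding M_def using mpoly_prime_one[OF insert.prems(2)] polys_1 by blast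
      then show ?thesis using P'(3) by blast
    qed
    ultimately have "P' \<subset> P" by blast
    obtain C where C: "\<forall>i\<le>card G. primeideal (C i) (mpoly_ring V)" "\<forall>i<card G. C i \<subset> C (Suc i)"
      "C (card G) = P'" using insert.IH[OF sub(1) P'(1,2)] by blast
    let ?C = "\<lambda>i. if i \<le> card G then C i else P"
    have "primeideal (?C i) (mpoly_ring V)" for i using C(1) insert.prems(2) by auto
    moreover have "?C i \<subset> ?C (Suc i)" if "i < Suc (card G)" for i
      using C(2,3) \<open>P' \<subset> P\<close> that by (cases "i = card G") auto
    ultimately show ?case using insert.hyps by (intro exI[of _ ?C]) auto
  qed
qed

lemma height_ge: "enat (card F) \<le> height (mpoly_ring V) (span_of F)"
  unfolding height_def
proof (rule INF_greatest, clarify)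
  fix P assume "primeideal P (mpoly_ring V)" "span_of F \<subseteq> P"
  from chain_below[OF order_refl this] show "enat (card F) \<le> prime_height (mpoly_ring V) P"
    unfolding prime_height_def by (intro SUP_upper) auto
qed

end

section \<open>The polynomial ring as a vector space\<close>

definition pscale :: "'k::field \<Rightarrow> ('x, 'k) mpoly \<Rightarrow> ('x, 'k) mpoly" where
  "pscale c p = single 0 c * p"

interpretation ps: vector_space "pscale :: 'k::field \<Rightarrow> ('x, 'k) mpoly \<Rightarrow> ('x, 'k) mpoly"
  by unfold_locales
    (simp_all add: pscale_def distrib_left distrib_right single_add mult_single flip: mult.assoc)

lemma pscale_polys: "p \<in> polys V \<Longrightarrow> pscale c p \<in> polys V"
  unfolding pscale_def by (intro polys_intros) auto

lemma lookup_pscale: "lookup (pscale c p) m = c * lookup p m"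
  unfolding pscale_def mult_map_scale_conv_mult[symmetric]
  by (simp add: Poly_Mapping.map.rep_eq when_def)

lemma mpoly_expand: "p = (\<Sum>m\<in>keys p. pscale (lookup p m) (single m 1))"
  for p :: "('x, 'k::field) mpoly"
proof (rule poly_mapping_eqI)
  fix a
  have "(\<Sum>m\<in>keys p. lookup p m * (if m = a then 1 else 0))
      = (\<Sum>m\<in>keys p. if m = a then lookup p m else 0)"
    by (rule sum.cong) auto
  also have "\<dots> = lookup p a" by (simp add: in_keys_iff)
  finally show "lookup p a = lookup
    (\<Sum>m\<in>keys p. pscale (lookup p m) (single m 1)) a"
    by (simp add: lookup_sum lookup_pscale lookup_single when_def)
qed

text \<open>A linearly independent family with monomials from \<open>S\<close> has at most \<open>card S\<close> members. Independence is
  stated for a family and not for a set, so that injectivity of \<open>v\<close> comes for free.\<close>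

lemma card_le_if_combinations_injective:
  fixes v :: "'i \<Rightarrow> ('x, 'k::field) mpoly"
  assumes T: "finite T" and S: "finite S"
    and sub: "\<And>t. t \<in> T \<Longrightarrow> keys (v t) \<subseteq> S"
    and inj: "\<And>c t. (\<Sum>t\<in>T. pscale (c t) (v t)) = 0 \<Longrightarrow> t \<in> T \<Longrightarrow> c t = 0"
  shows "card T \<le> card S"
proof -
  have v: "inj_on v T"
  proof (rule inj_onI, rule ccontr)
    fix s t assume st: "s \<in> T" "t \<in> T" "v s = v t" "s \<noteq> t"
    let ?c = "\<lambda>r. if r = s then 1 else if r = t then - 1 else (0::'k)"
    have "(\<Sum>r\<in>T. pscale (?c r) (v r)) = (\<Sum>r\<in>{s,t}. pscale (?c r) (v r))"
      using T st by (intro sum.mono_neutral_right) auto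
    also have "\<dots> = 0" using st by simp
    finally show False using inj[of ?c s] st by auto
  qed
  have "\<not> ps.dependent (v ` T)"
  proof
    assume "ps.dependent (v ` T)"
    then obtain u where u: "\<exists>w\<in>v ` T. u w \<noteq> 0" "(\<Sum>w\<in>v ` T. pscale (u w) w) = 0"
      using ps.dependent_finite[of "v ` T"] T by auto
    then have "(\<Sum>t\<in>T. pscale (u (v t)) (v t)) = 0" by (simp add: sum.reindex[OF v])
    then show False using inj[of "\<lambda>t. u (v t)"] u(1) by blast
  qed
  moreover have "v ` T \<subseteq> ps.span ((\<lambda>m. single m 1) ` S)"
  proof clarify
    fix t assume "t \<in> T"
    then show "v t \<in> ps.span ((\<lambda>m. single m 1) ` S)"
      using sub by (subst mpoly_expand) (intro ps.span_sum ps.span_scale ps.span_base, auto)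
  qed
  ultimately have "card (v ` T) \<le> card ((\<lambda>m. single m (1::'k)) ` S :: ('x, 'k) mpoly set)"
    using ps.independent_span_bound[of "(\<lambda>m. single m 1) ` S" "v ` T"] S by auto
  then show ?thesis using card_image[OF v] card_image_le[OF S] order_trans by metis
qed

section \<open>Upper bound for the height\<close>

definition exponents_le :: "nat \<Rightarrow> ('x, 'k::field) mpoly \<Rightarrow> bool" where
  "exponents_le b p \<longleftrightarrow> (\<forall>m\<in>keys p. \<forall>x. lookup m x \<le> b)"

lemma exponents_le_mult:
  assumes "exponents_le a p" "exponents_le b q"
  shows "exponents_le (a + b) (p * q)"
  unfolding exponents_le_def
proof (intro ballI allI)
  fix m x assume "m \<in> keys (p * q)"
  then obtain s t where "s \<in> keys p" "t \<in> keys q" "m = s + t"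
    using keys_mult by blast
  then show "lookup m x \<le> a + b"
    using assms by (auto simp: exponents_le_def lookup_add intro: add_mono)
qed

lemma exponents_le_power: "exponents_le a p \<Longrightarrow> exponents_le (k * a) (p ^ k)"
proof (induction k)
  case 0
  then show ?case by (simp add: exponents_le_def)
next
  case (Suc k)
  then show ?case using exponents_le_mult[of a p "k * a" "p ^ k"] by simp
qed

lemma exponents_le_mono: "exponents_le a p \<Longrightarrow> a \<le> b \<Longrightarrow> exponents_le b p"
  unfolding exponents_le_def by (meson order_trans)

lemma ex_exponents_le: "\<exists>b. exponents_le b p"
proof
  have "lookup m x \<le> (\<Sum>m\<in>keys p. mdeg m)" if m: "m \<in> keys p" for m x
  proof (cases "x \<in> keys m")
    case True
    then have "lookup m x \<le> mdeg m"
      unfolding mdeg_def by (rule member_le_sum) auto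
    also have "\<dots> \<le> (\<Sum>m\<in>keys p. mdeg m)" using m by (rule member_le_sum) auto
    finally show ?thesis .
  qed (simp add: in_keys_iff)
  then show "exponents_le (\<Sum>m\<in>keys p. mdeg m) p" by (simp add: exponents_le_def)
qed

text \<open>The product of powers of the last \<open>length as\<close> members of \<open>q 0, \<dots>, q (k - 1)\<close>. The list grows at its
  head as one descends in a chain of primes.\<close>

fun top_powers :: "(nat \<Rightarrow> ('x, 'k::field) mpoly) \<Rightarrow> nat \<Rightarrow> nat list \<Rightarrow> ('x, 'k) mpoly" where
  "top_powers q k [] = 1"
| "top_powers q k (a # as) = q (k - Suc (length as)) ^ a * top_powers q k as"

definition power_monomial ::
  "(nat \<Rightarrow> ('x, 'k::field) mpoly) \<Rightarrow> nat \<Rightarrow> nat list \<times> ('x \<Rightarrow>\<^sub>0 nat) \<Rightarrow> ('x, 'k) mpoly" where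
  "power_monomial q k t = top_powers q k (fst t) * single (snd t) 1"

text \<open>Exponents, all at most \<open>N\<close>, of \<open>r\<close> chosen polynomials and of the variables in \<open>U\<close>.\<close>

definition exponent_box :: "'x set \<Rightarrow> nat \<Rightarrow> nat \<Rightarrow> (nat list \<times> ('x \<Rightarrow>\<^sub>0 nat)) set" where
  "exponent_box U N r = {as. set as \<subseteq> {..N} \<and> length as = r} \<times>
     {m. keys m \<subseteq> U \<and> (\<forall>x. lookup m x \<le> N)}"

lemma exponent_box_finite:
  assumes "finite U"
  shows "finite (exponent_box U N r)" "card (exponent_box U N r) = (N + 1) ^ (r + card U)"
  using assms bounded_monomials_card[OF assms, of N] finite_lists_length_eq[of "{..N}" r]
    card_lists_length_eq[of "{..N}" r]
  by (auto simp: exponent_box_def card_cartesian_product power_add)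

lemma exponent_box_Suc:
  "bij_betw (\<lambda>(a, as, m). (a # as, m)) ({..N} \<times> exponent_box U N r) (exponent_box U N (Suc r))"
  by (rule bij_betwI[where g = "\<lambda>(as, m). (hd as, tl as, m)"])
     (auto simp: exponent_box_def length_Suc_conv)

lemma top_powers_exponents:
  assumes "\<And>i. i < k \<Longrightarrow> exponents_le b (q i)" "length as \<le> k" "set as \<subseteq> {..N}"
  shows "exponents_le (length as * (N * b)) (top_powers q k as)"
  using assms(2,3)
proof (induction as)
  case Nil
  then show ?case by (simp add: exponents_le_def)
next
  case (Cons a as)
  have "exponents_le (a * b) (q (k - Suc (length as)) ^ a)"
    using Cons.prems by (intro exponents_le_power assms(1)) auto
  then have "exponents_le (N * b) (q (k - Suc (length as)) ^ a)"
    by (rule exponents_le_mono) (use Cons.prems in simp)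
  from exponents_le_mult[OF this] Cons show ?case by simp
qed

lemma top_powers_polys:
  assumes "\<And>i. i < k \<Longrightarrow> q i \<in> polys V" "length as \<le> k"
  shows "top_powers q k as \<in> polys V"
  using assms(2) by (induction as) (auto intro!: polys_intros assms(1))

text \<open>If \<open>q i\<close> lies in \<open>C (i + 1)\<close> but not in \<open>C i\<close>, then each step down the chain adds one algebraically
  independent element: the variables in \<open>U\<close> are independent modulo \<open>C k\<close>, and if a polynomial in \<open>q i\<close>
  with coefficients \<open>Y a\<close> lies in \<open>C i\<close>, one can divide by the lowest power of \<open>q i\<close> that occurs, because
  \<open>C i\<close> is prime, and then read off modulo \<open>C (i + 1)\<close> that its coefficient lies in \<open>C (i + 1)\<close>.\<close>

lemma power_monomials_independent:
  fixes C :: "nat \<Rightarrow> ('x, 'k::field) mpoly set"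
  assumes U: "U \<subseteq> V" "finite V"
    and C: "\<And>i. i \<le> k \<Longrightarrow> primeideal (C i) (mpoly_ring V)"
    and q: "\<And>i. i < k \<Longrightarrow> q i \<in> C (Suc i) - C i" and sub: "\<And>i. i < k \<Longrightarrow> C i \<subseteq> C (Suc i)"
    and top: "\<And>p. p \<in> polys U \<Longrightarrow> p \<in> C k \<Longrightarrow> p = 0"
    and r: "r \<le> k"
    and s: "(\<Sum>t\<in>exponent_box U N r. pscale (c t) (power_monomial q k t)) \<in> C (k - r)"
    and t: "t \<in> exponent_box U N r"
  shows "c t = 0"
  using r s t
proof (induction r arbitrary: c t)
  case 0
  let ?B = "{m. keys m \<subseteq> U \<and> (\<forall>x. lookup m x \<le> N)}"
  have fin: "finite ?B" using bounded_monomials_card(1) U finite_subset by blast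
  let ?p = "\<Sum>m\<in>?B. pscale (c ([], m)) (single m 1)"
  have box: "exponent_box U N 0 = Pair [] ` ?B" by (auto simp: exponent_box_def)
  have "(\<Sum>t\<in>exponent_box U N 0. pscale (c t) (power_monomial q k t)) = ?p"
    unfolding box by (subst sum.reindex) (auto simp: inj_on_def power_monomial_def)
  then have "?p \<in> C k" using 0 by simp
  moreover have "?p \<in> polys U" by (intro polys_sum pscale_polys polys_single) auto
  ultimately have p0: "?p = 0" using top by blast
  obtain m where m: "m \<in> ?B" "t = ([], m)" using 0(3) box by auto
  have "lookup ?p m = (\<Sum>m'\<in>?B. if m' = m then c ([], m') else 0)"
    by (simp add: lookup_sum lookup_pscale lookup_single when_def if_distrib cong: if_cong)
  also have "\<dots> = c t" using m fin by simp
  finally show ?case using p0 by simp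
next
  case (Suc r)
  define i where "i = k - Suc r"
  have i: "i < k" "k - r = Suc i" using Suc.prems(1) by (auto simp: i_def)
  define Y where "Y a = (\<Sum>t\<in>exponent_box U N r. pscale (c (a # fst t, snd t)) (power_monomial q k t))" for a
  have qp: "q j \<in> polys V" if "j < k" for j
    using q[OF that] ideal_sub[OF primeideal.axioms(1)[OF C[of "Suc j"]]] that by auto
  have Ypol: "Y a \<in> polys V" for a
    unfolding Y_def power_monomial_def
  proof (intro polys_sum pscale_polys times_in_mpoly_ring)
    fix t assume "t \<in> exponent_box U N r"
    then have "length (fst t) \<le> k" "keys (snd t) \<subseteq> V"
      using Suc.prems(1) U by (auto simp: exponent_box_def)
    then show "top_powers q k (fst t) \<in> polys V" "single (snd t) 1 \<in> polys V"
      using qp by (auto intro: top_powers_polys polys_single)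
  qed
  have zero: "c (a # as, m) = 0" if "Y a \<in> C (Suc i)" "(as, m) \<in> exponent_box U N r" for a as m
    using Suc.IH[of "\<lambda>t. c (a # fst t, snd t)" "(as, m)"] that Suc.prems(1) unfolding Y_def i(2) by auto
  have Y0: "Y a = 0" if "Y a \<in> C (Suc i)" for a
    unfolding Y_def by (rule sum.neutral) (use zero[OF that] in \<open>auto simp: pscale_def\<close>)
  have "(\<Sum>t\<in>exponent_box U N (Suc r). pscale (c t) (power_monomial q k t))
      = (\<Sum>a\<le>N. \<Sum>t\<in>exponent_box U N r. pscale (c (a # fst t, snd t)) (power_monomial q k (a # fst t, snd t)))"
    unfolding sum.cartesian_product
    by (rule sum.reindex_bij_betw[OF exponent_box_Suc, symmetric, THEN trans])
       (auto intro!: sum.cong)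
  also have "\<dots> = (\<Sum>a\<le>N. q i ^ a * Y a)"
    unfolding Y_def sum_distrib_left
    by (intro sum.cong) (auto simp: power_monomial_def exponent_box_def i_def pscale_def mult_ac)
  finally have S: "(\<Sum>a\<le>N. q i ^ a * Y a) \<in> C i" using Suc.prems(2) by (simp add: i_def)
  have Y: "Y a = 0" if "a \<le> N" for a
    using that
  proof (induction a rule: less_induct)
    case (less a)
    \<comment> \<open>the terms of index below a vanish by induction, so that a power of q i can be cancelled\<close>
    let ?R = "\<Sum>b\<in>{a<..N}. q i ^ (b - Suc a) * Y b"
    have Rpol: "?R \<in> polys V" using qp[OF i(1)] Ypol by (intro polys_sum times_in_mpoly_ring polys_power)
    have split: "{..N} = {..<a} \<union> {a} \<union> {a<..N}" using less.prems by auto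
    have "(\<Sum>b\<le>N. q i ^ b * Y b) = q i ^ a * Y a + (\<Sum>b\<in>{a<..N}. q i ^ b * Y b)"
      unfolding split using less by (subst sum.union_disjoint) (auto simp: sum.union_disjoint)
    also have "(\<Sum>b\<in>{a<..N}. q i ^ b * Y b) = q i ^ a * (q i * ?R)"
      unfolding sum_distrib_left
    proof (rule sum.cong)
      fix b assume "b \<in> {a<..N}"
      then have "b = a + (1 + (b - Suc a))" by simp
      then have "q i ^ b = q i ^ a * (q i * q i ^ (b - Suc a))" by (metis power_add power_one_right)
      then show "q i ^ b * Y b = q i ^ a * (q i * (q i ^ (b - Suc a) * Y b))" by (simp add: mult_ac)
    qed simp
    finally have "q i ^ a * (Y a + q i * ?R) \<in> C i" using S by (simp add: distrib_left)
    then have "Y a + q i * ?R \<in> C i"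
      using mpoly_prime_power[OF C qp[OF i(1)], of i "Y a + q i * ?R" a] q[OF i(1)] i(1) Ypol Rpol qp[OF i(1)]
      by (auto intro: polys_intros)
    then have "Y a + q i * ?R \<in> C (Suc i)" using sub[OF i(1)] by blast
    moreover have I: "ideal (C (Suc i)) (mpoly_ring V)" using C[of "Suc i"] i(1) primeideal.axioms(1) by auto
    moreover have "q i * ?R \<in> C (Suc i)" using ideal_mult'[OF I Rpol] q[OF i(1)] by blast
    ultimately have "Y a \<in> C (Suc i)" using ideal_diff[OF I, of "Y a + q i * ?R" "q i * ?R"] by simp
    then show ?case by (rule Y0)
  qed
  obtain a as m where t: "t = (a # as, m)" "a \<le> N" "(as, m) \<in> exponent_box U N r"
    using Suc.prems(3) by (auto simp: exponent_box_def length_Suc_conv)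
  have "0 \<in> C (Suc i)" using C[of "Suc i"] i(1) primeideal.axioms(1) ideal_0 by auto
  then show ?case using zero[of a as m] Y[OF t(2)] t by simp
qed

lemma power_le_power_all_imp:
  fixes D r s :: nat
  assumes "\<And>N. (N + 1) ^ r \<le> (N * D + 1) ^ s" "D \<ge> 1"
  shows "r \<le> s"
proof (rule ccontr)
  assume "\<not> r \<le> s"
  \<comment> \<open>for this value of N the inequality fails by a factor (N + 1) / N\<close>
  define N where "N = D ^ s"
  have "(N + 1) * (N + 1) ^ s = (N + 1) ^ Suc s" by simp
  also have "\<dots> \<le> (N + 1) ^ r" using \<open>\<not> r \<le> s\<close> by (intro power_increasing) auto
  also have "\<dots> \<le> (N * D + 1) ^ s" by (rule assms)
  also have "\<dots> \<le> ((N + 1) * D) ^ s" using assms(2) by (intro power_mono) (auto simp: algebra_simps)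
  also have "\<dots> = N * (N + 1) ^ s" 
    unfolding N_def power_mult_distrib by (rule mult.commute)
  finally show False by simp
qed

text \<open>Transcendence degree in the guise of counting. The products of powers of the \<open>q i\<close> and of the
  variables in \<open>U\<close> with exponents up to \<open>N\<close> are linearly independent, and they involve only monomials
  with exponents up to \<open>N * D\<close>. Comparing the two numbers for all \<open>N\<close> bounds the length of the chain.\<close>

lemma chain_length_le:
  fixes C :: "nat \<Rightarrow> ('x, 'k::field) mpoly set"
  assumes U: "U \<subseteq> V" "finite V"
    and C: "\<And>i. i \<le> k \<Longrightarrow> primeideal (C i) (mpoly_ring V)" and strict: "\<And>i. i < k \<Longrightarrow> C i \<subset> C (Suc i)"
    and top: "\<And>p. p \<in> polys U \<Longrightarrow> p \<in> C k \<Longrightarrow> p = 0"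
  shows "k + card U \<le> card V"
proof -
  have "\<forall>i. \<exists>x. i < k \<longrightarrow> x \<in> C (Suc i) - C i" using strict by blast
  then obtain q where q: "\<And>i. i < k \<Longrightarrow> q i \<in> C (Suc i) - C i" by metis
  have qp: "q i \<in> polys V" if "i < k" for i
    using q[OF that] ideal_sub[OF primeideal.axioms(1)[OF C[of "Suc i"]]] that by auto
  have "\<forall>i. \<exists>b. exponents_le b (q i)" using ex_exponents_le by blast
  then obtain b where b: "\<And>i. exponents_le (b i) (q i)" by metis
  define D where "D = k * sum b {..<k} + 1"
  have fU: "finite U" using U finite_subset by blast
  have "(N + 1) ^ (k + card U) \<le> (N * D + 1) ^ card V" for N
  proof -
    let ?S = "{m. keys m \<subseteq> V \<and> (\<forall>x. lookup m x \<le> N * D)}"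
    have "card (exponent_box U N k) \<le> card ?S"
    proof (rule card_le_if_combinations_injective[where v = "power_monomial q k"])
      show "finite (exponent_box U N k)" using exponent_box_finite fU by blast
      show "finite ?S" using bounded_monomials_card(1)[OF U(2)] .
      fix t assume "t \<in> exponent_box U N k"
      then have t: "length (fst t) = k" "set (fst t) \<subseteq> {..N}" "keys (snd t) \<subseteq> U"
        "\<And>x. lookup (snd t) x \<le> N" by (auto simp: exponent_box_def)
      have "exponents_le (k * (N * sum b {..<k})) (top_powers q k (fst t))"
        using top_powers_exponents[of k "sum b {..<k}" q "fst t" N] t
          exponents_le_mono[OF b] member_le_sum[of _ "{..<k}" b] by auto
      moreover have "exponents_le N (single (snd t) (1::'k))"
        using t(4) by (simp add: exponents_le_def)
      ultimately have "exponents_le (N * D) (power_monomial q k t)"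
        unfolding power_monomial_def D_def using exponents_le_mult by (fastforce simp: algebra_simps)
      moreover have "power_monomial q k t \<in> polys V"
        unfolding power_monomial_def using t U qp
        by (intro times_in_mpoly_ring top_powers_polys polys_single) auto
      ultimately show "keys (power_monomial q k t) \<subseteq> ?S"
        by (auto simp: exponents_le_def polys_iff)
    next
      fix c :: "_ \<Rightarrow> 'k" and t
      assume c: "(\<Sum>t\<in>exponent_box U N k. pscale (c t) (power_monomial q k t)) = 0"
        and t: "t \<in> exponent_box U N k"
      have "0 \<in> C 0" using C[of 0] primeideal.axioms(1) ideal_0 by auto
      then have sum: "(\<Sum>t\<in>exponent_box U N k. pscale (c t) (power_monomial q k t)) \<in> C (k - k)"
        using c by simp
      show "c t = 0"
      proof (rule power_monomials_independent[where C = C and q = q and k = k and r = k, OF U])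
        show "p = 0" if "p \<in> polys U" "p \<in> C k" for p using top that .
        show "C i \<subseteq> C (Suc i)" if "i < k" for i using strict[OF that] by blast
      qed (use C q sum t in auto)
    qed
    then show ?thesis using exponent_box_finite(2)[OF fU] bounded_monomials_card(2)[OF U(2)] by simp
  qed
  then show ?thesis by (rule power_le_power_all_imp) (simp add: D_def)
qed

context coprime_leading_family
begin

text \<open>Delete from \<open>V\<close> one variable \<open>x e\<close> of each leading monomial. No polynomial in the remaining variables
  \<open>U\<close> has a leading monomial divisible by some \<open>lm (f e)\<close>, so the ideal misses the multiplicative set of
  nonzero polynomials in \<open>U\<close>, and some prime above the ideal still does.\<close>

lemma height_le:
  assumes nontriv: "\<And>e. e \<in> F \<Longrightarrow> lm (f e) \<noteq> 0"
  shows "height (mpoly_ring V) (span_of F) \<le> enat (card F)"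
proof -
  have "\<forall>e. \<exists>x. e \<in> F \<longrightarrow> x \<in> keys (lm (f e))" using nontriv by (metis all_not_in_conv keys_eq_empty)
  then obtain x where x: "\<And>e. e \<in> F \<Longrightarrow> x e \<in> keys (lm (f e))" by metis
  have xV: "x ` F \<subseteq> V" using x lm_keys_subset[OF f_polys f_nz] by blast
  define U where "U = V - x ` F"
  have avoid: "p = 0" if "p \<in> polys U" "p \<in> span_of F" for p
  proof (rule ccontr)
    assume p0: "p \<noteq> 0"
    then have "lm p \<in> leading_monomials (span_of F)" using that by (auto simp: leading_monomials_def)
    then obtain e where e: "e \<in> F" "mdvd (lm (f e)) (lm p)" using leading_span[of F] by blast
    have "x e \<in> keys (lm p)"
      using x[OF e(1)] e(2) unfolding mdvd_def by (metis in_keys_iff le_zero_eq)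
    then show False using lm_keys_subset[OF that(1) p0] e(1) by (auto simp: U_def)
  qed
  obtain P where P: "primeideal P (mpoly_ring V)" "span_of F \<subseteq> P" "P \<inter> (polys U - {0}) = {}"
  proof (rule prime_avoiding[OF span_ideal[OF order_refl], of "polys U - {0}"])
    show "polys U - {0} \<subseteq> polys V" using polys_mono[of U V] by (auto simp: U_def)
    show "a * b \<in> polys U - {0}" if "a \<in> polys U - {0}" "b \<in> polys U - {0}" for a b
      using that lm_mult(1)[of a b] by (auto intro: polys_intros)
  qed (use avoid in auto)
  have "k \<le> card F" if "\<forall>i\<le>k. primeideal (C i) (mpoly_ring V)" "\<forall>i<k. C i \<subset> C (Suc i)" "C k = P" for k C
  proof -
    have "k + card U \<le> card V"
      using that P(3) finite_V by (intro chain_length_le[of U V k C]) (auto simp: U_def)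
    moreover have "card V = card U + card (x ` F)"
      unfolding U_def using card_Diff_subset[OF finite_imageI[OF finite_F] xV] card_mono[OF finite_V xV]
      by linarith
    ultimately show ?thesis using card_image_le[OF finite_F, of x] by linarith
  qed
  then have "prime_height (mpoly_ring V) P \<le> enat (card F)"
    unfolding prime_height_def by (intro SUP_least) auto
  moreover have "height (mpoly_ring V) (span_of F) \<le> prime_height (mpoly_ring V) P"
    unfolding height_def using P by (intro INF_lower) auto
  ultimately show ?thesis by (rule order_trans[rotated])
qed

end

section \<open>Minimal generators of an equigenerated ideal\<close>

lemma ps_span_subset_Idl:
  fixes S :: "('x, 'k::field) mpoly set"
  assumes "S \<subseteq> polys V"
  shows "ps.span S \<subseteq> Idl\<^bsub>mpoly_ring V\<^esub> S"
proof (rule ps.span_minimal)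
  note I = mpoly_genideal(1)[OF assms]
  show "S \<subseteq> Idl\<^bsub>mpoly_ring V\<^esub> S" using mpoly_genideal(2)[OF assms] .
  have "pscale c p \<in> Idl\<^bsub>mpoly_ring V\<^esub> S" if "p \<in> Idl\<^bsub>mpoly_ring V\<^esub> S" for c p
    unfolding pscale_def using ideal_mult[OF I _ that] by (simp add: polys_single)
  then show "ps.subspace (Idl\<^bsub>mpoly_ring V\<^esub> S)"
    using ideal_0[OF I] ideal_add[OF I] by (auto simp: ps.subspace_def)
qed

lemma keys_span_subset:
  fixes G :: "('x, 'k::field) mpoly set"
  assumes "p \<in> ps.span G" "\<And>g. g \<in> G \<Longrightarrow> keys g \<subseteq> S"
  shows "keys p \<subseteq> S"
proof -
  have "ps.subspace {p :: ('x, 'k) mpoly. keys p \<subseteq> S}"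
    unfolding ps.subspace_def
  proof (intro conjI ballI allI)
    fix x y :: "('x, 'k) mpoly" and c
    assume x: "x \<in> {p. keys p \<subseteq> S}"
    have "keys (pscale c x) \<subseteq> keys x"
      by (auto simp: in_keys_iff lookup_pscale)
    then show "pscale c x \<in> {p. keys p \<subseteq> S}" using x by auto
    assume "y \<in> {p. keys p \<subseteq> S}"
    then show "x + y \<in> {p. keys p \<subseteq> S}"
      using x Poly_Mapping.keys_add[of x y] by auto
  qed simp
  then have "ps.span G \<subseteq> {p. keys p \<subseteq> S}"
    using assms(2) by (intro ps.span_minimal) auto
  then show ?thesis using assms(1) by blast
qed

lemma degree_in_span:
  assumes "p \<in> ps.span G" "\<And>g m. g \<in> G \<Longrightarrow> m \<in> keys g \<Longrightarrow> mdeg m = r"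
    "m \<in> keys p"
  shows "mdeg m = r"
  using keys_span_subset[OF assms(1), of "{m. mdeg m = r}"] assms(2,3) by blast

text \<open>If the generators in \<open>G\<close> either lie in a set \<open>H\<close> of forms of degree \<open>r\<close> or have only terms of higher
  degree, then the part of degree \<open>r\<close> of any element of the ideal is a linear combination of \<open>H\<close>: of a
  cofactor only the constant term matters.\<close>

lemma Idl_lowest_degree:
  fixes G :: "('x, 'k::field) mpoly set"
  assumes G: "G \<subseteq> polys V"
    and H: "\<And>g m. g \<in> H \<Longrightarrow> m \<in> keys g \<Longrightarrow> mdeg m = r" "H \<subseteq> polys V"
    and GH: "\<And>g. g \<in> G \<Longrightarrow> g \<in> H \<or> (\<forall>m\<in>keys g. r < mdeg m)"
    and p: "p \<in> Idl\<^bsub>mpoly_ring V\<^esub> G"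
  shows "\<exists>q\<in>ps.span H. \<forall>m\<in>keys (p - q). r < mdeg m"
proof -
  define J where "J = {p\<in>polys V. \<exists>q\<in>ps.span H. \<forall>m\<in>keys (p - q). r < mdeg m}"
  have "ideal J (mpoly_ring V)"
  proof (rule mpoly_idealI)
    show "J \<subseteq> polys V" by (auto simp: J_def)
    show "0 \<in> J" using ps.span_zero by (auto simp: J_def intro!: bexI[of _ 0])
    fix a b assume "a \<in> J" "b \<in> J"
    then obtain q q' where *: "a \<in> polys V" "b \<in> polys V" "q \<in> ps.span H" "q' \<in> ps.span H"
      "\<forall>m\<in>keys (a - q). r < mdeg m" "\<forall>m\<in>keys (b - q'). r < mdeg m"
      unfolding J_def by blast
    have eq: "a + b - (q + q') = (a - q) + (b - q')" by simp
    have "keys (a + b - (q + q')) \<subseteq> keys (a - q) \<union> keys (b - q')"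
      unfolding eq by (rule Poly_Mapping.keys_add)
    then have "\<forall>m\<in>keys (a + b - (q + q')). r < mdeg m"
      using *(5,6) by blast
    then show "a + b \<in> J"
      using * ps.span_add[of q H q'] plus_in_mpoly_ring[of a V b] unfolding J_def by blast
  next
    fix h a :: "('x, 'k) mpoly" assume h: "h \<in> polys V" and "a \<in> J"
    then obtain q where *: "a \<in> polys V" "q \<in> ps.span H" "\<forall>m\<in>keys (a - q). r < mdeg m"
      unfolding J_def by blast
    \<comment> \<open>only the constant term of the cofactor contributes in degree r\<close>
    define c where "c = lookup h 0"
    have "h * a - pscale c q = h * (a - q) + (h - single 0 c) * q"
      by (simp add: pscale_def algebra_simps)
    moreover have "r < mdeg m" if m: "m \<in> keys (h * (a - q))" for m
    proof -
      obtain s t where "s \<in> keys h" "t \<in> keys (a - q)" "m = s + t"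
        using m keys_mult by blast
      then show ?thesis using *(3) by (auto simp: mdeg_add trans_less_add2)
    qed
    moreover have "r < mdeg m" if m: "m \<in> keys ((h - single 0 c) * q)" for m
    proof -
      obtain s t where st: "s \<in> keys (h - single 0 c)" "t \<in> keys q"
        "m = s + t"
        using m keys_mult by blast
      then have "s \<noteq> 0" by (auto simp: in_keys_iff lookup_minus c_def)
      then have "mdeg s > 0" unfolding mdeg_def
        by (metis finite_keys gr_zeroI in_keys_iff keys_eq_empty equals0I sum_eq_0_iff)
      moreover have "mdeg t = r" using degree_in_span[OF *(2) H(1) st(2)] .
      ultimately show ?thesis using st(3) by (simp add: mdeg_add)
    qed
    ultimately have "\<forall>m\<in>keys (h * a - pscale c q). r < mdeg m"
      using Poly_Mapping.keys_add[of "h * (a - q)" "(h - single 0 c) * q"] by auto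
    moreover have "h * a \<in> polys V" using h *(1) times_in_mpoly_ring by blast
    ultimately show "h * a \<in> J"
      using ps.span_scale[OF *(2), of c] unfolding J_def by blast
  qed
  moreover have "G \<subseteq> J"
  proof
    fix g assume g: "g \<in> G"
    have "\<exists>q\<in>ps.span H. \<forall>m\<in>keys (g - q). r < mdeg m"
    proof (cases "g \<in> H")
      case True
      then show ?thesis using ps.span_base by (intro bexI[of _ g]) auto
    next
      case False
      then show ?thesis using GH[OF g] ps.span_zero[of H] by (intro bexI[of _ 0]) auto
    qed
    then show "g \<in> J" using g G unfolding J_def by blast
  qed
  ultimately have "Idl\<^bsub>mpoly_ring V\<^esub> G \<subseteq> J" using mpoly_genideal(3)[OF G] by blast
  then show ?thesis using p unfolding J_def by blast
qed

text \<open>The graded Nakayama lemma for an ideal generated in one degree \<open>r\<close>. The members of degree \<open>r\<close> of any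
  homogeneous generating set span the forms of degree \<open>r\<close> in the ideal, so that they generate alone.
  A minimal generating set is therefore a basis of this space of forms.\<close>

lemma equigenerated_mu:
  fixes B :: "('x, 'k::field) mpoly set"
  assumes B: "B \<subseteq> polys V" "finite B" "ps.independent B"
    and deg: "\<And>b m. b \<in> B \<Longrightarrow> m \<in> keys b \<Longrightarrow> mdeg m = r"
  defines "I \<equiv> Idl\<^bsub>mpoly_ring V\<^esub> B"
  shows "homogeneous_ideal V I" "mu V I = card B"
proof -
  note I = mpoly_genideal(1)[OF B(1), folded I_def]
  have low: "\<exists>q\<in>ps.span B. \<forall>m\<in>keys (p - q). r < mdeg m" if "p \<in> I" for p
    using Idl_lowest_degree[OF B(1) _ B(1), of r p] deg that unfolding I_def by blast
  have ge: "r \<le> mdeg m" if p: "p \<in> I" and m: "m \<in> keys p" for p m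
  proof -
    obtain q where q: "q \<in> ps.span B" "\<forall>m\<in>keys (p - q). r < mdeg m" using low[OF p] by blast
    have "p = (p - q) + q" by simp
    then have "m \<in> keys (p - q) \<or> m \<in> keys q"
      using m Poly_Mapping.keys_add[of "p - q" q] by auto
    then show ?thesis using q degree_in_span[OF q(1) deg] by fastforce
  qed
  have eq0: "p = q" if "\<forall>m\<in>keys (p - q). r < mdeg m"
    "\<forall>m\<in>keys p. mdeg m = r" "\<forall>m\<in>keys q. mdeg m = r" for p q :: "('x, 'k) mpoly"
  proof -
    have "m \<in> keys p \<or> m \<in> keys q" if "m \<in> keys (p - q)" for m
      using that by (auto simp: in_keys_iff lookup_minus)
    then have "keys (p - q) = {}" using that by fastforce
    then show ?thesis by simp
  qed
  have bottom: "p \<in> ps.span B" if p: "p \<in> I" "\<forall>m\<in>keys p. mdeg m = r" for p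
  proof -
    obtain q where q: "q \<in> ps.span B" "\<forall>m\<in>keys (p - q). r < mdeg m" using low[OF p(1)] by blast
    have "\<forall>m\<in>keys q. mdeg m = r" using degree_in_span[OF q(1), of r] deg by blast
    then show ?thesis using eq0[OF q(2) p(2)] q(1) by simp
  qed
  have gen: "B \<subseteq> ps.span {g \<in> G. \<forall>m\<in>keys g. mdeg m = r}"
    if G: "homogeneous_generating_set V I G" for G
  proof
    fix b assume b: "b \<in> B"
    let ?H = "{g \<in> G. \<forall>m\<in>keys g. mdeg m = r}"
    have G': "G \<subseteq> polys V" "\<And>g. g \<in> G \<Longrightarrow> homogeneous g" "Idl\<^bsub>mpoly_ring V\<^esub> G = I"
      using G by (auto simp: homogeneous_generating_set_def)
    have bG: "b \<in> Idl\<^bsub>mpoly_ring V\<^esub> G" using b mpoly_genideal(2)[OF B(1)] G'(3) unfolding I_def by blast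
    have alt: "g \<in> ?H \<or> (\<forall>m\<in>keys g. r < mdeg m)" if g: "g \<in> G" for g
    proof -
      obtain t where "\<forall>m\<in>keys g. mdeg m = t"
        using G'(2)[OF g] by (auto simp: homogeneous_def mdeg_def)
      moreover have "g \<in> I" using g mpoly_genideal(2)[OF G'(1)] G'(3) by blast
      ultimately show ?thesis using ge[of g] g by (cases "t = r") force+
    qed
    have HV: "?H \<subseteq> polys V" using G'(1) by blast
    obtain q where q: "q \<in> ps.span ?H" "\<forall>m\<in>keys (b - q). r < mdeg m"
      using Idl_lowest_degree[OF G'(1) _ HV alt bG] by blast
    then have "b = q" using eq0[OF q(2)] deg[OF b] degree_in_span[OF q(1), of r] by auto
    then show "b \<in> ps.span ?H" using q(1) by simp
  qed
  have homB: "homogeneous_generating_set V I B"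
    using B(1) deg unfolding homogeneous_generating_set_def homogeneous_def I_def mdeg_def by blast
  then show "homogeneous_ideal V I" unfolding homogeneous_ideal_def by blast
  have minB: "minimal_homogeneous_generating_set V I B"
    unfolding minimal_homogeneous_generating_set_def
  proof (intro conjI homB allI impI notI)
    fix G assume G: "G \<subset> B" "homogeneous_generating_set V I G"
    then obtain b where b: "b \<in> B" "b \<notin> G" by blast
    have "b \<in> ps.span {g \<in> G. \<forall>m\<in>keys g. mdeg m = r}" using gen[OF G(2)] b(1) by blast
    moreover have "{g \<in> G. \<forall>m\<in>keys g. mdeg m = r} \<subseteq> B - {b}" using G(1) b(2) by blast
    ultimately show False using B(3) b(1) ps.span_mono unfolding ps.dependent_def by blast
  qed
  have card: "finite G \<and> card G = card B" if G: "minimal_homogeneous_generating_set V I G" for G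
  proof -
    have hom: "homogeneous_generating_set V I G"
      and min: "\<And>G'. G' \<subset> G \<Longrightarrow> \<not> homogeneous_generating_set V I G'"
      using G by (auto simp: minimal_homogeneous_generating_set_def)
    have G': "G \<subseteq> polys V" "\<And>g. g \<in> G \<Longrightarrow> homogeneous g" "Idl\<^bsub>mpoly_ring V\<^esub> G = I"
      using hom by (auto simp: homogeneous_generating_set_def)
    have GI: "G \<subseteq> I" using mpoly_genideal(2)[OF G'(1)] G'(3) by blast
    have smaller: "G' = G" if sub: "G' \<subseteq> G" "B \<subseteq> ps.span G'" for G'
    proof -
      have G'V: "G' \<subseteq> polys V" using sub(1) G'(1) by blast
      have "B \<subseteq> Idl\<^bsub>mpoly_ring V\<^esub> G'" using sub(2) ps_span_subset_Idl[OF G'V] by blast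
      then have "I \<subseteq> Idl\<^bsub>mpoly_ring V\<^esub> G'"
        using mpoly_genideal(3)[OF B(1) mpoly_genideal(1)[OF G'V]] unfolding I_def by blast
      moreover have "Idl\<^bsub>mpoly_ring V\<^esub> G' \<subseteq> I" using mpoly_genideal(3)[OF G'V I] sub(1) GI by blast
      ultimately have "homogeneous_generating_set V I G'"
        using sub(1) G' unfolding homogeneous_generating_set_def by blast
      then show ?thesis using min sub(1) by blast
    qed
    have Gr: "{g \<in> G. \<forall>m\<in>keys g. mdeg m = r} = G"
      by (rule smaller[OF _ gen[OF hom]]) simp
    have span: "B \<subseteq> ps.span G" using gen[OF hom] unfolding Gr .
    have sub: "G \<subseteq> ps.span B"
    proof
      fix g assume "g \<in> G"
      then have "g \<in> I" "\<forall>m\<in>keys g. mdeg m = r" using GI Gr by auto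
      then show "g \<in> ps.span B" by (rule bottom)
    qed
    have ind: "ps.independent G"
      unfolding ps.dependent_def
    proof
      assume "\<exists>g\<in>G. g \<in> ps.span (G - {g})"
      then obtain g where g: "g \<in> G" "g \<in> ps.span (G - {g})" by blast
      have "ps.span G \<subseteq> ps.span (G - {g})"
      proof (rule ps.span_minimal)
        show "G \<subseteq> ps.span (G - {g})"
        proof
          fix h assume "h \<in> G"
          then show "h \<in> ps.span (G - {g})"
            using g(2) ps.span_base[of h "G - {g}"] by (cases "h = g") simp_all
        qed
      qed (rule ps.subspace_span)
      then have "G - {g} = G" using span by (intro smaller) auto
      then show False using g(1) by blast
    qed
    have le: "finite G \<and> card G \<le> card B" by (rule ps.independent_span_bound[OF B(2) ind sub])
    then have "card B \<le> card G" using ps.independent_span_bound[OF _ B(3) span] by blast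
    with le show ?thesis by simp
  qed
  show "mu V I = card B"
    unfolding mu_def
  proof (rule the_equality)
    show "\<exists>G. minimal_homogeneous_generating_set V I G \<and> finite G \<and> card G = card B"
      using minB B(2) by blast
    show "c = card B" if "\<exists>G. minimal_homogeneous_generating_set V I G \<and> finite G \<and> card G = c" for c
      using that card by metis
  qed
qed

context coprime_leading_family
begin

text \<open>No leading monomial is divisible by another one, so no member of the family lies in the ideal that
  the others generate.\<close>

lemma independent_family:
  assumes nontriv: "\<And>e. e \<in> F \<Longrightarrow> lm (f e) \<noteq> 0"
  shows "inj_on f F" "ps.independent (f ` F)"
proof -
  have notin: "f e \<notin> span_of (F - {e})" if e: "e \<in> F" for e
  proof
    assume "f e \<in> span_of (F - {e})"
    then have "lm (f e) \<in> leading_monomials (span_of (F - {e}))" using f_nz[OF e] by (auto simp: leading_monomials_def)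
    then obtain e' where e': "e' \<in> F - {e}" "mdvd (lm (f e')) (lm (f e))"
      using leading_span[of "F - {e}"] by blast
    then have "keys (lm (f e')) \<subseteq> keys (lm (f e))"
      unfolding mdvd_def by (metis in_keys_iff le_zero_eq subsetI)
    then have "keys (lm (f e')) = {}" using f_coprime[of e' e] e' e by blast
    then show False using nontriv e' by auto
  qed
  show inj: "inj_on f F"
  proof (rule inj_onI, rule ccontr)
    fix e e' assume "e \<in> F" "e' \<in> F" "f e = f e'" "e \<noteq> e'"
    then show False using notin[of e] f_in_span[of "F - {e}" e'] by auto
  qed
  show "ps.independent (f ` F)"
    unfolding ps.dependent_def
  proof clarify
    fix e assume e: "e \<in> F" "f e \<in> ps.span (f ` F - {f e})"
    have "f ` F - {f e} \<subseteq> f ` (F - {e})" by blast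
    then have "ps.span (f ` F - {f e}) \<subseteq> ps.span (f ` (F - {e}))" by (rule ps.span_mono)
    also have "\<dots> \<subseteq> span_of (F - {e})" using f_polys by (intro ps_span_subset_Idl) auto
    finally show False using notin[OF e(1)] e(2) by blast
  qed
qed

theorem complete_intersection_span:
  assumes nontriv: "\<And>e. e \<in> F \<Longrightarrow> lm (f e) \<noteq> 0"
    and deg: "\<And>e m. e \<in> F \<Longrightarrow> m \<in> keys (f e) \<Longrightarrow> mdeg m = r"
  shows "complete_intersection V (span_of F)"
proof -
  have *: "f ` F \<subseteq> polys V" "finite (f ` F)" using f_polys finite_F by auto
  note mu = equigenerated_mu[OF * independent_family(2)[OF nontriv], of r]
  have "mu V (span_of F) = card F" using mu(2) deg card_image[OF independent_family(1)[OF nontriv]] by auto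
  moreover have "height (mpoly_ring V) (span_of F) = enat (card F)"
    using height_le[OF nontriv] height_ge by (simp add: antisym)
  ultimately show ?thesis using mu(1) deg unfolding complete_intersection_def by auto
qed

end

section \<open>Extending a prime ideal by one block of variables\<close>

lemma monomial_part:
  obtains \<mu> :: "'x \<Rightarrow>\<^sub>0 nat"
  where "\<And>x. lookup \<mu> x = (if x \<in> Z then lookup m x else 0)"
proof
  fix x
  have "finite {x. (if x \<in> Z then lookup m x else 0) \<noteq> 0}"
    using finite_lookup[of m] by (rule finite_subset[rotated]) auto
  then show "lookup (Abs_poly_mapping (\<lambda>x. if x \<in> Z then lookup m x else 0)) x
    = (if x \<in> Z then lookup m x else 0)" by simp
qed

text \<open>A grading by an ordered group takes the place of a numerical weight. Products can then be handled by
  their parts of largest key.\<close>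

definition key_homogeneous :: "(('x \<Rightarrow>\<^sub>0 nat) \<Rightarrow> 'o) \<Rightarrow> 'o \<Rightarrow> ('x, 'k::field) mpoly \<Rightarrow> bool" where
  "key_homogeneous \<kappa> k p \<longleftrightarrow> (\<forall>m\<in>keys p. \<kappa> m = k)"

definition key_below :: "(('x \<Rightarrow>\<^sub>0 nat) \<Rightarrow> 'o::linorder) \<Rightarrow> 'o \<Rightarrow> ('x, 'k::field) mpoly \<Rightarrow> bool" where
  "key_below \<kappa> k p \<longleftrightarrow> (\<forall>m\<in>keys p. \<kappa> m < k)"

lemma key_below_add: "key_below \<kappa> k p \<Longrightarrow> key_below \<kappa> k q \<Longrightarrow> key_below \<kappa> k (p + q)"
  unfolding key_below_def using Poly_Mapping.keys_add[of p q] by blast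

lemma key_below_diff: "key_below \<kappa> k p \<Longrightarrow> key_below \<kappa> k q \<Longrightarrow> key_below \<kappa> k (p - q)"
  using key_below_add[of \<kappa> k p "- q"] by (simp add: key_below_def)

lemma key_homogeneous_diff:
  "key_homogeneous \<kappa> k p \<Longrightarrow> key_homogeneous \<kappa> k q \<Longrightarrow> key_homogeneous \<kappa> k (p - q)"
  unfolding key_homogeneous_def using Poly_Mapping.keys_add[of p "- q"] by auto

locale additive_key =
  fixes \<kappa> :: "('x \<Rightarrow>\<^sub>0 nat) \<Rightarrow> 'o::linordered_ab_group_add"
  assumes key_add: "\<kappa> (a + b) = \<kappa> a + \<kappa> b"
begin

lemma homogeneous_mult:
  "key_homogeneous \<kappa> k p \<Longrightarrow> key_homogeneous \<kappa> l q \<Longrightarrow> key_homogeneous \<kappa> (k + l) (p * q)"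
  unfolding key_homogeneous_def using keys_mult[of p q] by (fastforce simp: key_add)

lemma below_mult:
  assumes "key_homogeneous \<kappa> k p \<or> key_below \<kappa> k p" "key_below \<kappa> l q"
  shows "key_below \<kappa> (k + l) (p * q)" "key_below \<kappa> (l + k) (q * p)"
proof -
  show "key_below \<kappa> (k + l) (p * q)"
    unfolding key_below_def
  proof
    fix m assume "m \<in> keys (p * q)"
    then obtain a b where "a \<in> keys p" "b \<in> keys q" "m = a + b"
      using keys_mult by blast
    then show "\<kappa> m < k + l"
      using assms by (auto simp: key_add key_homogeneous_def key_below_def intro: add_strict_mono)
  qed
  then show "key_below \<kappa> (l + k) (q * p)" by (simp add: add.commute mult.commute[of q p])
qed

lemma homogeneous_single: "key_homogeneous \<kappa> (\<kappa> m) (single m c)"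
  by (simp add: key_homogeneous_def)

end

text \<open>The ring in the variables \<open>W\<close> carries the prime ideal generated by the \<open>g e\<close> with \<open>e\<close> in \<open>B\<close>. The
  variables in \<open>V - W\<close> are new. For \<open>e\<close> in \<open>B\<close> the generator \<open>g e\<close> is perturbed by terms of smaller key,
  and for \<open>e\<close> in \<open>A\<close> there is a new relation that replaces a product of new variables by \<open>- g e\<close>. Both
  sides of such a relation have the same key. The last assumption says that the key determines the
  part of a monomial in the new variables, as long as none of these products divides the monomial.\<close>

locale prime_extension =
  coprime_leading_family lt V "A \<union> B" f + additive_key \<kappa>
  for lt :: "('x \<Rightarrow>\<^sub>0 nat) \<Rightarrow> ('x \<Rightarrow>\<^sub>0 nat) \<Rightarrow> bool" and V :: "'x set" and A B :: "'e set"
    and f :: "'e \<Rightarrow> ('x, 'k::field) mpoly"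
    and \<kappa> :: "('x \<Rightarrow>\<^sub>0 nat) \<Rightarrow> 'o::linordered_ab_group_add" +
  fixes W :: "'x set" and g :: "'e \<Rightarrow> ('x, 'k) mpoly" and k0 :: 'o
  assumes lt_key: "\<kappa> a < \<kappa> b \<Longrightarrow> lt a b"
    and WV: "W \<subseteq> V"
    and g_polys: "e \<in> A \<union> B \<Longrightarrow> g e \<in> polys W" and g_key: "e \<in> A \<union> B \<Longrightarrow> key_homogeneous \<kappa> k0 (g e)"
    and g_nz: "e \<in> B \<Longrightarrow> g e \<noteq> 0"
    and prime: "primeideal (Idl\<^bsub>mpoly_ring W\<^esub> (g ` B)) (mpoly_ring W)"
    and A_f: "e \<in> A \<Longrightarrow> f e = single (lm (f e)) 1 + g e"
    and A_lm: "e \<in> A \<Longrightarrow> keys (lm (f e)) \<subseteq> V - W" "e \<in> A \<Longrightarrow> lm (f e) \<noteq> 0"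
      "e \<in> A \<Longrightarrow> \<kappa> (lm (f e)) = k0"
    and A_g: "e \<in> A \<Longrightarrow> g e \<notin> Idl\<^bsub>mpoly_ring W\<^esub> (g ` B)"
    and B_f: "e \<in> B \<Longrightarrow> key_below \<kappa> k0 (f e - g e)"
    and B_lm: "e \<in> B \<Longrightarrow> lm (f e) = lm (g e)" "e \<in> B \<Longrightarrow> lm (f e) \<noteq> 0"
    and separated: "\<lbrakk>keys a \<subseteq> V; keys b \<subseteq> V; \<kappa> a = \<kappa> b;
        \<And>e. e \<in> A \<Longrightarrow> \<not> mdvd (lm (f e)) a; \<And>e. e \<in> A \<Longrightarrow> \<not> mdvd (lm (f e)) b; x \<in> V - W\<rbrakk>
      \<Longrightarrow> lookup a x = lookup b x"
begin

abbreviation "I \<equiv> span_of (A \<union> B)"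
abbreviation "J \<equiv> Idl\<^bsub>mpoly_ring W\<^esub> (g ` B)"

lemma J_ideal: "ideal J (mpoly_ring W)" and g_in_J: "e \<in> B \<Longrightarrow> g e \<in> J"
  using mpoly_genideal(1,2)[of "g ` B" W] g_polys by blast+

lemma I_ideal: "ideal I (mpoly_ring V)"
  by (rule span_ideal) simp

lemma finite_W: "finite W"
  using finite_V WV finite_subset by blast

lemma coefficient_family: "coprime_leading_family lt W B g"
proof unfold_locales
  show "finite W" by (rule finite_W)
  show "finite B" using finite_F by simp
  show "g e \<in> polys W" "g e \<noteq> 0" if "e \<in> B" for e using that g_polys g_nz by auto
  show "keys (lm (g e)) \<inter> keys (lm (g e')) = {}"
    if "e \<in> B" "e' \<in> B" "e \<noteq> e'" for e e'
    using f_coprime[of e e'] that B_lm(1) by simp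
qed

text \<open>Division by the \<open>g e\<close> is carried out with the \<open>f e\<close> instead. Each step then leaves an error of smaller
  key, and all these errors are collected.\<close>

lemma reduce_coefficient:
  assumes "\<gamma> \<in> polys W" "\<gamma> \<notin> J" "key_homogeneous \<kappa> k \<gamma>"
  shows "\<exists>\<gamma>'\<in>polys W. \<gamma>' \<noteq> 0 \<and> key_homogeneous \<kappa> k \<gamma>' \<and> (\<forall>e\<in>B. \<not> mdvd (lm (f e)) (lm \<gamma>'))
    \<and> (\<exists>h\<in>I. key_below \<kappa> k (\<gamma> - \<gamma>' - h))"
  using finite_W assms
proof (induction \<gamma> rule: lm_induct)
  case (step \<gamma>)
  have nz: "\<gamma> \<noteq> 0" using step.prems(1) ideal_0[OF J_ideal] by auto
  show ?case
  proof (cases "\<forall>e\<in>B. \<not> mdvd (lm (f e)) (lm \<gamma>)")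
    case True
    have "key_below \<kappa> k (\<gamma> - \<gamma> - 0)" by (simp add: key_below_def)
    then show ?thesis using True nz step.hyps step.prems ideal_0[OF I_ideal] by blast
  next
    case False
    then obtain e where e: "e \<in> B" "mdvd (lm (g e)) (lm \<gamma>)" using B_lm(1) by auto
    obtain s where s: "lm \<gamma> = s + lm (g e)" using mdvdE[OF e(2)] by blast
    obtain c where c: "\<And>m. m \<in> keys (\<gamma> - single s c * g e) \<Longrightarrow> lt m (lm \<gamma>)"
      using cancel_lm[OF nz g_nz[OF e(1)] s] by blast
    let ?t = "single s c"
    let ?\<gamma> = "\<gamma> - ?t * g e"
    have sW: "keys s \<subseteq> W"
      using lm_keys_subset[OF step.hyps nz] s by (simp add: keys_add_nat)
    then have t: "?t \<in> polys W" "?t \<in> polys V" using WV by (auto intro: polys_single)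
    have gW: "g e \<in> polys W" using g_polys e(1) by blast
    have ks: "\<kappa> s + k0 = k"
      using step.prems(2) g_key[of e] lm_props(1)[OF nz] lm_props(1)[OF g_nz[OF e(1)]] e(1) s
      by (auto simp: key_homogeneous_def key_add)
    have "?\<gamma> \<in> polys W" using step.hyps t gW by (intro polys_diff times_in_mpoly_ring)
    moreover have "?\<gamma> \<notin> J"
    proof
      assume "?\<gamma> \<in> J"
      then have "\<gamma> \<in> J"
        using ideal_add[OF J_ideal _ ideal_mult[OF J_ideal t(1) g_in_J[OF e(1)]]] by fastforce
      then show False using step.prems by blast
    qed
    moreover have "key_homogeneous \<kappa> k ?\<gamma>"
      using key_homogeneous_diff[OF step.prems(2)] homogeneous_mult[OF homogeneous_single g_key, of e s c]
        ks e(1) by auto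
    ultimately obtain \<gamma>' h where \<gamma>': "\<gamma>' \<in> polys W" "\<gamma>' \<noteq> 0" "key_homogeneous \<kappa> k \<gamma>'"
      "\<forall>e\<in>B. \<not> mdvd (lm (f e)) (lm \<gamma>')" "h \<in> I" "key_below \<kappa> k (?\<gamma> - \<gamma>' - h)"
      using step.IH[OF _ nz c] by blast
    have "\<gamma> - \<gamma>' - (h + ?t * f e) = (?\<gamma> - \<gamma>' - h) - ?t * (f e - g e)"
      by (simp add: algebra_simps)
    moreover have "key_below \<kappa> k (?t * (f e - g e))"
      using below_mult(1)[OF disjI1[OF homogeneous_single] B_f[OF e(1)], of s c] ks by simp
    ultimately have "key_below \<kappa> k (\<gamma> - \<gamma>' - (h + ?t * f e))"
      using \<gamma>'(6) key_below_diff by metis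
    moreover have "h + ?t * f e \<in> I"
      using ideal_add[OF I_ideal \<gamma>'(5) ideal_mult[OF I_ideal t(2) f_in_span]] e(1) by blast
    ultimately show ?thesis using \<gamma>' by blast
  qed
qed

text \<open>Every product of new variables \<open>lm (f e)\<close> contained in \<open>\<sigma>\<close> is traded for the coefficient \<open>- g e\<close>. The
  coefficient stays outside \<open>J\<close>, because \<open>J\<close> is prime and contains none of these \<open>g e\<close>.\<close>

lemma reduce_monomial:
  assumes "keys \<sigma> \<subseteq> V - W" "\<gamma> \<in> polys W" "\<gamma> \<notin> J" "key_homogeneous \<kappa> k \<gamma>"
  shows "\<exists>\<rho> \<gamma>' k'. keys \<rho> \<subseteq> V - W \<and> (\<forall>e\<in>A. \<not> mdvd (lm (f e)) \<rho>) \<and> \<gamma>' \<in> polys W \<and> \<gamma>' \<notin> J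
    \<and> key_homogeneous \<kappa> k' \<gamma>' \<and> \<kappa> \<rho> + k' = \<kappa> \<sigma> + k
    \<and> single \<sigma> 1 * \<gamma> - single \<rho> 1 * \<gamma>' \<in> I"
  using assms
proof (induction "mdeg \<sigma>" arbitrary: \<sigma> \<gamma> k rule: less_induct)
  case less
  show ?case
  proof (cases "\<forall>e\<in>A. \<not> mdvd (lm (f e)) \<sigma>")
    case True
    have "single \<sigma> 1 * \<gamma> - single \<sigma> 1 * \<gamma> \<in> I"
      using ideal_0[OF I_ideal] by simp
    then show ?thesis using True less.prems by blast
  next
    case False
    then obtain e where e: "e \<in> A" "mdvd (lm (f e)) \<sigma>" by blast
    obtain s where s: "\<sigma> = s + lm (f e)" using mdvdE[OF e(2)] by blast
    let ?\<gamma> = "- (\<gamma> * g e)"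
    have gW: "g e \<in> polys W" using g_polys e(1) by blast
    have "0 < mdeg (lm (f e))"
      using A_lm(2)[OF e(1)] unfolding mdeg_def
      by (metis finite_keys gr_zeroI in_keys_iff keys_eq_empty equals0I sum_eq_0_iff)
    then have "mdeg s < mdeg \<sigma>" using s by (simp add: mdeg_add)
    moreover have sX: "keys s \<subseteq> V - W" using less.prems(1) s by (simp add: keys_add_nat)
    moreover have "?\<gamma> \<in> polys W" using less.prems(2) gW by (simp add: times_in_mpoly_ring)
    moreover have "?\<gamma> \<notin> J"
    proof
      assume "?\<gamma> \<in> J"
      then have "\<gamma> * g e \<in> J" using ideal_uminus[OF J_ideal] by fastforce
      then show False using mpoly_primeD[OF prime less.prems(2) gW] less.prems(3) A_g[OF e(1)] by blast
    qed
    moreover have "key_homogeneous \<kappa> (k + k0) ?\<gamma>"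
      using homogeneous_mult[OF less.prems(4) g_key[of e]] e(1) by (auto simp: key_homogeneous_def)
    ultimately obtain \<rho> \<gamma>' k' where *: "keys \<rho> \<subseteq> V - W" "\<forall>e\<in>A. \<not> mdvd (lm (f e)) \<rho>"
      "\<gamma>' \<in> polys W" "\<gamma>' \<notin> J" "key_homogeneous \<kappa> k' \<gamma>'" "\<kappa> \<rho> + k' = \<kappa> s + (k + k0)"
      "single s 1 * ?\<gamma> - single \<rho> 1 * \<gamma>' \<in> I"
      using less.hyps by blast
    have "\<kappa> \<rho> + k' = \<kappa> \<sigma> + k"
      using *(6) A_lm(3)[OF e(1)] s by (simp add: key_add algebra_simps)
    moreover have "single \<sigma> 1 * \<gamma> - single \<rho> 1 * \<gamma>' \<in> I"
    proof -
      have eq: "single \<sigma> (1::'k) = single s 1 * (f e - g e)"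
        using A_f[OF e(1)] s by (metis add_diff_cancel_right' mult_single mult.right_neutral)
      have eq': "single \<sigma> 1 * \<gamma> - single \<rho> 1 * \<gamma>'
        = (single s 1 * ?\<gamma> - single \<rho> 1 * \<gamma>') + (single s 1 * \<gamma>) * f e"
        unfolding eq by (simp add: algebra_simps)
      have sV: "single s 1 * \<gamma> \<in> polys V"
        using sX less.prems(2) WV by (intro polys_intros polys_mono[OF WV]) auto
      show ?thesis
        unfolding eq'
        by (rule ideal_add[OF I_ideal *(7) ideal_mult[OF I_ideal sV f_in_span]]) (use e in auto)
    qed
    ultimately show ?thesis using * by blast
  qed
qed

text \<open>All monomials of largest key in a remainder have the same part in the new variables, since they are
  standard and the key separates such parts. The coefficient is not in \<open>J\<close> because its monomials are
  standard as well.\<close>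

lemma top_part:
  assumes a: "a \<in> polys V" "a \<noteq> 0"
    and std: "\<And>m e. m \<in> keys a \<Longrightarrow> e \<in> A \<union> B \<Longrightarrow> \<not> mdvd (lm (f e)) m"
  shows "\<exists>\<mu> \<alpha> k. keys \<mu> \<subseteq> V - W \<and> \<alpha> \<in> polys W \<and> \<alpha> \<notin> J \<and> key_homogeneous \<kappa> k \<alpha>
    \<and> key_below \<kappa> (\<kappa> \<mu> + k) (a - single \<mu> 1 * \<alpha>)"
proof -
  define K where "K = \<kappa> (lm a)"
  have le: "\<kappa> m \<le> K" if "m \<in> keys a" for m
  proof (rule ccontr)
    assume "\<not> \<kappa> m \<le> K"
    then have "lt (lm a) m" unfolding K_def by (intro lt_key) simp
    then show False using lm_props(2)[OF a(2) that] lt_asym lt_irrefl by blast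
  qed
  obtain \<mu> where \<mu>: "\<And>x. lookup \<mu> x = (if x \<in> V - W then lookup (lm a) x else 0)"
    using monomial_part by blast
  define T where "T = {m \<in> keys a. \<kappa> m = K}"
  have T: "\<mu> + (m - \<mu>) = m" "keys (m - \<mu>) \<subseteq> W" if m: "m \<in> T" for m
  proof -
    have V: "keys m \<subseteq> V" "keys (lm a) \<subseteq> V"
      using m a lm_keys_subset[OF a] by (auto simp: T_def polys_iff)
    have eq: "lookup m x = lookup \<mu> x" if "x \<in> V - W" for x
      using separated[OF V _ _ _ that] std m lm_props(1)[OF a(2)] \<mu>[of x] that by (auto simp: T_def K_def)
    show "\<mu> + (m - \<mu>) = m"
    proof (rule poly_mapping_eqI)
      fix x
      show "lookup (\<mu> + (m - \<mu>)) x = lookup m x"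
        using eq[of x] \<mu>[of x] by (cases "x \<in> V - W") (simp_all add: lookup_add lookup_minus)
    qed
    show "keys (m - \<mu>) \<subseteq> W"
    proof
      fix x assume x: "x \<in> keys (m - \<mu>)"
      then have "lookup m x \<noteq> lookup \<mu> x" by (simp add: in_keys_iff lookup_minus)
      then have "x \<notin> V - W" using eq by blast
      moreover have "x \<in> keys m" using x by (auto simp: in_keys_iff lookup_minus)
      ultimately show "x \<in> W" using V(1) by blast
    qed
  qed
  define \<alpha> where "\<alpha> = (\<Sum>m\<in>T. single (m - \<mu>) (lookup a m))"
  have fT: "finite T" by (simp add: T_def)
  have "single \<mu> 1 * \<alpha> = (\<Sum>m\<in>T. single m (lookup a m))"
    unfolding \<alpha>_def sum_distrib_left mult_single by (rule sum.cong) (simp_all add: T(1))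
  then have lookup: "lookup (single \<mu> 1 * \<alpha>) m
      = (if m \<in> T then lookup a m else 0)" for m
    using fT by (simp add: lookup_sum lookup_single when_def)
  have keys_\<alpha>: "\<mu> + m \<in> T \<and> m = \<mu> + m - \<mu>" if "m \<in> keys \<alpha>" for m
  proof -
    have "(\<Sum>t\<in>T. lookup (single (t - \<mu>) (lookup a t)) m) \<noteq> 0"
      using that by (simp add: in_keys_iff \<alpha>_def lookup_sum)
    then obtain t where "t \<in> T" "lookup (single (t - \<mu>) (lookup a t)) m \<noteq> 0"
      using sum.not_neutral_contains_not_neutral by blast
    then have "t \<in> T" "m = t - \<mu>" by (auto simp: lookup_single when_def split: if_splits)
    then show ?thesis using T(1)[of t] by simp
  qed
  have \<alpha>W: "\<alpha> \<in> polys W"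
    unfolding \<alpha>_def using T(2) by (intro polys_sum polys_single) auto
  have "lm a \<in> T" using lm_props(1)[OF a(2)] by (simp add: T_def K_def)
  then have "single \<mu> 1 * \<alpha> \<noteq> 0"
    using lookup[of "lm a"] lm_props(1)[OF a(2)] by (auto simp: in_keys_iff)
  then have nz: "\<alpha> \<noteq> 0" by auto
  have "\<alpha> \<notin> J"
  proof (rule coprime_leading_family.standard_not_in_span[OF coefficient_family nz])
    fix e assume e: "e \<in> B"
    have "\<mu> + lm \<alpha> \<in> keys a"
      using keys_\<alpha>[OF lm_props(1)[OF nz]] by (simp add: T_def)
    then have "\<not> mdvd (lm (f e)) (\<mu> + lm \<alpha>)" using std e by blast
    then show "\<not> mdvd (lm (g e)) (lm \<alpha>)" using mdvd_add(2) B_lm(1)[OF e] by metis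
  qed
  moreover have "key_homogeneous \<kappa> (K - \<kappa> \<mu>) \<alpha>"
    unfolding key_homogeneous_def
  proof
    fix m assume "m \<in> keys \<alpha>"
    then have "\<kappa> (\<mu> + m) = K" using keys_\<alpha>[of m] by (simp add: T_def)
    then show "\<kappa> m = K - \<kappa> \<mu>" by (simp add: key_add algebra_simps)
  qed
  moreover have "key_below \<kappa> (\<kappa> \<mu> + (K - \<kappa> \<mu>)) (a - single \<mu> 1 * \<alpha>)"
    unfolding key_below_def
  proof
    fix m assume "m \<in> keys (a - single \<mu> 1 * \<alpha>)"
    then have "m \<in> keys a" "m \<notin> T"
      by (auto simp: in_keys_iff lookup_minus lookup split: if_splits)
    then show "\<kappa> m < \<kappa> \<mu> + (K - \<kappa> \<mu>)" using le[of m] by (auto simp: T_def)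
  qed
  moreover have "keys \<mu> \<subseteq> V - W" using \<mu> by (auto simp: in_keys_iff split: if_splits)
  ultimately show ?thesis using \<alpha>W by blast
qed

text \<open>The part of largest key decides. It can be rewritten, modulo the ideal and terms of smaller key, as
  a nonzero polynomial with standard leading monomial, and the order refines the key.\<close>

lemma top_not_in_span:
  assumes \<sigma>: "keys \<sigma> \<subseteq> V - W" and \<gamma>: "\<gamma> \<in> polys W" "\<gamma> \<notin> J" "key_homogeneous \<kappa> k \<gamma>"
    and low: "key_below \<kappa> (\<kappa> \<sigma> + k) (p - single \<sigma> 1 * \<gamma>)"
  shows "p \<notin> I"
proof
  assume p: "p \<in> I"
  obtain \<rho> \<gamma>1 k' where \<rho>: "keys \<rho> \<subseteq> V - W" "\<forall>e\<in>A. \<not> mdvd (lm (f e)) \<rho>"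
      "\<gamma>1 \<in> polys W" "\<gamma>1 \<notin> J" "key_homogeneous \<kappa> k' \<gamma>1" "\<kappa> \<rho> + k' = \<kappa> \<sigma> + k"
      "single \<sigma> 1 * \<gamma> - single \<rho> 1 * \<gamma>1 \<in> I"
    using reduce_monomial[OF \<sigma> \<gamma>] by blast
  obtain \<gamma>2 h where \<gamma>2: "\<gamma>2 \<in> polys W" "\<gamma>2 \<noteq> 0" "key_homogeneous \<kappa> k' \<gamma>2"
      "\<forall>e\<in>B. \<not> mdvd (lm (f e)) (lm \<gamma>2)" "h \<in> I" "key_below \<kappa> k' (\<gamma>1 - \<gamma>2 - h)"
    using reduce_coefficient[OF \<rho>(3,4,5)] by blast
  let ?R = "single \<rho> (1::'k)"
  define r where "r = (p - single \<sigma> 1 * \<gamma>) + ?R * (\<gamma>1 - \<gamma>2 - h)"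
  define q where "q = r + ?R * \<gamma>2"
  have R: "?R \<in> polys V" "?R \<noteq> 0" "lm ?R = \<rho>"
    using \<rho>(1) lm_single[of "1::'k" \<rho>] by (auto intro: polys_single simp flip: keys_eq_empty)
  have "q = p - (single \<sigma> 1 * \<gamma> - ?R * \<gamma>1) - ?R * h"
    by (simp add: q_def r_def algebra_simps)
  also have "\<dots> \<in> I"
    using ideal_diff[OF I_ideal ideal_diff[OF I_ideal p \<rho>(7)] ideal_mult[OF I_ideal R(1) \<gamma>2(5)]] .
  finally have qI: "q \<in> I" .
  have "key_below \<kappa> (\<kappa> \<rho> + k') r"
    unfolding r_def
  proof (rule key_below_add)
    show "key_below \<kappa> (\<kappa> \<rho> + k') (?R * (\<gamma>1 - \<gamma>2 - h))"
      by (rule below_mult(1)[OF disjI1[OF homogeneous_single] \<gamma>2(6)])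
  qed (use low \<rho>(6) in simp)
  then have rlow: "lt m (\<rho> + lm \<gamma>2)" if "m \<in> keys r" for m
    using that \<gamma>2(3) lm_props(1)[OF \<gamma>2(2)]
    by (intro lt_key) (auto simp: key_below_def key_homogeneous_def key_add)
  note top = lm_mult[OF R(2) \<gamma>2(2), unfolded R(3)]
  have "r = 0 \<or> lm r \<noteq> lm (?R * \<gamma>2)" using rlow[OF lm_props(1)] top(2) lt_irrefl by metis
  note q = lm_add_neq[OF top(1) this, folded q_def]
  have lmq: "lm q = \<rho> + lm \<gamma>2"
  proof (rule lm_eqI)
    have "\<rho> + lm \<gamma>2 \<notin> keys r" using rlow lt_irrefl by blast
    then show "\<rho> + lm \<gamma>2 \<in> keys q"
      using lm_props(1)[OF top(1)] unfolding top(2) q_def by (simp add: in_keys_iff lookup_add)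
    fix m assume "m \<in> keys q"
    then have "m \<in> keys r \<or> m \<in> keys (?R * \<gamma>2)"
      using Poly_Mapping.keys_add[of r "?R * \<gamma>2"] unfolding q_def by blast
    then show "m = \<rho> + lm \<gamma>2 \<or> lt m (\<rho> + lm \<gamma>2)"
      using rlow[of m] lm_props(2)[OF top(1), of m] unfolding top(2) by blast
  qed
  have "keys (lm \<gamma>2) \<subseteq> W" using lm_keys_subset[OF \<gamma>2(1,2)] .
  have "\<not> mdvd (lm (f e)) (lm q)" if e: "e \<in> A \<union> B" for e
  proof
    assume dvd: "mdvd (lm (f e)) (lm q)"
    show False
    proof (cases "e \<in> A")
      case True
      then have "mdvd (lm (f e)) \<rho>"
        using dvd mdvd_coprime_cancel[of "lm (f e)" \<rho> "lm \<gamma>2"] A_lm(1)[OF True]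
          \<open>keys (lm \<gamma>2) \<subseteq> W\<close> unfolding lmq by blast
      then show False using \<rho>(2) True by blast
    next
      case False
      then have eB: "e \<in> B" using e by blast
      have "keys (lm (f e)) \<subseteq> W"
        using lm_keys_subset[of "g e" W] g_polys g_nz B_lm(1) eB by auto
      then have "mdvd (lm (f e)) (lm \<gamma>2)"
        using dvd mdvd_coprime_cancel[of "lm (f e)" "lm \<gamma>2" \<rho>] \<rho>(1)
        unfolding lmq by (auto simp: add.commute)
      then show False using \<gamma>2(4) eB by blast
    qed
  qed
  then show False using standard_not_in_span[OF q(1)] qI by blast
qed

text \<open>The parts of largest key of two remainders are monomials in the new variables with coefficients
  outside \<open>J\<close>. Their product has the same shape, as \<open>J\<close> is prime, and hence is not in the ideal.\<close>

theorem span_prime: "primeideal I (mpoly_ring V)"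
proof (rule primeidealI[OF I_ideal cring_mpoly_ring])
  have "1 \<notin> I"
  proof (rule standard_not_in_span)
    have "lm (1 :: ('x, 'k) mpoly) = 0" by (rule lm_eqI) simp_all
    then show "\<not> mdvd (lm (f e)) (lm (1 :: ('x, 'k) mpoly))" if "e \<in> A \<union> B" for e
      using that A_lm(2) B_lm(2) by (auto simp: mdvd_def poly_mapping_eq_iff fun_eq_iff)
  qed simp
  then show "polys V \<noteq> I" using polys_1 by blast
next
  fix a b assume ab: "a \<in> polys V" "b \<in> polys V" "a \<otimes>\<^bsub>mpoly_ring V\<^esub> b \<in> I"
  show "a \<in> I \<or> b \<in> I"
  proof (rule ccontr)
    assume contra: "\<not> ?thesis"
    obtain a' where a': "a' \<in> polys V" "a - a' \<in> I"
      "\<And>m e. m \<in> keys a' \<Longrightarrow> e \<in> A \<union> B \<Longrightarrow> \<not> mdvd (lm (f e)) m"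
      using standard_form[OF ab(1)] by blast
    obtain b' where b': "b' \<in> polys V" "b - b' \<in> I"
      "\<And>m e. m \<in> keys b' \<Longrightarrow> e \<in> A \<union> B \<Longrightarrow> \<not> mdvd (lm (f e)) m"
      using standard_form[OF ab(2)] by blast
    have "a * b - a' * b' = b * (a - a') + a' * (b - b')" by (simp add: algebra_simps)
    also have "\<dots> \<in> I"
      using ideal_add[OF I_ideal ideal_mult[OF I_ideal ab(2) a'(2)] ideal_mult[OF I_ideal a'(1) b'(2)]] .
    finally have prod: "a' * b' \<in> I" using ideal_cong[OF I_ideal] ab(3) by simp
    have nz: "a' \<noteq> 0" "b' \<noteq> 0" using contra a'(2) b'(2) by auto
    obtain \<mu> \<alpha> k where \<alpha>: "keys \<mu> \<subseteq> V - W" "\<alpha> \<in> polys W" "\<alpha> \<notin> J" "key_homogeneous \<kappa> k \<alpha>"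
      "key_below \<kappa> (\<kappa> \<mu> + k) (a' - single \<mu> 1 * \<alpha>)"
      using top_part[OF a'(1) nz(1) a'(3)] by blast
    obtain \<nu> \<beta> l where \<beta>: "keys \<nu> \<subseteq> V - W" "\<beta> \<in> polys W" "\<beta> \<notin> J" "key_homogeneous \<kappa> l \<beta>"
      "key_below \<kappa> (\<kappa> \<nu> + l) (b' - single \<nu> 1 * \<beta>)"
      using top_part[OF b'(1) nz(2) b'(3)] by blast
    let ?a = "single \<mu> 1 * \<alpha>" and ?b = "single \<nu> 1 * \<beta>"
    have ha: "key_homogeneous \<kappa> (\<kappa> \<mu> + k) ?a" and hb: "key_homogeneous \<kappa> (\<kappa> \<nu> + l) ?b"
      using homogeneous_mult homogeneous_single \<alpha>(4) \<beta>(4) by blast+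
    have "a' * b' - ?a * ?b = ?a * (b' - ?b) + (a' - ?a) * ?b + (a' - ?a) * (b' - ?b)"
      by (simp add: algebra_simps)
    moreover have "key_below \<kappa> ((\<kappa> \<mu> + k) + (\<kappa> \<nu> + l)) \<dots>"
      using below_mult(1)[OF disjI1[OF ha] \<beta>(5)] below_mult(2)[OF disjI1[OF hb] \<alpha>(5)]
        below_mult(1)[OF disjI2[OF \<alpha>(5)] \<beta>(5)] by (intro key_below_add) auto
    moreover have "?a * ?b = single (\<mu> + \<nu>) 1 * (\<alpha> * \<beta>)"
      by (metis (no_types, lifting) mult.assoc mult.left_commute mult_1 mult_single)
    moreover have "(\<kappa> \<mu> + k) + (\<kappa> \<nu> + l) = \<kappa> (\<mu> + \<nu>) + (k + l)" by (simp add: key_add algebra_simps)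
    ultimately have "key_below \<kappa> (\<kappa> (\<mu> + \<nu>) + (k + l)) (a' * b' - single (\<mu> + \<nu>) 1 * (\<alpha> * \<beta>))"
      by simp
    moreover have "keys (\<mu> + \<nu>) \<subseteq> V - W" using \<alpha>(1) \<beta>(1) by (simp add: keys_add_nat)
    moreover have "\<alpha> * \<beta> \<in> polys W" "\<alpha> * \<beta> \<notin> J"
      using \<alpha> \<beta> mpoly_primeD[OF prime] by (auto intro: polys_intros)
    moreover have "key_homogeneous \<kappa> (k + l) (\<alpha> * \<beta>)" using homogeneous_mult \<alpha>(4) \<beta>(4) by blast
    ultimately have "a' * b' \<notin> I" using top_not_in_span by blast
    then show False using prod by blast
  qed
qed

end

section \<open>Refining monomial orders\<close>

definition refine :: "(('x \<Rightarrow>\<^sub>0 nat) \<Rightarrow> 'o::linorder) \<Rightarrow> (('x \<Rightarrow>\<^sub>0 nat) \<Rightarrow> ('x \<Rightarrow>\<^sub>0 nat) \<Rightarrow> bool)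
    \<Rightarrow> ('x \<Rightarrow>\<^sub>0 nat) \<Rightarrow> ('x \<Rightarrow>\<^sub>0 nat) \<Rightarrow> bool" where
  "refine \<kappa> lt a b \<longleftrightarrow> \<kappa> a < \<kappa> b \<or> \<kappa> a = \<kappa> b \<and> lt a b"

lemma monomial_order_refine:
  assumes "monomial_order lt" "additive_key \<kappa>" and deg: "\<And>a b. \<kappa> a < \<kappa> b \<Longrightarrow> mdeg a \<le> mdeg b"
  shows "monomial_order (refine \<kappa> lt)"
proof -
  interpret monomial_order lt by fact
  interpret additive_key \<kappa> by fact
  show ?thesis
  proof
    show "\<not> refine \<kappa> lt a a" for a by (simp add: refine_def lt_irrefl)
    show "refine \<kappa> lt a c" if "refine \<kappa> lt a b" "refine \<kappa> lt b c" for a b c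
      using that lt_trans unfolding refine_def by (metis order_less_trans)
    show "refine \<kappa> lt a b \<or> refine \<kappa> lt b a" if "a \<noteq> b" for a b
      using lt_total[OF that] unfolding refine_def by (metis neqE)
    show "refine \<kappa> lt (a + c) (b + c)" if "refine \<kappa> lt a b" for a b c
      using that lt_add unfolding refine_def by (auto simp: key_add)
    show "mdeg a \<le> mdeg b" if "refine \<kappa> lt a b" for a b
      using that lt_deg deg unfolding refine_def by blast
  qed
qed

text \<open>The lexicographic order of exponent vectors is a tie-breaker. It need not be a well-order on its own,
  but becomes one on finitely many variables once the degree is compared first.\<close>

definition deglex :: "('x::linorder \<Rightarrow>\<^sub>0 nat) \<Rightarrow> ('x \<Rightarrow>\<^sub>0 nat) \<Rightarrow> bool" where
  "deglex a b \<longleftrightarrow> mdeg a < mdeg b \<or> mdeg a = mdeg b \<and> a < b"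

lemma monomial_order_deglex: "monomial_order (deglex :: ('x::linorder \<Rightarrow>\<^sub>0 nat) \<Rightarrow> _)"
proof
  show "deglex a b \<or> deglex b a" if "a \<noteq> b" for a b :: "'x \<Rightarrow>\<^sub>0 nat"
    using that unfolding deglex_def by (metis neqE)
  show "deglex (a + c) (b + c)" if "deglex a b" for a b c :: "'x \<Rightarrow>\<^sub>0 nat"
    using that unfolding deglex_def by (auto simp: mdeg_add)
qed (auto simp: deglex_def)

section \<open>The LSS polynomials\<close>

definition column_monomial :: "nat set \<Rightarrow> nat \<Rightarrow> (nat \<times> nat) \<Rightarrow>\<^sub>0 nat" where
  "column_monomial e j = (\<Sum>i\<in>e. single (i, j) 1)"

lemma lookup_column_monomial:
  assumes "finite e"
  shows "lookup (column_monomial e j) (i, j') = (if i \<in> e \<and> j' = j then 1 else 0)"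
proof -
  have "lookup (column_monomial e j) (i, j') = (\<Sum>i'\<in>e. if i' = i then (if j' = j then 1 else 0) else 0)"
    unfolding column_monomial_def lookup_sum
    by (intro sum.cong) (auto simp: lookup_single when_def)
  then show ?thesis using assms by simp
qed

lemma keys_column_monomial:
  assumes "finite e"
  shows "keys (column_monomial e j) = e \<times> {j}"
proof (rule Set.set_eqI)
  fix x :: "nat \<times> nat"
  obtain i j' where "x = (i, j')" by (cases x)
  then show "x \<in> keys (column_monomial e j) \<longleftrightarrow> x \<in> e \<times> {j}"
    by (simp add: in_keys_iff lookup_column_monomial[OF assms])
qed

lemma mdeg_column_monomial:
  assumes "finite e"
  shows "mdeg (column_monomial e j) = card e"
proof -
  have "mdeg (column_monomial e j) = (\<Sum>x\<in>e \<times> {j}. 1)"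
    unfolding mdeg_def keys_column_monomial[OF assms]
    by (intro sum.cong) (auto simp: lookup_column_monomial[OF assms])
  then show ?thesis by (simp add: card_cartesian_product)
qed

lemma column_monomial_eq_iff:
  assumes "finite e" "finite e'" "e \<noteq> {}"
  shows "column_monomial e j = column_monomial e' j' \<longleftrightarrow> e = e' \<and> j = j'"
proof
  assume "column_monomial e j = column_monomial e' j'"
  then have "e \<times> {j} = e' \<times> {j'}" using assms(1,2) keys_column_monomial by metis
  then show "e = e' \<and> j = j'" using assms(3) by (auto simp: times_eq_iff)
qed simp

text \<open>The part of an LSS polynomial that lies in the columns \<open>l\<close> to \<open>D\<close>.\<close>

definition lss_columns :: "nat \<Rightarrow> nat \<Rightarrow> nat set \<Rightarrow> (nat \<times> nat, 'k::field) mpoly" where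
  "lss_columns l D e = (\<Sum>j=l..D. single (column_monomial e j) 1)"

lemma lookup_lss_columns:
  assumes "finite e" "e \<noteq> {}"
  shows "lookup (lss_columns l D e :: (_, 'k::field) mpoly) m
    = (if m \<in> column_monomial e ` {l..D} then 1 else 0)"
proof (cases "m \<in> column_monomial e ` {l..D}")
  case True
  then obtain j where j: "j \<in> {l..D}" "m = column_monomial e j" by blast
  have "lookup (lss_columns l D e :: (_, 'k) mpoly) m = (\<Sum>j'=l..D. if j' = j then 1 else 0)"
    unfolding lss_columns_def lookup_sum j(2)
    by (intro sum.cong) (auto simp: lookup_single when_def column_monomial_eq_iff[OF assms(1) assms(1) assms(2)])
  then show ?thesis using True j(1) by simp
next
  case False
  then have "lookup (lss_columns l D e :: (_, 'k) mpoly) m = 0"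
    unfolding lss_columns_def lookup_sum by (intro sum.neutral) (auto simp: lookup_single when_def)
  then show ?thesis using False by simp
qed

lemma keys_lss_columns:
  assumes "finite e" "e \<noteq> {}"
  shows "keys (lss_columns l D e :: (_, 'k::field) mpoly) = column_monomial e ` {l..D}"
  by (rule Set.set_eqI) (simp add: in_keys_iff lookup_lss_columns[OF assms])

lemma prod_Var: "finite e \<Longrightarrow> (\<Prod>i\<in>e. Var (i, j)) = single (column_monomial e j) (1::'k::field)"
  by (induction e rule: finite_induct) (auto simp: column_monomial_def Var_def mult_single)

lemma lss_poly_eq: "finite e \<Longrightarrow> lss_poly d e = lss_columns 1 d e"
  by (simp add: lss_poly_def lss_columns_def prod_Var)

lemma lss_columns_split: "l \<le> D \<Longrightarrow>
  lss_columns l D e = single (column_monomial e l) 1 + lss_columns (Suc l) D e"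
  unfolding lss_columns_def by (simp add: sum.atLeast_Suc_atMost)

section \<open>Hypergraphs decomposed into matchings\<close>

text \<open>The edges with \<open>cl e = l\<close> form the \<open>l\<close>-th matching and \<open>w l\<close> is its weight. The usual definition of a
  positive matching asks for a positive weight on the matching; lowering the weight of one vertex of
  each of its edges turns it into zero and
  keeps the later edges negative. With weight zero the monomial of such an edge in column \<open>l\<close>
  ties with its monomials in the later columns.\<close>

locale matching_decomposition =
  fixes n d r :: nat and E :: "nat set set" and cl :: "nat set \<Rightarrow> nat" and w :: "nat \<Rightarrow> nat \<Rightarrow> int"
  assumes edge: "e \<in> E \<Longrightarrow> e \<subseteq> {1..n}" and card_edge: "e \<in> E \<Longrightarrow> card e = r" and r_pos: "0 < r"
    and cl: "e \<in> E \<Longrightarrow> 1 \<le> cl e \<and> cl e \<le> d"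
    and matching: "\<lbrakk>e \<in> E; e' \<in> E; cl e = cl e'; e \<noteq> e'\<rbrakk> \<Longrightarrow> e \<inter> e' = {}"
    and weight_zero: "e \<in> E \<Longrightarrow> (\<Sum>i\<in>e. w (cl e) i) = 0"
    and weight_neg: "\<lbrakk>e \<in> E; 1 \<le> l; l < cl e\<rbrakk> \<Longrightarrow> (\<Sum>i\<in>e. w l i) < 0"
begin

lemma finite_E: "finite E" and finite_edge: "e \<in> E \<Longrightarrow> finite e" and edge_nonempty: "e \<in> E \<Longrightarrow> e \<noteq> {}"
proof -
  show "finite E" using edge by (intro finite_subset[of E "Pow {1..n}"]) auto
  show "finite e" if "e \<in> E" for e using edge[OF that] finite_subset by blast
  show "e \<noteq> {}" if "e \<in> E" for e using card_edge[OF that] r_pos by auto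
qed

lemma edges_through_vertex:
  assumes "e \<in> E" "i \<in> e"
  shows "{e'. e' \<in> E \<and> cl e' = cl e \<and> i \<in> e'} = {e}"
proof (rule subset_antisym)
  show "{e'. e' \<in> E \<and> cl e' = cl e \<and> i \<in> e'} \<subseteq> {e}"
  proof
    fix e' assume e': "e' \<in> {e'. e' \<in> E \<and> cl e' = cl e \<and> i \<in> e'}"
    show "e' \<in> {e}"
    proof (rule ccontr)
      assume "e' \<notin> {e}"
      then have "e' \<inter> e = {}" using e' assms(1) by (intro matching) auto
      then show False using e' assms(2) by auto
    qed
  qed
qed (use assms in auto)

text \<open>Exponent of the vertex \<open>i\<close> in column \<open>l\<close>, relative to the smallest vertex of the edge of the \<open>l\<close>-th
  matching through \<open>i\<close> if there is one. The sum has at most one summand.\<close>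

definition difference_key :: "nat \<Rightarrow> nat \<Rightarrow> ((nat \<times> nat) \<Rightarrow>\<^sub>0 nat) \<Rightarrow> int" where
  "difference_key l i m = int (lookup m (i, l))
     - (\<Sum>e | e \<in> E \<and> cl e = l \<and> i \<in> e. int (lookup m (Min e, l)))"

text \<open>A lexicographic list of integers, encoded as a finitely supported function because this type is a
  linearly ordered group: the degree at \<open>0\<close>, the weight of column \<open>l\<close> at \<open>1\<close>, and behind them the
  difference of exponents for each vertex. The latter vanish on the monomials of all edges in the
  matching and separate the standard monomials of the column.\<close>

definition column_key :: "nat \<Rightarrow> ((nat \<times> nat) \<Rightarrow>\<^sub>0 nat) \<Rightarrow> nat \<Rightarrow>\<^sub>0 int" where
  "column_key l m = single 0 (int (mdeg m))
     + single 1 (\<Sum>i=1..n. w l i * int (lookup m (i, l)))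
     + (\<Sum>i=1..n. single (Suc i) (difference_key l i m))"

text \<open>Breaks the tie in favour of column \<open>l\<close> for the edges of the \<open>l\<close>-th matching. The degree comes first
  so that the refined order still refines the degree.\<close>

definition column_degree_key :: "nat \<Rightarrow> ((nat \<times> nat) \<Rightarrow>\<^sub>0 nat) \<Rightarrow> nat \<Rightarrow>\<^sub>0 int" where
  "column_degree_key l m = single 0 (int (mdeg m))
     + single 1 (\<Sum>i=1..n. int (lookup m (i, l)))"

text \<open>The recursion runs through the columns \<open>d, d - 1, \<dots>\<close> and counts the columns that have been treated.\<close>

fun column_order_aux :: "nat \<Rightarrow> ((nat \<times> nat) \<Rightarrow>\<^sub>0 nat) \<Rightarrow> ((nat \<times> nat) \<Rightarrow>\<^sub>0 nat) \<Rightarrow> bool" where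
  "column_order_aux 0 = deglex"
| "column_order_aux (Suc k) = refine (column_key (d - k)) (refine (column_degree_key (d - k)) (column_order_aux k))"

definition column_order :: "nat \<Rightarrow> ((nat \<times> nat) \<Rightarrow>\<^sub>0 nat) \<Rightarrow> ((nat \<times> nat) \<Rightarrow>\<^sub>0 nat) \<Rightarrow> bool" where
  "column_order l = column_order_aux (Suc d - l)"

lemma column_order_rec:
  assumes "l \<le> d"
  shows "column_order l = refine (column_key l) (refine (column_degree_key l) (column_order (Suc l)))"
proof -
  have "Suc d - l = Suc (d - l)" "Suc d - Suc l = d - l" "d - (d - l) = l" using assms by auto
  then show ?thesis by (simp add: column_order_def)
qed

lemma lookup_column_key:
  "lookup (column_key l m) 0 = int (mdeg m)"
  "lookup (column_key l m) 1 = (\<Sum>i=1..n. w l i * int (lookup m (i, l)))"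
  "lookup (column_key l m) (Suc (Suc i)) = (if Suc i \<le> n then difference_key l (Suc i) m else 0)"
proof -
  have "lookup (\<Sum>i=1..n. single (Suc i) (difference_key l i m)) c
    = (\<Sum>i=1..n. if i = c - 1 then (if 0 < c then difference_key l i m else 0) else 0)" for c
    unfolding lookup_sum by (intro sum.cong) (auto simp: lookup_single when_def)
  then have *: "lookup (\<Sum>i=1..n. single (Suc i) (difference_key l i m)) c
    = (if 2 \<le> c \<and> c \<le> Suc n then difference_key l (c - 1) m else 0)" for c
    by auto
  show "lookup (column_key l m) 0 = int (mdeg m)"
  "lookup (column_key l m) 1 = (\<Sum>i=1..n. w l i * int (lookup m (i, l)))"
  "lookup (column_key l m) (Suc (Suc i)) = (if Suc i \<le> n then difference_key l (Suc i) m else 0)"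
    unfolding column_key_def lookup_add * by (simp_all add: lookup_single when_def del: single_of_nat)
qed

lemma key_less_iff:
  "(a :: nat \<Rightarrow>\<^sub>0 int) < b \<longleftrightarrow> (\<exists>k. lookup a k < lookup b k
     \<and> (\<forall>k'<k. lookup a k' = lookup b k'))"
  by (simp add: less_poly_mapping.rep_eq less_fun_def)

lemma key_less_first: "(a :: nat \<Rightarrow>\<^sub>0 int) < b \<Longrightarrow> lookup a 0 \<le> lookup b 0"
  unfolding key_less_iff by (metis bot_nat_0.not_eq_extremum order_less_imp_le order_refl)

lemma additive_column_key: "additive_key (column_key l)"
proof
  fix a b
  have p: "difference_key l i (a + b) = difference_key l i a + difference_key l i b" for i
    by (simp add: difference_key_def lookup_add sum.distrib)
  show "column_key l (a + b) = column_key l a + column_key l b"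
    by (simp add: column_key_def mdeg_add p lookup_add single_add sum.distrib distrib_left)
qed

lemma additive_column_degree_key: "additive_key (column_degree_key l)"
  by unfold_locales (simp add: column_degree_key_def mdeg_add lookup_add single_add sum.distrib)

lemma lookup_column_degree_key:
  "lookup (column_degree_key l m) 0 = int (mdeg m)"
  "lookup (column_degree_key l m) 1 = (\<Sum>i=1..n. int (lookup m (i, l)))"
  unfolding column_degree_key_def lookup_add by (simp_all add: lookup_single when_def del: single_of_nat)

lemma column_monomial_order: "monomial_order (column_order l)"
proof -
  have "monomial_order (column_order_aux k)" for k
  proof (induction k)
    case 0
    show ?case by (simp add: monomial_order_deglex)
  next
    case (Suc k)
    show ?case
      unfolding column_order_aux.simps
    proof (intro monomial_order_refine Suc additive_column_key additive_column_degree_key)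
      show "mdeg a \<le> mdeg b" if "column_key (d - k) a < column_key (d - k) b" for a b
        using key_less_first[OF that] by (simp add: lookup_column_key)
      show "mdeg a \<le> mdeg b" if "column_degree_key (d - k) a < column_degree_key (d - k) b" for a b
        using key_less_first[OF that] by (simp add: lookup_column_degree_key)
    qed
  qed
  then show ?thesis by (simp add: column_order_def)
qed

lemma sum_edge:
  assumes "e \<in> E"
  shows "(\<Sum>i=1..n. h i * int (lookup (column_monomial e j) (i, l))) = (if j = l then sum h e else 0)"
proof (cases "j = l")
  case True
  have "(\<Sum>i=1..n. h i * int (lookup (column_monomial e j) (i, l))) = (\<Sum>i\<in>{1..n}. if i \<in> e then h i else 0)"
    using True by (intro sum.cong) (auto simp: lookup_column_monomial[OF finite_edge[OF assms]])
  also have "\<dots> = sum h e"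
    using edge[OF assms] by (simp add: sum.inter_restrict[symmetric] Int_absorb1)
  finally show ?thesis using True by simp
qed (simp add: lookup_column_monomial[OF finite_edge[OF assms]])

lemma difference_key_column_monomial:
  assumes e: "e \<in> E" and jl: "j \<noteq> l \<or> cl e = l"
  shows "difference_key l i (column_monomial e j) = 0"
proof (cases "j = l")
  case False
  then show ?thesis by (simp add: difference_key_def lookup_column_monomial[OF finite_edge[OF e]])
next
  case True
  then have cle: "cl e = l" using jl by simp
  show ?thesis
  proof (cases "i \<in> e")
    case i: True
    have "{e'. e' \<in> E \<and> cl e' = l \<and> i \<in> e'} = {e}"
      using edges_through_vertex[OF e i] cle by simp
    then show ?thesis
      using True i Min_in[OF finite_edge[OF e] edge_nonempty[OF e]]
      by (simp add: difference_key_def lookup_column_monomial[OF finite_edge[OF e]])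
  next
    case False
    have "Min e' \<notin> e" if "e' \<in> E" "cl e' = l" "i \<in> e'" for e'
    proof -
      have "e' \<inter> e = {}" using that cle False by (intro matching[OF that(1) e]) auto
      moreover have "Min e' \<in> e'" using Min_in[OF finite_edge[OF that(1)] edge_nonempty[OF that(1)]] .
      ultimately show ?thesis by blast
    qed
    then show ?thesis
      using False by (simp add: difference_key_def lookup_column_monomial[OF finite_edge[OF e]])
  qed
qed

lemma column_key_column_monomial:
  assumes e: "e \<in> E" and jl: "j \<noteq> l \<or> cl e = l"
  shows "column_key l (column_monomial e j) = single 0 (int r)"
proof (rule poly_mapping_eqI)
  fix c :: nat
  consider "c = 0" | "c = 1" | i where "c = Suc (Suc i)" by (metis One_nat_def not0_implies_Suc)
  then show "lookup (column_key l (column_monomial e j)) c = lookup (single 0 (int r)) c"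
  proof cases
    case 1
    then show ?thesis
      by (simp add: lookup_column_key mdeg_column_monomial[OF finite_edge[OF e]] card_edge[OF e] del: single_of_nat)
  next
    case 2
    have "lookup (column_key l (column_monomial e j)) 1 = 0"
      unfolding lookup_column_key sum_edge[OF e] using weight_zero[OF e] jl by auto
    then show ?thesis using 2 by (simp add: lookup_single when_def del: single_of_nat)
  next
    case 3
    then show ?thesis
      by (simp add: lookup_column_key difference_key_column_monomial[OF e jl] lookup_single when_def del: single_of_nat)
  qed
qed

lemma column_key_later:
  assumes e: "e \<in> E" "1 \<le> l" "l < cl e"
  shows "column_key l (column_monomial e l) < single 0 (int r)"
  unfolding key_less_iff
proof (intro exI[of _ 1] conjI allI impI)
  show "lookup (column_key l (column_monomial e l)) 1 < lookup (single 0 (int r)) 1"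
    unfolding lookup_column_key sum_edge[OF e(1)] using weight_neg[OF e] by (simp add: lookup_single when_def)
  show "lookup (column_key l (column_monomial e l)) k = lookup (single 0 (int r)) k"
    if "k < 1" for k
    using that by (simp add: lookup_column_key mdeg_column_monomial[OF finite_edge[OF e(1)]] card_edge[OF e(1)]
        del: single_of_nat)
qed

lemma column_degree_key_column_monomial:
  assumes e: "e \<in> E" and "j \<noteq> l" "j' \<noteq> l"
  shows "column_degree_key l (column_monomial e j) = column_degree_key l (column_monomial e j')"
    "column_degree_key l (column_monomial e j) < column_degree_key l (column_monomial e l)"
proof -
  have S: "(\<Sum>i=1..n. int (lookup (column_monomial e j) (i, l))) = (if j = l then int r else 0)" for j
    using sum_edge[OF e, of "\<lambda>_. 1" j l] card_edge[OF e] by simp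
  show "column_degree_key l (column_monomial e j) = column_degree_key l (column_monomial e j')"
    using assms S[of j] S[of j'] by (simp add: column_degree_key_def mdeg_column_monomial[OF finite_edge[OF e]])
  show "column_degree_key l (column_monomial e j) < column_degree_key l (column_monomial e l)"
    unfolding key_less_iff
  proof (intro exI[of _ 1] conjI allI impI)
    show "lookup (column_degree_key l (column_monomial e j)) 1
        < lookup (column_degree_key l (column_monomial e l)) 1"
      unfolding lookup_column_degree_key S using assms r_pos by simp
    show "lookup (column_degree_key l (column_monomial e j)) k
        = lookup (column_degree_key l (column_monomial e l)) k" if "k < 1" for k
      using that by (simp add: lookup_column_degree_key mdeg_column_monomial[OF finite_edge[OF e]])
  qed
qed

text \<open>For a column \<open>l\<close> before the class of \<open>e\<close>, the weight makes the monomial in column \<open>l\<close> smaller than the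
  others, which tie. At the class of \<open>e\<close> all monomials have the same weight and the column degree
  decides.\<close>

lemma column_order_leading:
  assumes "e \<in> E" "1 \<le> l" "l \<le> cl e" "l \<le> j" "j \<noteq> cl e"
  shows "column_order l (column_monomial e j) (column_monomial e (cl e))"
  using assms(2-)
proof (induction "Suc d - l" arbitrary: l)
  case 0
  then show ?case using cl[OF assms(1)] by auto
next
  case (Suc k)
  have l: "l \<le> d" using Suc.hyps(2) by auto
  show ?case
  proof (cases "l = cl e")
    case True
    then have "column_key l (column_monomial e j) = column_key l (column_monomial e l)"
      "column_degree_key l (column_monomial e j) < column_degree_key l (column_monomial e l)"
      using column_key_column_monomial[OF assms(1)] column_degree_key_column_monomial(2)[OF assms(1), of j l j] Suc.prems
      by auto
    then show ?thesis using True unfolding column_order_rec[OF l] refine_def by auto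
  next
    case False
    then have less: "l < cl e" using Suc.prems by simp
    have key: "column_key l (column_monomial e (cl e)) = single 0 (int r)"
      using column_key_column_monomial[OF assms(1)] False by auto
    show ?thesis
    proof (cases "j = l")
      case True
      then show ?thesis
        using column_key_later[OF assms(1) Suc.prems(1) less] key unfolding column_order_rec[OF l] refine_def by simp
    next
      case jl: False
      have "column_order (Suc l) (column_monomial e j) (column_monomial e (cl e))"
        using Suc.hyps(1)[of "Suc l"] Suc.hyps(2) Suc.prems less jl by auto
      then show ?thesis
        using column_key_column_monomial[OF assms(1), of j l] jl key False
          column_degree_key_column_monomial(1)[OF assms(1) jl, of "cl e"]
        unfolding column_order_rec[OF l] refine_def by auto
    qed
  qed
qed

definition column_vars :: "nat \<Rightarrow> nat \<Rightarrow> (nat \<times> nat) set" where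
  "column_vars l D = {1..n} \<times> {l..D}"

lemma lss_columns_polys:
  assumes e: "e \<in> E"
  shows "lss_columns l D e \<in> polys (column_vars l D)"
  unfolding lss_columns_def
proof (rule polys_sum, rule polys_single)
  fix j assume "j \<in> {l..D}"
  then show "1 = 0 \<or> keys (column_monomial e j) \<subseteq> column_vars l D"
    using edge[OF e] by (auto simp: keys_column_monomial[OF finite_edge[OF e]] column_vars_def)
qed

lemma lm_lss_columns:
  assumes e: "e \<in> E" and l: "1 \<le> l" "l \<le> l'" "l' \<le> cl e" "cl e \<le> D"
  shows "monomial_order.lm (column_order l) (lss_columns l' D e :: (_, 'k::field) mpoly) = column_monomial e (cl e)"
proof -
  interpret monomial_order "column_order l" by (rule column_monomial_order)
  note keys = keys_lss_columns[OF finite_edge[OF e] edge_nonempty[OF e]]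
  show ?thesis
  proof (rule lm_eqI)
    show "column_monomial e (cl e) \<in> keys (lss_columns l' D e :: (_, 'k) mpoly)"
      unfolding keys using l by auto
    fix m assume "m \<in> keys (lss_columns l' D e :: (_, 'k) mpoly)"
    then obtain j where "m = column_monomial e j" "l' \<le> j" unfolding keys by auto
    then show "m = column_monomial e (cl e) \<or> column_order l m (column_monomial e (cl e))"
      using column_order_leading[OF e l(1), of j] l by (cases "j = cl e") auto
  qed
qed

lemma lss_columns_family:
  assumes l: "1 \<le> l" "l \<le> l'" "d \<le> D"
  shows "coprime_leading_family (column_order l) (column_vars l' D) {e \<in> E. l' \<le> cl e}
    (lss_columns l' D :: _ \<Rightarrow> (_, 'k::field) mpoly)"
proof -
  interpret monomial_order "column_order l" by (rule column_monomial_order)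
  have lm: "lm (lss_columns l' D e :: (_, 'k) mpoly) = column_monomial e (cl e)" if "e \<in> E" "l' \<le> cl e" for e
    by (rule lm_lss_columns[OF that(1) l(1,2) that(2)]) (use cl[OF that(1)] l(3) in simp)
  show ?thesis
  proof
    show "finite (column_vars l' D)" by (simp add: column_vars_def)
    show "finite {e \<in> E. l' \<le> cl e}" using finite_E by simp
    fix e assume e: "e \<in> {e \<in> E. l' \<le> cl e}"
    then show "(lss_columns l' D e :: (_, 'k) mpoly) \<in> polys (column_vars l' D)" by (simp add: lss_columns_polys)
    have "keys (lss_columns l' D e :: (_, 'k) mpoly) \<noteq> {}"
      using e cl[of e] l(3) by (simp add: keys_lss_columns finite_edge edge_nonempty)
    then show "(lss_columns l' D e :: (_, 'k) mpoly) \<noteq> 0" by auto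
    fix e' assume e': "e' \<in> {e \<in> E. l' \<le> cl e}" "e \<noteq> e'"
    have "cl e \<noteq> cl e' \<or> e \<inter> e' = {}" using matching[of e e'] e e' by auto
    then show "keys (lm (lss_columns l' D e :: (_, 'k) mpoly))
        \<inter> keys (lm (lss_columns l' D e' :: (_, 'k) mpoly)) = {}"
      using e e' by (auto simp: lm keys_column_monomial finite_edge)
  qed
qed

text \<open>The ideal contains only linear combinations of its generators in degree \<open>r\<close>, and the monomial of \<open>e\<close>
  in column \<open>D\<close> occurs in none of these. For \<open>D > d\<close> the last column is available even when all
  columns of the matchings have been removed.\<close>

lemma lss_columns_not_in_ideal:
  assumes e: "e \<in> E" "e \<notin> B" and B: "B \<subseteq> E" and lD: "l \<le> D"
  shows "(lss_columns l D e :: (_, 'k::field) mpoly) \<notin> Idl\<^bsub>mpoly_ring (column_vars l D)\<^esub> (lss_columns l D ` B)"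
proof
  let ?f = "lss_columns l D :: _ \<Rightarrow> (_, 'k) mpoly"
  assume mem: "?f e \<in> Idl\<^bsub>mpoly_ring (column_vars l D)\<^esub> (?f ` B)"
  have sub: "?f ` B \<subseteq> polys (column_vars l D)" using lss_columns_polys B by auto
  have deg: "mdeg m = r" if "e \<in> E" "m \<in> keys (?f e)" for e m
    using that by (auto simp: keys_lss_columns finite_edge edge_nonempty mdeg_column_monomial card_edge)
  have degB: "mdeg m = r" if "p \<in> ?f ` B" "m \<in> keys p" for p m
    using that deg B by blast
  obtain q where q: "q \<in> ps.span (?f ` B)" "\<forall>m\<in>keys (?f e - q). r < mdeg m"
    using Idl_lowest_degree[OF sub _ sub _ mem, of r] degB by blast
  \<comment> \<open>a monomial of the edge e that no other edge shares\<close>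
  define m where "m = column_monomial e D"
  have m: "m \<in> keys (?f e)"
    using lD by (simp add: m_def keys_lss_columns finite_edge edge_nonempty e(1))
  have "keys q \<subseteq> (\<Union>e'\<in>B. column_monomial e' ` {l..D})"
    using B by (intro keys_span_subset[OF q(1)]) (auto simp: keys_lss_columns finite_edge edge_nonempty subset_iff)
  moreover have "m \<notin> (\<Union>e'\<in>B. column_monomial e' ` {l..D})"
    using e B column_monomial_eq_iff[OF finite_edge[OF e(1)] finite_edge edge_nonempty[OF e(1)]]
    unfolding m_def by auto
  ultimately have "m \<notin> keys q" by blast
  then have "m \<in> keys (?f e - q)" using m by (simp add: in_keys_iff lookup_minus)
  then show False using q(2) deg[OF e(1) m] by auto
qed

text \<open>The difference of two exponent vectors with the same key is constant along each edge of the matching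
  and zero elsewhere. If it were positive on some edge, the column monomial of that edge would divide
  the first vector, and if it were negative, the second.\<close>

lemma column_key_separates:
  assumes key: "column_key l a = column_key l b" and i: "i \<in> {1..n}"
    and std: "\<And>e. e \<in> E \<Longrightarrow> cl e = l \<Longrightarrow> \<not> mdvd (column_monomial e l) a"
      "\<And>e. e \<in> E \<Longrightarrow> cl e = l \<Longrightarrow> \<not> mdvd (column_monomial e l) b"
  shows "lookup a (i, l) = lookup b (i, l)"
proof -
  define \<delta> where "\<delta> i = int (lookup a (i, l)) - int (lookup b (i, l))" for i
  have pk: "\<delta> i = (\<Sum>e | e \<in> E \<and> cl e = l \<and> i \<in> e. \<delta> (Min e))" if i_range: "i \<in> {1..n}" for i
  proof -
    obtain i' where i': "i = Suc i'" using i_range by (cases i) auto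
    have "lookup (column_key l a) (Suc (Suc i')) = lookup (column_key l b) (Suc (Suc i'))"
      using key by simp
    then have "difference_key l i a = difference_key l i b" unfolding lookup_column_key using i_range i' by simp
    then show ?thesis by (simp add: difference_key_def \<delta>_def sum_subtractf)
  qed
  have "\<delta> i = 0"
  proof (cases "\<exists>e\<in>E. cl e = l \<and> i \<in> e")
    case False
    then have none: "{e. e \<in> E \<and> cl e = l \<and> i \<in> e} = {}" by blast
    show ?thesis using pk[OF i] unfolding none by simp
  next
    case True
    then obtain e where e: "e \<in> E" "cl e = l" "i \<in> e" by blast
    have const: "\<delta> j = \<delta> (Min e)" if "j \<in> e" for j
    proof -
      have "{e'. e' \<in> E \<and> cl e' = l \<and> j \<in> e'} = {e}" using edges_through_vertex[OF e(1) that] e(2) by simp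
      moreover have "j \<in> {1..n}" using edge[OF e(1)] that by blast
      ultimately show ?thesis using pk[of j] by simp
    qed
    have pos: "mdvd (column_monomial e l) m" if "\<And>j. j \<in> e \<Longrightarrow> 0 < lookup m (j, l)" for m
      unfolding mdvd_def
    proof
      fix x :: "nat \<times> nat"
      show "lookup (column_monomial e l) x \<le> lookup m x"
        using that[of "fst x"] by (cases x) (auto simp: lookup_column_monomial[OF finite_edge[OF e(1)]] Suc_le_eq)
    qed
    have "\<not> 0 < \<delta> (Min e)"
    proof
      assume *: "0 < \<delta> (Min e)"
      have "0 < lookup a (j, l)" if "j \<in> e" for j
        using const[OF that] * unfolding \<delta>_def by linarith
      then show False using pos std(1) e by blast
    qed
    moreover have "\<not> \<delta> (Min e) < 0"
    proof
      assume *: "\<delta> (Min e) < 0"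
      have "0 < lookup b (j, l)" if "j \<in> e" for j
        using const[OF that] * unfolding \<delta>_def by linarith
      then show False using pos std(2) e by blast
    qed
    ultimately show ?thesis using const[OF e(3)] by simp
  qed
  then show ?thesis by (simp add: \<delta>_def)
qed

lemma prime_step:
  assumes l: "1 \<le> l" "l \<le> d" and D: "d < D"
    and IH: "primeideal (Idl\<^bsub>mpoly_ring (column_vars (Suc l) D)\<^esub>
      ((lss_columns (Suc l) D :: _ \<Rightarrow> (_, 'k::field) mpoly) ` {e \<in> E. Suc l \<le> cl e})) (mpoly_ring (column_vars (Suc l) D))"
  shows "primeideal (Idl\<^bsub>mpoly_ring (column_vars l D)\<^esub>
      ((lss_columns l D :: _ \<Rightarrow> (_, 'k::field) mpoly) ` {e \<in> E. l \<le> cl e})) (mpoly_ring (column_vars l D))"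
proof -
  let ?A = "{e \<in> E. cl e = l}" and ?B = "{e \<in> E. Suc l \<le> cl e}"
  let ?f = "lss_columns l D :: _ \<Rightarrow> (_, 'k) mpoly" and ?g = "lss_columns (Suc l) D :: _ \<Rightarrow> (_, 'k) mpoly"
  have AB: "{e \<in> E. l \<le> cl e} = ?A \<union> ?B" by (auto simp: Suc_le_eq)
  have split: "?f e = single (column_monomial e l) 1 + ?g e" for e
    using l D by (intro lss_columns_split) simp
  interpret monomial_order "column_order l" by (rule column_monomial_order)
  have lmf: "lm (?f e) = column_monomial e (cl e)" if "e \<in> ?A \<union> ?B" for e
    using that cl[of e] l D by (intro lm_lss_columns) auto
  have lmg: "lm (?g e) = column_monomial e (cl e)" if "e \<in> ?B" for e
    using that cl[of e] l D by (intro lm_lss_columns) auto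
  have nz: "column_monomial e j \<noteq> 0" if "e \<in> E" for e j
  proof -
    have "keys (column_monomial e j) \<noteq> {}"
      unfolding keys_column_monomial[OF finite_edge[OF that]] using edge_nonempty[OF that] by simp
    then show ?thesis by auto
  qed
  have VW: "column_vars l D - column_vars (Suc l) D = {1..n} \<times> {l}"
    using l D by (auto simp: column_vars_def)
  have "prime_extension (column_order l) (column_vars l D) ?A ?B ?f (column_key l)
    (column_vars (Suc l) D) ?g (single 0 (int r))"
  proof (intro prime_extension.intro prime_extension_axioms.intro)
    show "coprime_leading_family (column_order l) (column_vars l D) (?A \<union> ?B) ?f"
      using lss_columns_family[OF l(1) order_refl, of D] D unfolding AB by simp
    show "additive_key (column_key l)" by (rule additive_column_key)
    show "column_order l a b" if "column_key l a < column_key l b" for a b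
      using that by (simp add: column_order_rec[OF l(2)] refine_def)
    show "column_vars (Suc l) D \<subseteq> column_vars l D" by (auto simp: column_vars_def)
    show "?g e \<in> polys (column_vars (Suc l) D)" if "e \<in> ?A \<union> ?B" for e
      using that by (intro lss_columns_polys) auto
    show "key_homogeneous (column_key l) (single 0 (int r)) (?g e)" if "e \<in> ?A \<union> ?B" for e
      using that by (auto simp: key_homogeneous_def keys_lss_columns finite_edge edge_nonempty column_key_column_monomial)
    show "?g e \<noteq> 0" if "e \<in> ?B" for e
    proof -
      have "keys (?g e) \<noteq> {}"
        using that l D by (auto simp: keys_lss_columns finite_edge edge_nonempty)
      then show ?thesis by auto
    qed
    show "?f e = single (lm (?f e)) 1 + ?g e" if "e \<in> ?A" for e
      using that lmf[of e] split[of e] by simp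
    show "keys (lm (?f e)) \<subseteq> column_vars l D - column_vars (Suc l) D" if "e \<in> ?A" for e
      using that lmf[of e] edge[of e] unfolding VW by (auto simp: keys_column_monomial finite_edge)
    show "lm (?f e) \<noteq> 0" if "e \<in> ?A" for e using that lmf[of e] nz by simp
    show "column_key l (lm (?f e)) = single 0 (int r)" if "e \<in> ?A" for e
      using that lmf[of e] by (simp add: column_key_column_monomial)
    show "?g e \<notin> Idl\<^bsub>mpoly_ring (column_vars (Suc l) D)\<^esub> (?g ` ?B)" if "e \<in> ?A" for e
      using that l D by (intro lss_columns_not_in_ideal) auto
    show "key_below (column_key l) (single 0 (int r)) (?f e - ?g e)" if "e \<in> ?B" for e
      unfolding split using that column_key_later[of e l] l by (simp add: key_below_def)
    show "lm (?f e) = lm (?g e)" if "e \<in> ?B" for e using that lmf[of e] lmg[of e] by simp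
    show "lm (?f e) \<noteq> 0" if "e \<in> ?B" for e using that lmf[of e] nz by simp
    show "lookup a x = lookup b x"
      if ab: "column_key l a = column_key l b" "\<And>e. e \<in> ?A \<Longrightarrow> \<not> mdvd (lm (?f e)) a"
        "\<And>e. e \<in> ?A \<Longrightarrow> \<not> mdvd (lm (?f e)) b" "x \<in> column_vars l D - column_vars (Suc l) D" for a b x
    proof -
      obtain i where x: "x = (i, l)" "i \<in> {1..n}" using ab(4) unfolding VW by auto
      show ?thesis
        unfolding x(1)
      proof (rule column_key_separates[OF ab(1) x(2)])
        fix e assume e: "e \<in> E" "cl e = l"
        then have "lm (?f e) = column_monomial e l" using lmf[of e] by simp
        then show "\<not> mdvd (column_monomial e l) a" "\<not> mdvd (column_monomial e l) b"
          using ab(2,3)[of e] e by simp_all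
      qed
    qed
  qed (rule IH)
  then show ?thesis unfolding AB by (rule prime_extension.span_prime)
qed

text \<open>Starting from the columns after the \<open>d\<close>-th, where no edge is left and the zero ideal is prime.\<close>

lemma prime_from_column:
  assumes "1 \<le> l" "l \<le> Suc d" "d < D"
  shows "primeideal (Idl\<^bsub>mpoly_ring (column_vars l D)\<^esub>
      ((lss_columns l D :: _ \<Rightarrow> (_, 'k::field) mpoly) ` {e \<in> E. l \<le> cl e})) (mpoly_ring (column_vars l D))"
  using assms(2,1)
proof (induction rule: inc_induct)
  case base
  have none: "{e \<in> E. Suc d \<le> cl e} = {}" using cl by fastforce
  have Z: "ideal {0 :: (nat \<times> nat, 'k) mpoly} (mpoly_ring (column_vars (Suc d) D))"
    by (rule mpoly_idealI) auto
  have "primeideal {0 :: (nat \<times> nat, 'k) mpoly} (mpoly_ring (column_vars (Suc d) D))"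
  proof (rule primeidealI[OF Z cring_mpoly_ring])
    show "polys (column_vars (Suc d) D) \<noteq> {0 :: (nat \<times> nat, 'k) mpoly}"
      using polys_1 by (metis singletonD zero_neq_one)
    show "a \<in> {0} \<or> b \<in> {0}" if "a \<otimes>\<^bsub>mpoly_ring (column_vars (Suc d) D)\<^esub> b \<in> {0}" for a b :: "(nat \<times> nat, 'k) mpoly"
      using that by simp
  qed
  moreover have "Idl\<^bsub>mpoly_ring (column_vars (Suc d) D)\<^esub> {} = {0 :: (nat \<times> nat, 'k) mpoly}"
    using mpoly_genideal(3)[OF _ Z, of "{}"] ideal_0[OF mpoly_genideal(1)[of "{}" "column_vars (Suc d) D"]] by auto
  ultimately show ?case unfolding none image_empty by simp
next
  case (step l)
  then show ?case using prime_step[of l D] assms(3) by simp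
qed

lemma lss_ideal_columns:
  "(lss_ideal n E D :: (nat \<times> nat, 'k::field) mpoly set) = Idl\<^bsub>mpoly_ring (column_vars 1 D)\<^esub> (lss_columns 1 D ` {e \<in> E. 1 \<le> cl e})"
proof -
  have "{e \<in> E. 1 \<le> cl e} = E" using cl by blast
  moreover have "(lss_poly D :: _ \<Rightarrow> (_, 'k) mpoly) ` E = lss_columns 1 D ` E"
    by (rule image_cong) (simp_all add: lss_poly_eq finite_edge)
  ultimately show ?thesis
    unfolding lss_ideal_def lss_vars_def column_vars_def by simp
qed

theorem lss_ideal_prime:
  assumes "d < D"
  shows "primeideal (lss_ideal n E D :: (nat \<times> nat, 'k::field) mpoly set) (mpoly_ring (lss_vars n D))"
  using prime_from_column[of 1 D] assms unfolding lss_ideal_columns by (simp add: lss_vars_def column_vars_def)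

theorem lss_ideal_radical_complete_intersection:
  assumes "d \<le> D"
  shows "radical_ideal (lss_ideal n E D :: (nat \<times> nat, 'k::field) mpoly set) (mpoly_ring (lss_vars n D))"
    "complete_intersection (lss_vars n D) (lss_ideal n E D :: (nat \<times> nat, 'k) mpoly set)"
proof -
  let ?f = "lss_columns 1 D :: _ \<Rightarrow> (_, 'k) mpoly"
  interpret F: coprime_leading_family "column_order 1" "column_vars 1 D" "{e \<in> E. 1 \<le> cl e}" ?f
    using lss_columns_family[of 1 1 D] assms by simp
  have lm: "F.lm (?f e) = column_monomial e (cl e)" if "e \<in> E" for e
    using cl[OF that] assms by (intro lm_lss_columns that) auto
  have vars: "lss_vars n D = column_vars 1 D" by (simp add: lss_vars_def column_vars_def)
  have sqfree: "lookup (column_monomial e j) x \<le> 1" if "e \<in> E" for e j x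
    by (cases x) (simp add: lookup_column_monomial finite_edge that)
  show "radical_ideal (lss_ideal n E D :: (nat \<times> nat, 'k) mpoly set) (mpoly_ring (lss_vars n D))"
    unfolding lss_ideal_columns vars 
  proof (rule F.radical_span)
    show "lookup (F.lm (?f e)) x \<le> 1" if "e \<in> {e \<in> E. 1 \<le> cl e}" for e x
      using lm[of e] sqfree[of e] that by auto
  qed
  show "complete_intersection (lss_vars n D) (lss_ideal n E D :: (nat \<times> nat, 'k) mpoly set)"
    unfolding lss_ideal_columns vars
  proof (rule F.complete_intersection_span)
    fix e assume e: "e \<in> {e \<in> E. 1 \<le> cl e}"
    have "keys (column_monomial e (cl e)) \<noteq> {}"
      using e by (simp add: keys_column_monomial finite_edge edge_nonempty)
    then show "F.lm (?f e) \<noteq> 0" using lm e by auto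
    show "mdeg m = r" if "m \<in> keys (?f e)" for m
      using that e by (auto simp: keys_lss_columns finite_edge edge_nonempty mdeg_column_monomial card_edge)
  qed
qed

end

section \<open>The matching decomposition of triples\<close>

definition triple_class :: "nat set \<Rightarrow> nat \<times> nat" where
  "triple_class e = (\<Sum>e - Max e, \<Sum>e - Min e)"

lemma sorted_triple:
  fixes e :: "nat set"
  assumes "card e = 3"
  obtains i j k where "i < j" "j < k" "e = {i, j, k}"
proof -
  obtain x y z where e: "e = {x, y, z}" "x \<noteq> y" "y \<noteq> z" "x \<noteq> z"
    using assms unfolding card_3_iff by blast
  consider "x < y \<and> y < z" | "x < z \<and> z < y" | "y < x \<and> x < z" | "y < z \<and> z < x"
    | "z < x \<and> x < y" | "z < y \<and> y < x" using e(2-) by linarith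
  then show ?thesis by cases (use that e(1) in blast)+
qed

lemma triple_class_sorted: "i < j \<Longrightarrow> j < k \<Longrightarrow> triple_class {i, j, k} = (i + j, j + k)"
  by (simp add: triple_class_def)

text \<open>A common vertex in the same position forces both triples to agree. In different positions it
  contradicts one of the two equal sums.\<close>

lemma triple_classes_matching:
  assumes "card e = 3" "card e' = 3" "triple_class e = triple_class e'" "e \<noteq> e'"
  shows "e \<inter> e' = {}"
proof -
  obtain i j k where e: "i < j" "j < k" "e = {i, j, k}" using sorted_triple assms(1) by blast
  obtain i' j' k' where e': "i' < j'" "j' < k'" "e' = {i', j', k'}" using sorted_triple assms(2) by blast
  have eq: "i + j = i' + j'" "j + k = j' + k'"
    using assms(3) e e' by (simp_all add: triple_class_sorted)
  have ne: "i \<noteq> i' \<and> j \<noteq> j' \<and> k \<noteq> k'" using assms(4) e(3) e'(3) eq by auto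
  then have "i \<noteq> j' \<and> i \<noteq> k' \<and> j \<noteq> i' \<and> j \<noteq> k' \<and> k \<noteq> i' \<and> k \<noteq> j'"
    using eq e(1,2) e'(1,2) by linarith
  with ne show ?thesis unfolding e(3) e'(3) by auto
qed

text \<open>The triples \<open>i < j < k\<close> of the class \<open>(s, t)\<close> have \<open>i\<close>, \<open>j\<close> and \<open>k\<close> in the three open intervals with ends
  \<open>s - t/2\<close>, \<open>s/2\<close>, \<open>t/2\<close> and \<open>t - s/2\<close>. Up to the levels \<open>- a\<^sup>2\<close>, \<open>0\<close> and \<open>a\<^sup>2\<close>, which force one vertex in each
  interval, the weight of a triple with one vertex in each is \<open>a * (i + j - s) + (j + k - t)\<close>. Because \<open>a\<close> exceeds
  \<open>2 * n\<close>, the sign of this number is decided by the lexicographic comparison of pairs. Vertices outside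
  the intervals are penalised.\<close>

definition triple_weight :: "nat \<Rightarrow> nat \<times> nat \<Rightarrow> nat \<Rightarrow> int" where
  "triple_weight n q i = (let s = int (fst q); t = int (snd q); a = 2 * int n + 1; x = int i in
     if 2 * s - t < 2 * x \<and> 2 * x < s then - (a * a) + a * (x - s)
     else if s < 2 * x \<and> 2 * x < t then a * x + (x - t)
     else if t < 2 * x \<and> 2 * x < 2 * t - s then a * a + x
     else - 5 * (a * a))"

lemma triple_weight_zero:
  assumes "i < j" "j < k"
  shows "(\<Sum>x\<in>{i, j, k}. triple_weight n (i + j, j + k) x) = 0"
proof -
  have "triple_weight n (i + j, j + k) i = - ((2 * int n + 1) * (2 * int n + 1)) + (2 * int n + 1) * (- int j)"
    "triple_weight n (i + j, j + k) j = (2 * int n + 1) * int j - int k"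
    "triple_weight n (i + j, j + k) k = (2 * int n + 1) * (2 * int n + 1) + int k"
    using assms by (simp_all add: triple_weight_def Let_def)
  then show ?thesis using assms by simp
qed

text \<open>As \<open>i + j \<le> s\<close>, the smallest vertex lies in the first interval or is penalised, and in the former case
  \<open>j\<close> is not in the third interval. Of the remaining combinations only one vertex in each interval has
  level sum zero.\<close>

lemma triple_weight_neg:
  assumes ijk: "i < j" "j < k" "k \<le> n" and less: "(i + j, j + k) < (s, t)"
  shows "(\<Sum>x\<in>{i, j, k}. triple_weight n (s, t) x) < 0"
proof -
  define a where "a = 2 * int n + 1"
  define N where "N = a * a"
  define M where "M = a * int n + int n"
  have N: "2 * M < N" "int n \<le> M" "0 \<le> M"
    unfolding N_def M_def a_def by (simp_all add: algebra_simps)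
  let ?w = "triple_weight n (s, t)"
  let ?A = "\<lambda>x::nat. 2 * int s - int t < 2 * int x \<and> 2 * int x < int s"
  let ?B = "\<lambda>x::nat. int s < 2 * int x \<and> 2 * int x < int t"
  let ?C = "\<lambda>x::nat. int t < 2 * int x \<and> 2 * int x < 2 * int t - int s"
  have wA: "?w x = - N + a * (int x - int s)" if "?A x" for x
    using that by (simp add: triple_weight_def Let_def N_def a_def)
  have wB: "?w x = a * int x + (int x - int t)" if "?B x" for x
    using that by (simp add: triple_weight_def Let_def a_def)
  have wC: "?w x = N + int x" if "?C x" for x
  proof -
    have "\<not> ?A x" "\<not> ?B x" using that by linarith+
    then show ?thesis using that by (auto simp: triple_weight_def Let_def N_def a_def)
  qed
  have wO: "?w x = - 5 * N" if "\<not> ?A x" "\<not> ?B x" "\<not> ?C x" for x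
    using that unfolding triple_weight_def Let_def N_def a_def fst_conv snd_conv by argo
  have leA: "?w x \<le> - N" if "?A x" for x
  proof -
    have "int x - int s \<le> 0" using that by linarith
    then have "a * (int x - int s) \<le> 0" unfolding a_def by (intro mult_nonneg_nonpos) auto
    then show ?thesis using wA[OF that] by linarith
  qed
  have leB: "?w x \<le> M" if "?B x" "x \<le> n" for x
  proof -
    have "a * int x \<le> a * int n" unfolding a_def using that(2) by (intro mult_left_mono) auto
    then show ?thesis using wB[OF that(1)] that(2) unfolding M_def by linarith
  qed
  have le: "?w x \<le> N + M" if "x \<le> n" for x
    using leA[of x] leB[of x] wC[of x] wO[of x] that N by linarith
  have s: "int i + int j < int s \<or> int i + int j = int s \<and> int j + int k < int t"
    using less by auto
  have n: "i \<le> n" "j \<le> n" using ijk by auto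
  have "?w i + ?w j + ?w k < 0"
  proof (cases "?A i")
    case False
    then have wi: "?w i = - 5 * N" using s ijk by (intro wO) linarith+
    show ?thesis using wi le[OF n(2)] le[OF ijk(3)] N by linarith
  next
    case Ai: True
    \<comment> \<open>i is in the first interval and i + j is at most s, hence 2 j < t\<close>
    have nC: "\<not> ?C j" using s Ai by linarith
    consider "?A j" | "?B j" | "\<not> ?A j" "\<not> ?B j" by blast
    then show ?thesis
    proof cases
      case 1
      show ?thesis using leA[OF Ai] leA[OF 1] le[OF ijk(3)] N by linarith
    next
      case 3
      then show ?thesis using leA[OF Ai] wO[OF 3 nC] le[OF ijk(3)] N by linarith
    next
      case Bj: 2
      consider "?C k" | "?B k" | "\<not> ?C k" "\<not> ?B k" by blast
      then show ?thesis
      proof cases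
        case 1
        have eq: "?w i + ?w j + ?w k = a * (int i + int j - int s) + (int j + int k - int t)"
          unfolding wA[OF Ai] wB[OF Bj] wC[OF 1] by (simp add: algebra_simps)
        show ?thesis
        proof (cases "int i + int j < int s")
          case True
          then have "a * (int i + int j - int s) \<le> a * (- 1)" unfolding a_def by (intro mult_left_mono) auto
          moreover have "int j + int k - int t < a" unfolding a_def using ijk n by linarith
          ultimately show ?thesis unfolding eq by simp
        next
          case False
          then show ?thesis unfolding eq using s by auto
        qed
      next
        case 2
        show ?thesis using leA[OF Ai] leB[OF Bj n(2)] leB[OF 2 ijk(3)] N by linarith
      next
        case 3
        have "\<not> ?A k" using Bj ijk by linarith
        then show ?thesis using leA[OF Ai] leB[OF Bj n(2)] wO[OF _ 3(2,1)] N by auto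
      qed
    qed
  qed
  then show ?thesis using ijk by simp
qed

definition triple_classes :: "nat \<Rightarrow> (nat \<times> nat) set" where
  "triple_classes n = triple_class ` {e. e \<subseteq> {1..n} \<and> card e = 3}"

lemma finite_triple_classes: "finite (triple_classes n)"
  by (simp add: triple_classes_def)

lemma sum_descending: "k \<le> c \<Longrightarrow> real (\<Sum>h<k. c - h) = real c * real k - real k * (real k - 1) / 2"
  by (induction k) (auto simp: algebra_simps of_nat_diff add_divide_distrib diff_divide_distrib)

text \<open>Sort the pairs \<open>(i + j, j + k)\<close> by the gap \<open>k - i\<close>. For the gap \<open>2\<close> one has \<open>j = i + 1\<close>, and there are
  \<open>n - 2\<close> pairs. For a gap \<open>g > 2\<close> the sum \<open>i + j\<close> lies between \<open>3\<close> and \<open>2 * n - g - 1\<close> and determines the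
  pair. In the proof \<open>n = m + 3\<close> and \<open>g = h + 3\<close>.\<close>

lemma card_triple_classes:
  assumes "n \<ge> 3"
  shows "real (card (triple_classes n)) \<le> 3/2 * (real n)^2 - 15/2 * real n + 10"
proof -
  obtain m where m: "n = m + 3" using assms le_Suc_ex by (metis add.commute)
  let ?S = "SIGMA h:{..<m}. {..<2 * m - h}"
  let ?S1 = "(\<lambda>(h, u). (u + 3, u + h + 6)) ` ?S" and ?S2 = "(\<lambda>i. (2 * i + 3, 2 * i + 5)) ` {..m}"
  have "triple_classes n \<subseteq> ?S1 \<union> ?S2"
  proof
    fix q assume "q \<in> triple_classes n"
    then obtain e where e: "q = triple_class e" "e \<subseteq> {1..n}" "card e = 3" by (auto simp: triple_classes_def)
    obtain i j k where ijk: "i < j" "j < k" "e = {i, j, k}" using sorted_triple[OF e(3)] by blast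
    have q: "q = (i + j, j + k)" using e(1) ijk triple_class_sorted by simp
    have range: "1 \<le> i" "k \<le> m + 3" using e(2) ijk(3) m by auto
    show "q \<in> ?S1 \<union> ?S2"
    proof (cases "k = i + 2")
      case True
      then have "q = (2 * (i - 1) + 3, 2 * (i - 1) + 5)" "i - 1 \<le> m" using q ijk range by auto
      then show ?thesis by blast
    next
      case False
      then have "q = (\<lambda>(h, u). (u + 3, u + h + 6)) (k - i - 3, i + j - 3)"
        "(k - i - 3, i + j - 3) \<in> ?S" using q ijk range by auto
      then show ?thesis by blast
    qed
  qed
  then have "card (triple_classes n) \<le> card (?S1 \<union> ?S2)" by (intro card_mono) auto
  also have "\<dots> \<le> card ?S1 + card ?S2" by (rule card_Un_le)
  also have "\<dots> \<le> card ?S + (m + 1)"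
    by (intro add_mono card_image_le[THEN order_trans]) auto
  also have "card ?S = (\<Sum>h<m. 2 * m - h)" by simp
  finally have "real (card (triple_classes n)) \<le> real (\<Sum>h<m. 2 * m - h) + (real m + 1)"
    by (metis (no_types, lifting) of_nat_1 of_nat_add of_nat_le_iff)
  also have "\<dots> = 3/2 * (real n)^2 - 15/2 * real n + 10"
    by (subst sum_descending) (simp_all add: m power2_eq_square field_simps)
  finally show ?thesis .
qed

text \<open>Position of a class in the lexicographically decreasing enumeration, starting with \<open>1\<close>.\<close>

definition class_rank :: "nat \<Rightarrow> nat \<times> nat \<Rightarrow> nat" where
  "class_rank n q = card {q' \<in> triple_classes n. q \<le> q'}"

lemma class_rank_less:
  assumes "q \<in> triple_classes n" "q < q'"
  shows "class_rank n q' < class_rank n q"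
  unfolding class_rank_def
proof (rule psubset_card_mono)
  have "q \<in> {x \<in> triple_classes n. q \<le> x}" "q \<notin> {x \<in> triple_classes n. q' \<le> x}" using assms by auto
  moreover have "{x \<in> triple_classes n. q' \<le> x} \<subseteq> {x \<in> triple_classes n. q \<le> x}" using assms(2) by auto
  ultimately show "{x \<in> triple_classes n. q' \<le> x} \<subset> {x \<in> triple_classes n. q \<le> x}" by blast
qed (simp add: finite_triple_classes)

lemma class_rank_bij: "bij_betw (class_rank n) (triple_classes n) {1..card (triple_classes n)}"
proof -
  have inj: "inj_on (class_rank n) (triple_classes n)"
  proof (rule inj_onI, rule ccontr)
    fix q q' assume q: "q \<in> triple_classes n" "q' \<in> triple_classes n" "class_rank n q = class_rank n q'" "q \<noteq> q'"
    then have "q < q' \<or> q' < q" by auto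
    then show False using class_rank_less[of q n q'] class_rank_less[of q' n q] q by auto
  qed
  moreover have "class_rank n ` triple_classes n \<subseteq> {1..card (triple_classes n)}"
  proof
    fix l assume "l \<in> class_rank n ` triple_classes n"
    then obtain q where q: "q \<in> triple_classes n" "l = class_rank n q" by blast
    have "class_rank n q \<le> card (triple_classes n)"
      unfolding class_rank_def by (intro card_mono finite_triple_classes) auto
    moreover have "q \<in> {q' \<in> triple_classes n. q \<le> q'}" using q(1) by simp
    then have "{q' \<in> triple_classes n. q \<le> q'} \<noteq> {}" by blast
    then have "0 < class_rank n q"
      unfolding class_rank_def using finite_triple_classes[of n] by (simp add: card_gt_0_iff)
    ultimately show "l \<in> {1..card (triple_classes n)}" using q(2) by simp
  qed
  ultimately show ?thesis
    unfolding bij_betw_def by (metis card_atLeastAtMost card_image card_subset_eq diff_Suc_1 finite_atLeastAtMost)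
qed

lemma triple_matching_decomposition:
  assumes E: "\<And>e. e \<in> E \<Longrightarrow> e \<subseteq> {1..n}" "\<And>e. e \<in> E \<Longrightarrow> card e = 3"
    and d: "card (triple_classes n) \<le> d"
  shows "matching_decomposition n d 3 E (\<lambda>e. class_rank n (triple_class e))
    (\<lambda>l. triple_weight n (inv_into (triple_classes n) (class_rank n) l))"
proof
  note bij = class_rank_bij[of n]
  have inj: "inj_on (class_rank n) (triple_classes n)" and
    img: "class_rank n ` triple_classes n = {1..card (triple_classes n)}"
    using bij by (auto simp: bij_betw_def)
  have mem: "triple_class e \<in> triple_classes n" if "e \<in> E" for e
    using E[OF that] by (auto simp: triple_classes_def)
  show "e \<subseteq> {1..n}" "card e = 3" if "e \<in> E" for e using E that by auto
  show "1 \<le> class_rank n (triple_class e) \<and> class_rank n (triple_class e) \<le> d" if "e \<in> E" for e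
    using img mem[OF that] d by (metis atLeastAtMost_iff imageI le_trans)
  show "e \<inter> e' = {}" if "e \<in> E" "e' \<in> E" "class_rank n (triple_class e) = class_rank n (triple_class e')" "e \<noteq> e'" for e e'
  proof (rule triple_classes_matching)
    show "triple_class e = triple_class e'" using inj_onD[OF inj that(3)] mem that by blast
  qed (use E that in auto)
  show "(\<Sum>i\<in>e. triple_weight n (inv_into (triple_classes n) (class_rank n) (class_rank n (triple_class e))) i) = 0"
    if e: "e \<in> E" for e
  proof -
    obtain i j k where "i < j" "j < k" "e = {i, j, k}" using sorted_triple[OF E(2)[OF e]] by blast
    then show ?thesis
      unfolding inv_into_f_f[OF inj mem[OF e]] using triple_weight_zero triple_class_sorted by simp
  qed
  show "(\<Sum>i\<in>e. triple_weight n (inv_into (triple_classes n) (class_rank n) l) i) < 0"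
    if e: "e \<in> E" "1 \<le> l" "l < class_rank n (triple_class e)" for e l
  proof -
    obtain i j k where ijk: "i < j" "j < k" "e = {i, j, k}" using sorted_triple[OF E(2)[OF e(1)]] by blast
    have "class_rank n (triple_class e) \<in> {1..card (triple_classes n)}"
      using img mem[OF e(1)] by blast
    then have "l \<in> class_rank n ` triple_classes n" unfolding img using e by simp
    then obtain q where q: "q \<in> triple_classes n" "class_rank n q = l" by blast
    have "\<not> q \<le> triple_class e"
      using class_rank_less[OF q(1), of "triple_class e"] q(2) e(3) by (auto simp: order_le_less)
    then have "(i + j, j + k) < q" using ijk triple_class_sorted[of i j k] by simp
    moreover have "k \<le> n" using E(1)[OF e(1)] ijk(3) by auto
    ultimately have "(\<Sum>x\<in>{i, j, k}. triple_weight n (fst q, snd q) x) < 0"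
      by (intro triple_weight_neg ijk) simp_all
    moreover have "inv_into (triple_classes n) (class_rank n) l = q"
      using inv_into_f_f[OF inj q(1)] q(2) by simp
    ultimately show ?thesis using ijk(3) by simp
  qed
qed simp

theorem theorem1p1:
  fixes n d :: nat and E :: "nat set set"
  assumes "hypergraph {1..n} E"
    and "uniform 3 E"
    and "d \<ge> 1"
    and "real d \<ge> 3/2 * (real n)^2 - 15/2 * real n + 10"
  shows "radical_ideal (lss_ideal n E d :: (nat \<times> nat, 'k::field) mpoly set)
           (mpoly_ring (lss_vars n d)) \<and>
         complete_intersection (lss_vars n d)
           (lss_ideal n E d :: (nat \<times> nat, 'k) mpoly set) \<and>
         primeideal (lss_ideal n E (d + 1) :: (nat \<times> nat, 'k) mpoly set)
           (mpoly_ring (lss_vars n (d + 1)))"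
proof -
  have E: "e \<subseteq> {1..n}" "card e = 3" if "e \<in> E" for e
    using assms(1,2) that by (auto simp: hypergraph_def uniform_def)
  have d: "card (triple_classes n) \<le> d"
  proof (cases "n \<ge> 3")
    case True
    then show ?thesis using card_triple_classes[OF True] assms(4) by linarith
  next
    case False
    have "card e \<noteq> 3" if "e \<subseteq> {1..n}" for e :: "nat set"
      using card_mono[OF finite_atLeastAtMost that] False by simp
    then have "{e. e \<subseteq> {1..n} \<and> card e = 3} = {}" by blast
    then show ?thesis unfolding triple_classes_def by (simp only: image_empty card.empty)
  qed
  interpret matching_decomposition n d 3 E "\<lambda>e. class_rank n (triple_class e)"
    "\<lambda>l. triple_weight n (inv_into (triple_classes n) (class_rank n) l)"
    by (rule triple_matching_decomposition[OF E d])
  show ?thesis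
    using lss_ideal_radical_complete_intersection[OF order_refl] lss_ideal_prime[of "d + 1"] by simp
qed

end
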